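(* Let $s\in\mathbb Z\setminus\{0\}$. For every square integrable, isotropic, (complex) Gaussian random section $T$ of the homogeneous spin $s$ line bundle $\xi_s$ on $\mathbb S^2$, there exists a square integrable and bi-$s$-associated function $f$ on $SO(3)$ such that $T^f$ and $T$ have the same law. Such a function $f$ is not unique.
   Context: Let $K\cong SO(2)$ be the subgroup of $SO(3)$ fixing the north pole, so $\mathbb S^2\cong SO(3)/K$, and for $s\in\mathbb Z$ let $\chi_s(k)=e^{is\vartheta(k)}$ be the $s$-th character of $K$ ($\vartheta(k)$ the rotation angle). $K$ acts on $SO(3)\times\mathbb C$ by $k(g,z)=(gk,\chi_s(k^{-1})z)$; let $\theta(g,z)$ be the orbit of $(g,z)$ and $\mathcal E_s$ the space of orbits. The line bundle $\xi_s=(\mathcal E_s,\pi_s,\mathbb S^2)$ has projection $\pi_s(\theta(g,z))=gK$; the inner product of $\theta(g,z),\theta(g,w)$ in the fiber is $z\overline w$. $SO(3)$ acts by $h\theta(g,z)=\theta(hg,z)$ and on sections by $U_hu(x)=hu(h^{-1}x)$. A random section $T$ is a measurable family $(T_x)_{x\in\mathbb S^2}$ with each path $x\mapsto T_x(\omega)$ a section of $\xi_s$. Its pullback is the unique random field $X$ on $SO(3)$ with $T_{gK}=\theta(g,X_g)$; it satisfies $X_{gk}=\chi_s(k^{-1})X_g$. $T$ is square integrable if $\int_{\mathbb S^2}\|T_x\|^2dx<\infty$ a.s. For a square integrable section $u$, $T(u)=\int_{\mathbb S^2}\langle T_x,u(x)\rangle_{\pi_s^{-1}(x)}dx$. $T$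 is isotropic if $(T(u_1),\dots,T(u_m))$ and $(T(U_gu_1),\dots,T(U_gu_m))$ have the same law for all $g\in SO(3)$, $m$ and square integrable sections $u_i$; it is complex Gaussian if every $T(u)$ is a complex Gaussian variable (real and imaginary parts independent Gaussian with the same variance). Two random sections $T,T'$ have the same law if $(T(u_1),\dots,T(u_m))$ and $(T'(u_1),\dots,T'(u_m))$ have the same law for all $m$ and all square integrable sections $u_i$. A function $f\in L^2(SO(3))$ is bi-$s$-associated if $f(k_1gk_2)=\chi_s(k_1)f(g)\chi_s(k_2)$ for $g\in SO(3)$, $k_1,k_2\in K$. White noise: with $(e_n)$ an orthonormal basis of $L^2(SO(3))$ consisting of real functions and $(X_n)$ i.i.d. standard real Gaussian variables, $S(\sum_k\alpha_ke_k)=\sum_k\alpha_kX_k$ for complex $\alpha_k$. With $L_gf(h)=f(g^{-1}h)$, set $X^f_g=S(L_gf)$ (jointly measurable version) and $T^f_{gK}=\theta(g,X^f_g)$, which is a random section of $\xi_s$.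
   Formalization: The non-uniqueness of f is claimed only for random sections T that are not almost surely zero (almost everywhere); for T = 0 the only representing f in L^2(SO(3)) is f = 0. Non-unique means two functions f that are not almost everywhere equal. *)

theory Defs
  imports "HOL-Analysis.Analysis" "HOL-Probability.Probability"
begin

definition SO3 :: "(real^3^3) set" where
  "SO3 = {g. rotation_matrix g}"

definition north :: "real^3" where
  "north = axis 3 1"

definition K_north :: "(real^3^3) set" where
  "K_north = {k \<in> SO3. k *v north = north}"

text \<open>An element of \<open>K_north\<close> with angle \<open>a\<close> sends the first basis vector to \<open>(cos a, sin a, 0)\<close>, which is
  its first column. The angle is determined only modulo \<open>2 * pi\<close>; this does not matter for integer \<open>s\<close>.\<close>

definition rot_angle :: "real^3^3 \<Rightarrow> real" where
  "rot_angle k = Arg (Complex (k $ 1 $ 1) (k $ 2 $ 1))"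

definition chi :: "int \<Rightarrow> real^3^3 \<Rightarrow> complex" where
  "chi s k = exp (\<i> * of_int s * complex_of_real (rot_angle k))"

definition is_haar_SO3 :: "(real^3^3) measure \<Rightarrow> bool" where
  "is_haar_SO3 \<mu> \<longleftrightarrow> prob_space \<mu> \<and> sets \<mu> = sets (restrict_space borel SO3) \<and>
     (\<forall>g\<in>SO3. distr \<mu> \<mu> (\<lambda>h. g ** h) = \<mu>)"

definition haar_SO3 :: "(real^3^3) measure" where
  "haar_SO3 = (THE \<mu>. is_haar_SO3 \<mu>)"

text \<open>The coset \<open>g K_north\<close> is identified with the point \<open>g *v north\<close> of the unit sphere. The measure \<open>dx\<close> is the
  image of the Haar measure, i.e. surface measure normalised to total mass one.\<close>

abbreviation S2 :: "(real^3) set" where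
  "S2 \<equiv> sphere 0 1"

definition S2_measure :: "(real^3) measure" where
  "S2_measure = distr haar_SO3 (restrict_space borel S2) (\<lambda>g. g *v north)"

text \<open>A point of the total space is an orbit, represented as a set of pairs.\<close>

type_synonym bundle_point = "((real^3^3) \<times> complex) set"

definition theta :: "int \<Rightarrow> real^3^3 \<Rightarrow> complex \<Rightarrow> bundle_point" where
  "theta s g z = {(g ** k, chi s (matrix_inv k) * z) | k. k \<in> K_north}"

definition spin_bundle :: "int \<Rightarrow> bundle_point set" where
  "spin_bundle s = {theta s g z | g z. g \<in> SO3}"

definition bundle_proj :: "bundle_point \<Rightarrow> real^3" where
  "bundle_proj p = (THE x. \<exists>(g, z)\<in>p. x = g *v north)"

text \<open>The Borel \<open>\<sigma>\<close>-algebra of the quotient topology on the orbit space.\<close>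

definition bundle_borel :: "int \<Rightarrow> bundle_point measure" where
  "bundle_borel s = sigma (spin_bundle s)
     {A. A \<subseteq> spin_bundle s \<and>
         openin (top_of_set (SO3 \<times> UNIV)) {(g, z). g \<in> SO3 \<and> theta s g z \<in> A}}"

definition fiber_inner :: "int \<Rightarrow> bundle_point \<Rightarrow> bundle_point \<Rightarrow> complex" where
  "fiber_inner s p q =
     (THE c. \<exists>g z w. g \<in> SO3 \<and> p = theta s g z \<and> q = theta s g w \<and> c = z * cnj w)"

definition fiber_norm :: "int \<Rightarrow> bundle_point \<Rightarrow> real" where
  "fiber_norm s p = sqrt (Re (fiber_inner s p p))"

definition bundle_act :: "real^3^3 \<Rightarrow> bundle_point \<Rightarrow> bundle_point" where
  "bundle_act h p = (\<lambda>(g, z). (h ** g, z)) ` p"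

definition is_section :: "int \<Rightarrow> (real^3 \<Rightarrow> bundle_point) \<Rightarrow> bool" where
  "is_section s u \<longleftrightarrow> (\<forall>x\<in>S2. u x \<in> spin_bundle s \<and> bundle_proj (u x) = x)"

definition L2_section :: "int \<Rightarrow> (real^3 \<Rightarrow> bundle_point) \<Rightarrow> bool" where
  "L2_section s u \<longleftrightarrow> is_section s u \<and> u \<in> measurable S2_measure (bundle_borel s) \<and>
     (\<integral>\<^sup>+x. ennreal ((fiber_norm s (u x))\<^sup>2) \<partial>S2_measure) < \<infinity>"

definition section_act :: "real^3^3 \<Rightarrow> (real^3 \<Rightarrow> bundle_point) \<Rightarrow> real^3 \<Rightarrow> bundle_point" where
  "section_act h u x = bundle_act h (u (matrix_inv h *v x))"

definition random_section :: "int \<Rightarrow> 'w measure \<Rightarrow> (real^3 \<Rightarrow> 'w \<Rightarrow> bundle_point) \<Rightarrow> bool" where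
  "random_section s M T \<longleftrightarrow> prob_space M \<and>
     (\<lambda>(x, \<omega>). T x \<omega>) \<in> measurable (S2_measure \<Otimes>\<^sub>M M) (bundle_borel s) \<and>
     (\<forall>\<omega>\<in>space M. is_section s (\<lambda>x. T x \<omega>))"

definition sq_integrable_random_section ::
    "int \<Rightarrow> 'w measure \<Rightarrow> (real^3 \<Rightarrow> 'w \<Rightarrow> bundle_point) \<Rightarrow> bool" where
  "sq_integrable_random_section s M T \<longleftrightarrow>
     (AE \<omega> in M. (\<integral>\<^sup>+x. ennreal ((fiber_norm s (T x \<omega>))\<^sup>2) \<partial>S2_measure) < \<infinity>)"

definition pairing ::
    "int \<Rightarrow> (real^3 \<Rightarrow> 'w \<Rightarrow> bundle_point) \<Rightarrow> (real^3 \<Rightarrow> bundle_point) \<Rightarrow> 'w \<Rightarrow> complex" where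
  "pairing s T u \<omega> = (\<integral>x. fiber_inner s (T x \<omega>) (u x) \<partial>S2_measure)"

definition joint_law ::
    "int \<Rightarrow> 'w measure \<Rightarrow> (real^3 \<Rightarrow> 'w \<Rightarrow> bundle_point) \<Rightarrow> nat \<Rightarrow>
     (nat \<Rightarrow> real^3 \<Rightarrow> bundle_point) \<Rightarrow> (nat \<Rightarrow> complex) measure" where
  "joint_law s M T m u =
     distr M (PiM {..<m} (\<lambda>_. borel)) (\<lambda>\<omega>. \<lambda>i\<in>{..<m}. pairing s T (u i) \<omega>)"

definition isotropic :: "int \<Rightarrow> 'w measure \<Rightarrow> (real^3 \<Rightarrow> 'w \<Rightarrow> bundle_point) \<Rightarrow> bool" where
  "isotropic s M T \<longleftrightarrow> (\<forall>g\<in>SO3. \<forall>m u. (\<forall>i<m. L2_section s (u i)) \<longrightarrow>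
     joint_law s M T m u = joint_law s M T m (\<lambda>i. section_act g (u i)))"

definition same_law ::
    "int \<Rightarrow> 'w measure \<Rightarrow> (real^3 \<Rightarrow> 'w \<Rightarrow> bundle_point) \<Rightarrow>
     'v measure \<Rightarrow> (real^3 \<Rightarrow> 'v \<Rightarrow> bundle_point) \<Rightarrow> bool" where
  "same_law s M T N T' \<longleftrightarrow> (\<forall>m u. (\<forall>i<m. L2_section s (u i)) \<longrightarrow>
     joint_law s M T m u = joint_law s N T' m u)"

text \<open>The law of a real Gaussian with mean \<open>\<mu>\<close> and standard deviation \<open>\<sigma> \<ge> 0\<close>; for \<open>\<sigma> = 0\<close> it is the
  point mass at \<open>\<mu>\<close>.\<close>

definition gaussian_law :: "real \<Rightarrow> real \<Rightarrow> real measure" where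
  "gaussian_law \<mu> \<sigma> = distr std_normal_distribution borel (\<lambda>x. \<mu> + \<sigma> * x)"

definition complex_gaussian_var :: "'w measure \<Rightarrow> ('w \<Rightarrow> complex) \<Rightarrow> bool" where
  "complex_gaussian_var M Y \<longleftrightarrow> Y \<in> borel_measurable M \<and>
     prob_space.indep_var M borel (\<lambda>\<omega>. Re (Y \<omega>)) borel (\<lambda>\<omega>. Im (Y \<omega>)) \<and>
     (\<exists>a b \<sigma>. \<sigma> \<ge> 0 \<and> distr M borel (\<lambda>\<omega>. Re (Y \<omega>)) = gaussian_law a \<sigma> \<and>
                distr M borel (\<lambda>\<omega>. Im (Y \<omega>)) = gaussian_law b \<sigma>)"

definition complex_gaussian_section ::
    "int \<Rightarrow> 'w measure \<Rightarrow> (real^3 \<Rightarrow> 'w \<Rightarrow> bundle_point) \<Rightarrow> bool" where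
  "complex_gaussian_section s M T \<longleftrightarrow>
     (\<forall>u. L2_section s u \<longrightarrow> complex_gaussian_var M (pairing s T u))"

definition sq_integrable :: "'a measure \<Rightarrow> ('a \<Rightarrow> complex) \<Rightarrow> bool" where
  "sq_integrable \<mu> \<phi> \<longleftrightarrow> \<phi> \<in> borel_measurable \<mu> \<and> integrable \<mu> (\<lambda>x. (norm (\<phi> x))\<^sup>2)"

definition L2_sums :: "'a measure \<Rightarrow> (nat \<Rightarrow> 'a \<Rightarrow> complex) \<Rightarrow> ('a \<Rightarrow> complex) \<Rightarrow> bool" where
  "L2_sums \<mu> h \<phi> \<longleftrightarrow>
     (\<lambda>n. \<integral>\<^sup>+x. ennreal ((norm (\<phi> x - (\<Sum>k<n. h k x)))\<^sup>2) \<partial>\<mu>) \<longlonglongrightarrow> 0"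

definition real_onb_SO3 :: "(nat \<Rightarrow> real^3^3 \<Rightarrow> real) \<Rightarrow> bool" where
  "real_onb_SO3 e \<longleftrightarrow>
     (\<forall>n. sq_integrable haar_SO3 (\<lambda>g. complex_of_real (e n g))) \<and>
     (\<forall>i j. (\<integral>g. e i g * e j g \<partial>haar_SO3) = of_bool (i = j)) \<and>
     (\<forall>\<phi>. sq_integrable haar_SO3 \<phi> \<longrightarrow>
        (\<exists>\<alpha>. L2_sums haar_SO3 (\<lambda>k g. \<alpha> k * complex_of_real (e k g)) \<phi>))"

definition iid_std_normal :: "'v measure \<Rightarrow> (nat \<Rightarrow> 'v \<Rightarrow> real) \<Rightarrow> bool" where
  "iid_std_normal N \<xi> \<longleftrightarrow> prob_space N \<and> prob_space.indep_vars N (\<lambda>_. borel) \<xi> UNIV \<and>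
     (\<forall>n. distributed N lborel (\<xi> n) std_normal_density)"

text \<open>\<open>white_noise N e \<xi> \<phi> Y\<close> says that \<open>Y\<close> is a version of \<open>S(\<phi>)\<close>, the image under \<open>S\<close> being
  determined only almost surely.\<close>

definition white_noise ::
    "'v measure \<Rightarrow> (nat \<Rightarrow> real^3^3 \<Rightarrow> real) \<Rightarrow> (nat \<Rightarrow> 'v \<Rightarrow> real) \<Rightarrow>
     (real^3^3 \<Rightarrow> complex) \<Rightarrow> ('v \<Rightarrow> complex) \<Rightarrow> bool" where
  "white_noise N e \<xi> \<phi> Y \<longleftrightarrow> Y \<in> borel_measurable N \<and>
     (\<exists>\<alpha>. L2_sums haar_SO3 (\<lambda>k g. \<alpha> k * complex_of_real (e k g)) \<phi> \<and>
          L2_sums N (\<lambda>k \<omega>. \<alpha> k * complex_of_real (\<xi> k \<omega>)) Y)"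

definition left_translate :: "real^3^3 \<Rightarrow> (real^3^3 \<Rightarrow> complex) \<Rightarrow> real^3^3 \<Rightarrow> complex" where
  "left_translate g f h = f (matrix_inv g ** h)"

definition bi_associated :: "int \<Rightarrow> (real^3^3 \<Rightarrow> complex) \<Rightarrow> bool" where
  "bi_associated s f \<longleftrightarrow>
     (\<forall>g\<in>SO3. \<forall>k1\<in>K_north. \<forall>k2\<in>K_north. f (k1 ** g ** k2) = chi s k1 * f g * chi s k2)"

text \<open>\<open>T'\<close> is a random section of the form \<open>T\<^sup>f\<close>, for some jointly measurable version \<open>X\<close> of the field
  \<open>g \<mapsto> S(L\<^sub>g f)\<close>. For the last clause to be satisfiable, the version must transform under \<open>K_north\<close> like a
  pullback on every path.\<close>

definition is_Tf ::
    "int \<Rightarrow> 'v measure \<Rightarrow> (nat \<Rightarrow> real^3^3 \<Rightarrow> real) \<Rightarrow> (nat \<Rightarrow> 'v \<Rightarrow> real) \<Rightarrow>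
     (real^3^3 \<Rightarrow> complex) \<Rightarrow> (real^3 \<Rightarrow> 'v \<Rightarrow> bundle_point) \<Rightarrow> bool" where
  "is_Tf s N e \<xi> f T' \<longleftrightarrow> random_section s N T' \<and>
     (\<exists>X. (\<lambda>(g, \<omega>). X g \<omega>) \<in> borel_measurable (haar_SO3 \<Otimes>\<^sub>M N) \<and>
          (\<forall>g\<in>SO3. white_noise N e \<xi> (left_translate g f) (X g)) \<and>
          (\<forall>g\<in>SO3. \<forall>\<omega>\<in>space N. T' (g *v north) \<omega> = theta s g (X g \<omega>)))"

text \<open>The field \<open>T\<^sup>f\<close> depends on the chosen version, so the law is compared for every version,
  and a version is required to exist.\<close>

definition represents ::
    "int \<Rightarrow> 'w measure \<Rightarrow> (real^3 \<Rightarrow> 'w \<Rightarrow> bundle_point) \<Rightarrow> 'v measure \<Rightarrow>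
     (nat \<Rightarrow> real^3^3 \<Rightarrow> real) \<Rightarrow> (nat \<Rightarrow> 'v \<Rightarrow> real) \<Rightarrow> (real^3^3 \<Rightarrow> complex) \<Rightarrow> bool" where
  "represents s M T N e \<xi> f \<longleftrightarrow> sq_integrable haar_SO3 f \<and> bi_associated s f \<and>
     (\<exists>T'. is_Tf s N e \<xi> f T') \<and> (\<forall>T'. is_Tf s N e \<xi> f T' \<longrightarrow> same_law s N T' M T)"

end

theory Submission
  imports Defs
begin

text \<open>
  Pulled back to \<open>SO(3)\<close>, sections of \<open>\<xi>\<^sub>s\<close> are the functions \<open>U\<close> with \<open>U (g k) = \<chi>\<^sub>s(k)\<^sup>-\<^sup>1 U g\<close>, and \<open>T\<close> becomes
  a field \<open>X\<close>. Since a Gaussian variable cannot concentrate its variance on an event of small probability, almost sure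
  square integrability gives \<open>E \<integral> |X|\<^sup>2 < \<infinity>\<close>. Put \<open>Y = cnj X\<close> and \<open>\<phi> x = E \<integral> cnj (Y k) * Y (k x) dk\<close>. Isotropy turns
  the variance of \<open>T(u)\<close> into \<open>\<langle>v * \<phi>, v\<rangle>\<close> with \<open>v = cnj U\<close>, and with \<open>s \<noteq> 0\<close> it forces the mean of \<open>T(u)\<close> to vanish.

  A square root of \<open>\<phi>\<close> under convolution is found without the Peter-Weyl theorem. With \<open>A v = v * \<phi>\<close>, scaled so that
  \<open>A \<le> 1\<close>, and \<open>B = 1 - A\<close>, the function \<open>f = (\<Sum>k. c\<^sub>k B\<^sup>k \<phi>)\<close>, where \<open>c\<^sub>k\<close> are the Taylor coefficients of
  \<open>(1 - b)\<^sup>-\<^sup>1\<^sup>/\<^sup>2\<close>, is formally the kernel of \<open>A\<^sup>1\<^sup>/\<^sup>2\<close>. The series converges in \<open>L\<^sup>2\<close> because the traces \<open>\<langle>B\<^sup>m \<phi>, \<phi>\<rangle>\<close> are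
  nonnegative and telescope to at most \<open>E \<integral> |X|\<^sup>2\<close>. Hence \<open>\<parallel>v * f\<parallel>\<^sup>2 = \<langle>v * \<phi>, v\<rangle>\<close>, and \<open>f\<close> inherits the bi-association of \<open>\<phi>\<close>.

  On the white noise side \<open>T\<^sup>f(u)\<close> is \<open>S(v * f)\<close>. As \<open>f\<close> is right-associated and \<open>s \<noteq> 0\<close>, \<open>\<integral> (v * f)\<^sup>2 = 0\<close>, so the real
  part of \<open>T\<^sup>f(u)\<close> has variance \<open>\<parallel>v * f\<parallel>\<^sup>2 / 2\<close>, as for \<open>T(u)\<close>. Applied to all linear combinations of sections this
  identifies all joint laws. Replacing \<open>f\<close> by \<open>-f\<close> changes nothing, and \<open>f \<noteq> 0\<close> unless \<open>T = 0\<close>.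
\<close>


section \<open>Square-integrable functions\<close>

text \<open>Isotropy constrains only the pairings \<open>T(u)\<close>, so neither moments of a
  single \<open>X g\<close> nor a pointwise covariance is available at the start. Hence the passage
  to \<open>SO(3) x Omega\<close>: \<open>Z x (k, w) = cnj (X (k x) w)\<close> rotates the path by
  an independent Haar element, and right invariance of Haar measure makes \<open>Z\<close> exactly
  stationary. Isotropy then shows that the rotation has not changed the means and variances of the
  pairings. The same auxiliary field turns the sum over \<open>m\<close> of
  \<open><B^m phi, phi>\<close> into the expectation of a telescoping sum along single paths
  (\<open>trace_form\<close>); this is where the finite second moment pays for the convergence in
  L^2. The statement asks for \<open>bi_associated\<close> at every point, while limits in L^2 are
  determined only almost everywhere. Both the root \<open>f\<close> and the noise field are
  therefore built with \<open>climit\<close>, a pointwise limit along a subsequence, set to 0 where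
  it fails to exist. It commutes with nonzero scalars, so exact equivariance survives.\<close>

definition l2ip :: "'a measure \<Rightarrow> ('a \<Rightarrow> complex) \<Rightarrow> ('a \<Rightarrow> complex) \<Rightarrow> complex" where
  "l2ip M u v = (\<integral>x. u x * cnj (v x) \<partial>M)"

definition l2sq :: "'a measure \<Rightarrow> ('a \<Rightarrow> complex) \<Rightarrow> real" where
  "l2sq M u = (\<integral>x. (norm (u x))\<^sup>2 \<partial>M)"

lemma sq_integrable_measurable [measurable_dest]:
  "sq_integrable M u \<Longrightarrow> u \<in> borel_measurable M"
  by (simp add: sq_integrable_def)

lemma sq_integrableD: "sq_integrable M u \<Longrightarrow> integrable M (\<lambda>x. (norm (u x))\<^sup>2)"
  by (simp add: sq_integrable_def)

lemma l2sq_nonneg [simp]: "0 \<le> l2sq M u"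
  by (simp add: l2sq_def)

lemma nn_integral_l2sq:
  "sq_integrable M u \<Longrightarrow> (\<integral>\<^sup>+x. ennreal ((norm (u x))\<^sup>2) \<partial>M) = ennreal (l2sq M u)"
  unfolding l2sq_def by (rule nn_integral_eq_integral) (auto simp: sq_integrable_def)

lemma sq_integrable_iff_nn:
  "sq_integrable M u \<longleftrightarrow> u \<in> borel_measurable M \<and> (\<integral>\<^sup>+x. ennreal ((norm (u x))\<^sup>2) \<partial>M) < \<infinity>"
  unfolding sq_integrable_def integrable_iff_bounded by auto

lemma l2sq_cong: "(\<And>x. x \<in> space M \<Longrightarrow> u x = v x) \<Longrightarrow> l2sq M u = l2sq M v"
  unfolding l2sq_def by (rule Bochner_Integration.integral_cong) auto

lemma l2ip_cong:
  "(\<And>x. x \<in> space M \<Longrightarrow> u x = u' x) \<Longrightarrow> (\<And>x. x \<in> space M \<Longrightarrow> v x = v' x) \<Longrightarrow> l2ip M u v = l2ip M u' v'"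
  unfolding l2ip_def by (rule Bochner_Integration.integral_cong) auto

lemma measurable_cnj [measurable (raw)]:
  "u \<in> borel_measurable M \<Longrightarrow> (\<lambda>x. cnj (u x)) \<in> borel_measurable M"
  by (rule measurable_compose[OF _ borel_measurable_continuous_onI]) (auto intro: continuous_intros)

lemma sq_integrable_cnj [simp]: "sq_integrable M (\<lambda>x. cnj (u x)) \<longleftrightarrow> sq_integrable M u"
proof -
  have "(\<lambda>x. cnj (u x)) \<in> borel_measurable M \<longleftrightarrow> u \<in> borel_measurable M"
    using measurable_cnj[of u M] measurable_cnj[of "\<lambda>x. cnj (u x)" M] unfolding complex_cnj_cnj by blast
  then show ?thesis by (simp add: sq_integrable_def)
qed

lemma sq_integrable_scale: "sq_integrable M u \<Longrightarrow> sq_integrable M (\<lambda>x. c * u x)"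
  by (auto simp: sq_integrable_def norm_mult power_mult_distrib)

lemma sq_integrable_bounded_by:
  assumes "sq_integrable M v" "u \<in> borel_measurable M" "\<And>x. x \<in> space M \<Longrightarrow> norm (u x) \<le> norm (v x)"
  shows "sq_integrable M u"
  unfolding sq_integrable_def
proof
  show "integrable M (\<lambda>x. (norm (u x))\<^sup>2)"
    by (rule Bochner_Integration.integrable_bound[OF sq_integrableD[OF assms(1)]])
       (use assms in \<open>auto intro!: AE_I2 power_mono\<close>)
qed (rule assms)

lemma sum_power2_norm_le: "(norm (a + b :: complex))\<^sup>2 \<le> 2 * (norm a)\<^sup>2 + 2 * (norm b)\<^sup>2"
proof -
  have "(norm (a + b))\<^sup>2 \<le> (norm a + norm b)\<^sup>2" by (intro power_mono norm_triangle_ineq) auto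
  also have "\<dots> \<le> 2 * (norm a)\<^sup>2 + 2 * (norm b)\<^sup>2"
    using sum_squares_bound[of "norm a" "norm b"] by (simp add: power2_sum)
  finally show ?thesis .
qed

lemma sq_integrable_add:
  assumes "sq_integrable M u" "sq_integrable M v"
  shows "sq_integrable M (\<lambda>x. u x + v x)"
  unfolding sq_integrable_def
proof
  show "integrable M (\<lambda>x. (norm (u x + v x))\<^sup>2)"
  proof (rule Bochner_Integration.integrable_bound)
    show "integrable M (\<lambda>x. 2 * (norm (u x))\<^sup>2 + 2 * (norm (v x))\<^sup>2)"
      using assms by (auto simp: sq_integrable_def)
  qed (use assms sum_power2_norm_le in \<open>auto simp: sq_integrable_def intro!: AE_I2\<close>)
qed (use assms in \<open>auto simp: sq_integrable_def\<close>)

lemma sq_integrable_diff: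
  assumes "sq_integrable M u" "sq_integrable M v"
  shows "sq_integrable M (\<lambda>x. u x - v x)"
  using sq_integrable_add[OF assms(1) sq_integrable_scale[OF assms(2), of "-1"]] by simp

lemma sq_integrable_zero [simp]: "sq_integrable M (\<lambda>x. 0)"
  by (simp add: sq_integrable_def)

lemma sq_integrable_sum:
  "(\<And>i. i \<in> A \<Longrightarrow> sq_integrable M (u i)) \<Longrightarrow> sq_integrable M (\<lambda>x. \<Sum>i\<in>A. u i x)"
  by (induction A rule: infinite_finite_induct) (auto intro: sq_integrable_add)

lemma integrable_norm_mult:
  fixes u v :: "'a \<Rightarrow> complex"
  assumes "sq_integrable M u" "sq_integrable M v"
  shows "integrable M (\<lambda>x. norm (u x) * norm (v x))"
proof (rule Bochner_Integration.integrable_bound)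
  show "integrable M (\<lambda>x. (norm (u x))\<^sup>2 + (norm (v x))\<^sup>2)"
    using assms by (auto simp: sq_integrable_def)
  have "norm a * norm b \<le> (norm a)\<^sup>2 + (norm b)\<^sup>2" for a b :: complex
    using sum_squares_bound[of "norm a" "norm b"] mult_nonneg_nonneg[of "norm a" "norm b"]
    by (simp del: mult_nonneg_nonneg)
  then show "AE x in M. norm (norm (u x) * norm (v x)) \<le> norm ((norm (u x))\<^sup>2 + (norm (v x))\<^sup>2)"
    by (intro AE_I2) simp
qed (use assms in measurable)

lemma integrable_mult_L2:
  assumes "sq_integrable M u" "sq_integrable M v"
  shows "integrable M (\<lambda>x. u x * v x)"
  by (rule Bochner_Integration.integrable_bound[OF integrable_norm_mult[OF assms]])
     (use assms in \<open>auto simp: norm_mult\<close>)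

lemma integrable_l2ip:
  assumes "sq_integrable M u" "sq_integrable M v"
  shows "integrable M (\<lambda>x. u x * cnj (v x))"
  using integrable_mult_L2[of M u "\<lambda>x. cnj (v x)"] assms by simp

text \<open>The norms stay inside the integral: in this form Cauchy-Schwarz also supplies the
  dominating functions for Fubini.\<close>

lemma l2sq_cs_norm:
  assumes u: "sq_integrable M u" and v: "sq_integrable M v"
  shows "(\<integral>x. norm (u x) * norm (v x) \<partial>M)\<^sup>2 \<le> l2sq M u * l2sq M v"
proof -
  have [measurable]: "u \<in> borel_measurable M" "v \<in> borel_measurable M" using u v by auto
  have "(\<integral>\<^sup>+x. ennreal (norm (u x)) * ennreal (norm (v x)) \<partial>M)\<^sup>2
      \<le> (\<integral>\<^sup>+x. (ennreal (norm (u x)))\<^sup>2 \<partial>M) * (\<integral>\<^sup>+x. (ennreal (norm (v x)))\<^sup>2 \<partial>M)"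
    by (rule Cauchy_Schwarz_nn_integral) auto
  also have "(\<integral>\<^sup>+x. ennreal (norm (u x)) * ennreal (norm (v x)) \<partial>M) = ennreal (\<integral>x. norm (u x) * norm (v x) \<partial>M)"
    unfolding ennreal_mult[symmetric, OF norm_ge_zero norm_ge_zero]
    by (rule nn_integral_eq_integral[OF integrable_norm_mult[OF u v]]) auto
  also have "(\<integral>\<^sup>+x. (ennreal (norm (u x)))\<^sup>2 \<partial>M) = ennreal (l2sq M u)"
    using nn_integral_l2sq[OF u] by (simp add: ennreal_power)
  also have "(\<integral>\<^sup>+x. (ennreal (norm (v x)))\<^sup>2 \<partial>M) = ennreal (l2sq M v)"
    using nn_integral_l2sq[OF v] by (simp add: ennreal_power)
  finally show ?thesis
    by (simp add: ennreal_power ennreal_mult[symmetric])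
qed

lemma l2_cs:
  assumes "sq_integrable M u" "sq_integrable M v"
  shows "(norm (\<integral>x. u x * v x \<partial>M))\<^sup>2 \<le> l2sq M u * l2sq M v"
proof -
  have "norm (\<integral>x. u x * v x \<partial>M) \<le> (\<integral>x. norm (u x) * norm (v x) \<partial>M)"
    using integral_norm_bound[of M "\<lambda>x. u x * v x"] by (simp add: norm_mult)
  then have "(norm (\<integral>x. u x * v x \<partial>M))\<^sup>2 \<le> (\<integral>x. norm (u x) * norm (v x) \<partial>M)\<^sup>2"
    by (intro power_mono) auto
  with l2sq_cs_norm[OF assms] show ?thesis by linarith
qed

lemma l2sq_cnj [simp]: "l2sq M (\<lambda>x. cnj (v x)) = l2sq M v"
  by (simp add: l2sq_def)

lemma l2sq_scale: "l2sq M (\<lambda>x. c * v x) = (norm c)\<^sup>2 * l2sq M v"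
  by (simp add: l2sq_def norm_mult power_mult_distrib)

lemma l2ip_cs:
  assumes "sq_integrable M u" "sq_integrable M v"
  shows "norm (l2ip M u v) \<le> sqrt (l2sq M u) * sqrt (l2sq M v)"
proof -
  have "(norm (l2ip M u v))\<^sup>2 \<le> l2sq M u * l2sq M v"
    unfolding l2ip_def using l2_cs[of M u "\<lambda>x. cnj (v x)"] assms by simp
  then show ?thesis unfolding real_sqrt_mult[symmetric] by (rule real_le_rsqrt)
qed

lemma l2ip_self: "l2ip M u u = of_real (l2sq M u)"
  by (simp add: l2ip_def l2sq_def complex_norm_square[symmetric] flip: of_real_power)

lemma l2ip_add_left:
  "sq_integrable M u \<Longrightarrow> sq_integrable M u' \<Longrightarrow> sq_integrable M v \<Longrightarrow>
    l2ip M (\<lambda>x. u x + u' x) v = l2ip M u v + l2ip M u' v"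
  by (simp add: l2ip_def distrib_right integrable_l2ip)

lemma l2ip_diff_left:
  "sq_integrable M u \<Longrightarrow> sq_integrable M u' \<Longrightarrow> sq_integrable M v \<Longrightarrow>
    l2ip M (\<lambda>x. u x - u' x) v = l2ip M u v - l2ip M u' v"
  by (simp add: l2ip_def left_diff_distrib integrable_l2ip)

lemma l2ip_scale_left: "l2ip M (\<lambda>x. c * u x) v = c * l2ip M u v"
  by (simp add: l2ip_def mult.assoc)

lemma l2ip_cnj_swap: "cnj (l2ip M u v) = l2ip M v u"
  unfolding l2ip_def using Bochner_Integration.integral_cnj[of M "\<lambda>x. u x * cnj (v x)"] by (simp add: mult.commute)

lemma l2ip_sum_left:
  "(\<And>i. i \<in> A \<Longrightarrow> sq_integrable M (u i)) \<Longrightarrow> sq_integrable M v \<Longrightarrow>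
    l2ip M (\<lambda>x. \<Sum>i\<in>A. u i x) v = (\<Sum>i\<in>A. l2ip M (u i) v)"
  by (simp add: l2ip_def sum_distrib_right integrable_l2ip)

lemma l2ip_sum_right:
  assumes "\<And>i. i \<in> A \<Longrightarrow> sq_integrable M (u i)" "sq_integrable M v"
  shows "l2ip M v (\<lambda>x. \<Sum>i\<in>A. u i x) = (\<Sum>i\<in>A. l2ip M v (u i))"
  using arg_cong[OF l2ip_sum_left[of A M u v, OF assms], of cnj] by (simp add: l2ip_cnj_swap)

lemma l2ip_scale_right: "l2ip M v (\<lambda>x. c * u x) = cnj c * l2ip M v u"
  using arg_cong[OF l2ip_scale_left[of M c u v], of cnj] by (simp add: l2ip_cnj_swap)

lemma l2ip_diff_right:
  "sq_integrable M u \<Longrightarrow> sq_integrable M u' \<Longrightarrow> sq_integrable M v \<Longrightarrow>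
    l2ip M v (\<lambda>x. u x - u' x) = l2ip M v u - l2ip M v u'"
  by (simp add: l2ip_def right_diff_distrib integrable_l2ip)

lemma l2sq_add_le:
  assumes "sq_integrable M u" "sq_integrable M v"
  shows "sqrt (l2sq M (\<lambda>x. u x + v x)) \<le> sqrt (l2sq M u) + sqrt (l2sq M v)"
proof -
  have "of_real (l2sq M (\<lambda>x. u x + v x)) = l2ip M (\<lambda>x. u x + v x) (\<lambda>x. u x + v x)"
    by (simp add: l2ip_self)
  also have "\<dots> = l2ip M u (\<lambda>x. u x + v x) + l2ip M v (\<lambda>x. u x + v x)"
    using assms by (intro l2ip_add_left sq_integrable_add)
  also have "l2ip M u (\<lambda>x. u x + v x) = cnj (l2ip M u u + l2ip M v u)"
    using assms by (simp add: l2ip_add_left[symmetric] l2ip_cnj_swap)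
  also have "l2ip M v (\<lambda>x. u x + v x) = cnj (l2ip M u v + l2ip M v v)"
    using assms by (simp add: l2ip_add_left[symmetric] l2ip_cnj_swap)
  finally have "l2sq M (\<lambda>x. u x + v x) = Re (cnj (l2ip M u u + l2ip M v u) + cnj (l2ip M u v + l2ip M v v))"
    by (metis Re_complex_of_real)
  also have "\<dots> = l2sq M u + l2sq M v + Re (l2ip M v u) + Re (l2ip M u v)"
    by (simp add: l2ip_self)
  also have "\<dots> \<le> l2sq M u + l2sq M v + sqrt (l2sq M v) * sqrt (l2sq M u) + sqrt (l2sq M u) * sqrt (l2sq M v)"
    using l2ip_cs[OF assms] l2ip_cs[OF assms(2,1)] complex_Re_le_cmod[of "l2ip M v u"] complex_Re_le_cmod[of "l2ip M u v"]
    by linarith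
  also have "\<dots> = (sqrt (l2sq M u) + sqrt (l2sq M v))\<^sup>2"
    by (simp add: power2_sum)
  finally show ?thesis
    by (intro real_le_lsqrt) auto
qed

lemma l2sq_minus_commute: "l2sq M (\<lambda>x. u x - v x) = l2sq M (\<lambda>x. v x - u x)"
  by (simp add: l2sq_def norm_minus_commute)

lemma l2sq_diff_abs_le:
  assumes "sq_integrable M u" "sq_integrable M v"
  shows "\<bar>sqrt (l2sq M u) - sqrt (l2sq M v)\<bar> \<le> sqrt (l2sq M (\<lambda>x. u x - v x))"
  using l2sq_add_le[OF sq_integrable_diff[OF assms] assms(2)]
    l2sq_add_le[OF sq_integrable_diff[OF assms(2,1)] assms(1)] l2sq_minus_commute[of M u v]
  by simp

lemma l2sq_tendsto:
  assumes "\<And>n. sq_integrable M (F n)" "sq_integrable M f" "(\<lambda>n. l2sq M (\<lambda>x. F n x - f x)) \<longlonglongrightarrow> 0"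
  shows "(\<lambda>n. l2sq M (F n)) \<longlonglongrightarrow> l2sq M f"
proof -
  have "(\<lambda>n. sqrt (l2sq M (\<lambda>x. F n x - f x))) \<longlonglongrightarrow> sqrt 0"
    by (intro tendsto_real_sqrt assms)
  then have "(\<lambda>n. sqrt (l2sq M (F n)) - sqrt (l2sq M f)) \<longlonglongrightarrow> 0"
    using l2sq_diff_abs_le[OF assms(1,2)]
    by (intro Lim_null_comparison[of "\<lambda>n. sqrt (l2sq M (F n)) - sqrt (l2sq M f)"]) auto
  then have "(\<lambda>n. sqrt (l2sq M (F n))) \<longlonglongrightarrow> sqrt (l2sq M f)"
    by (simp add: LIM_zero_iff)
  from tendsto_power[OF this, of 2] show ?thesis by simp
qed

section \<open>Pointwise limits along subsequences and completeness of L^2\<close>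

definition climit :: "(nat \<Rightarrow> complex) \<Rightarrow> complex" where
  "climit a = (if convergent a then lim a else 0)"

text \<open>The default 0 makes this true for divergent sequences as well: a nonzero factor
  preserves divergence and fixes 0. Equivariance of the approximants thus passes to the limit at
  every point.\<close>

lemma climit_scale: "c \<noteq> 0 \<Longrightarrow> climit (\<lambda>n. c * a n) = c * climit a"
proof -
  assume c: "c \<noteq> 0"
  have "convergent (\<lambda>n. c * a n) \<longleftrightarrow> convergent a"
    using c by (rule convergent_mult_const_iff)
  moreover have "lim (\<lambda>n. c * a n) = c * lim a" if "convergent a"
    using that by (intro limI tendsto_intros) (simp add: convergent_LIMSEQ_iff)
  ultimately show ?thesis by (simp add: climit_def)
qed

lemma tendsto_climit: "convergent a \<Longrightarrow> a \<longlonglongrightarrow> climit a"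
  by (simp add: climit_def convergent_LIMSEQ_iff)

lemma measurable_climit [measurable]:
  assumes [measurable]: "\<And>n. F n \<in> borel_measurable M"
  shows "(\<lambda>x. climit (\<lambda>n. F n x)) \<in> borel_measurable M"
  unfolding climit_def Cauchy_convergent_iff[symmetric] by measurable

text \<open>Increments with squared norm at most \<open>(1/4)^n\<close> have L^1 norm at most
  \<open>(1/2)^n\<close> under a probability measure. Their sum has finite expectation, so it is
  finite almost surely.\<close>

lemma (in prob_space) AE_convergent_fast:
  fixes F :: "nat \<Rightarrow> 'a \<Rightarrow> complex"
  assumes F: "\<And>n. sq_integrable M (F n)"
    and fast: "\<And>n. l2sq M (\<lambda>x. F (Suc n) x - F n x) \<le> (1/4)^n"
  shows "AE x in M. convergent (\<lambda>n. F n x)"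
proof -
  note [measurable] = sq_integrable_measurable[OF F]
  let ?d = "\<lambda>n x. F (Suc n) x - F n x"
  have d: "sq_integrable M (?d n)" for n by (intro sq_integrable_diff F)
  have int: "integrable M (\<lambda>x. norm (?d n x))" for n
    using integrable_norm_mult[OF d, of "\<lambda>_. 1" n] by (simp add: sq_integrable_def)
  have b: "(\<integral>x. norm (?d n x) \<partial>M) \<le> (1/2)^n" for n
  proof -
    have "(\<integral>x. norm (?d n x) \<partial>M)\<^sup>2 \<le> l2sq M (?d n) * l2sq M (\<lambda>_. 1)"
      using l2sq_cs_norm[OF d, of "\<lambda>_. 1" n] by (simp add: sq_integrable_def)
    also have "\<dots> \<le> (1/4)^n" using fast[of n] by (simp add: l2sq_def prob_space)
    also have "\<dots> = ((1/2)^n)\<^sup>2" by (simp add: power_mult[symmetric] power2_eq_square power_mult_distrib[symmetric])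
    finally show ?thesis by (rule power2_le_imp_le) simp
  qed
  have "(\<integral>\<^sup>+x. (\<Sum>n. ennreal (norm (?d n x))) \<partial>M) = (\<Sum>n. \<integral>\<^sup>+x. ennreal (norm (?d n x)) \<partial>M)"
    by (rule nn_integral_suminf) auto
  also have "\<dots> \<le> (\<Sum>n. ennreal ((1/2)^n))"
  proof (rule suminf_le)
    show "(\<integral>\<^sup>+x. ennreal (norm (?d n x)) \<partial>M) \<le> ennreal ((1/2)^n)" for n
      using nn_integral_eq_integral[OF int, of n] b[of n] by (simp add: ennreal_leI)
  qed (rule summableI)+
  also have "\<dots> = ennreal (\<Sum>n. (1/2)^n)"
    by (rule suminf_ennreal2) (auto intro!: summable_geometric)
  finally have "(\<integral>\<^sup>+x. (\<Sum>n. ennreal (norm (?d n x))) \<partial>M) \<noteq> \<infinity>"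
    by (auto simp: top_unique)
  then have "AE x in M. (\<Sum>n. ennreal (norm (?d n x))) \<noteq> \<infinity>"
    by (intro nn_integral_PInf_AE) auto
  then show ?thesis
  proof eventually_elim
    case (elim x)
    then have "summable (\<lambda>n. norm (?d n x))"
      by (intro summable_suminf_not_top) (auto simp: top_unique)
    then have "summable (\<lambda>n. ?d n x)" by (rule summable_norm_cancel)
    then have "convergent (\<lambda>n. \<Sum>i<n. ?d i x)" by (simp add: summable_iff_convergent)
    then have "convergent (\<lambda>n. F n x - F 0 x)" by (simp add: sum_lessThan_telescope[of "\<lambda>i. F i x"])
    from convergent_add[OF this convergent_const[of "F 0 x"]] show ?case by simp
  qed
qed

text \<open>Stated with \<open>nn_integral\<close>, so that square integrability of
  \<open>h - f\<close> comes out as a conclusion. Fatou transfers a bound along the approximants to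
  their almost sure limit.\<close>

lemma (in prob_space) l2_Fatou:
  fixes F :: "nat \<Rightarrow> 'a \<Rightarrow> complex"
  assumes [measurable]: "\<And>n. F n \<in> borel_measurable M" "f \<in> borel_measurable M" "h \<in> borel_measurable M"
    and lim: "AE x in M. (\<lambda>n. F n x) \<longlonglongrightarrow> f x"
    and b: "\<forall>\<^sub>F n in sequentially. (\<integral>\<^sup>+x. ennreal ((norm (h x - F n x))\<^sup>2) \<partial>M) \<le> ennreal e"
  shows "(\<integral>\<^sup>+x. ennreal ((norm (h x - f x))\<^sup>2) \<partial>M) \<le> ennreal e"
proof -
  have "(\<integral>\<^sup>+x. ennreal ((norm (h x - f x))\<^sup>2) \<partial>M) = (\<integral>\<^sup>+x. liminf (\<lambda>n. ennreal ((norm (h x - F n x))\<^sup>2)) \<partial>M)"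
  proof (rule nn_integral_cong_AE, use lim in eventually_elim)
    case (elim x)
    have "(\<lambda>n. ennreal ((norm (h x - F n x))\<^sup>2)) \<longlonglongrightarrow> ennreal ((norm (h x - f x))\<^sup>2)"
      by (intro tendsto_intros elim tendsto_ennrealI)
    then show ?case by (intro lim_imp_Liminf[symmetric]) auto
  qed
  also have "\<dots> \<le> liminf (\<lambda>n. \<integral>\<^sup>+x. ennreal ((norm (h x - F n x))\<^sup>2) \<partial>M)"
    by (rule nn_integral_liminf) auto
  also have "\<dots> \<le> ennreal e"
    using Liminf_le[OF _ b] by simp
  finally show ?thesis .
qed

text \<open>The limit is exhibited as \<open>climit\<close> of a subsequence because the later
  symmetry arguments need this pointwise formula, not just a function modulo null sets.\<close>

lemma (in prob_space) L2_complete: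
  fixes F :: "nat \<Rightarrow> 'a \<Rightarrow> complex"
  assumes F: "\<And>n. sq_integrable M (F n)"
    and cauchy: "\<And>e. e > 0 \<Longrightarrow> \<exists>N. \<forall>m\<ge>N. \<forall>n\<ge>N. l2sq M (\<lambda>x. F m x - F n x) < e"
  obtains r where "strict_mono r" and "sq_integrable M (\<lambda>x. climit (\<lambda>k. F (r k) x))"
    and "(\<lambda>n. l2sq M (\<lambda>x. F n x - climit (\<lambda>k. F (r k) x))) \<longlonglongrightarrow> 0"
proof -
  note [measurable] = sq_integrable_measurable[OF F]
  have "\<forall>k. \<exists>N. \<forall>m\<ge>N. \<forall>n\<ge>N. l2sq M (\<lambda>x. F m x - F n x) < (1/4)^k"
    by (intro allI cauchy) simp
  from choice[OF this] obtain N where N: "\<And>k m n. m \<ge> N k \<Longrightarrow> n \<ge> N k \<Longrightarrow> l2sq M (\<lambda>x. F m x - F n x) < (1/4)^k"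
    by blast
  \<comment> \<open>The sum dominates \<open>N k\<close>, and the summand \<open>k\<close> makes
    \<open>r\<close> strictly increasing.\<close>
  define r where "r k = (\<Sum>i\<le>k. N i) + k" for k
  have r: "strict_mono r" by (intro strict_monoI_Suc) (simp add: r_def)
  have rN: "r k \<ge> N k" for k
    using member_le_sum[of k "{..k}" N] by (simp add: r_def)
  let ?f = "\<lambda>x. climit (\<lambda>k. F (r k) x)"
  have f[measurable]: "?f \<in> borel_measurable M" by measurable
  have "AE x in M. convergent (\<lambda>k. F (r k) x)"
  proof (rule AE_convergent_fast[OF F])
    fix k show "l2sq M (\<lambda>x. F (r (Suc k)) x - F (r k) x) \<le> (1/4)^k"
      using strict_monoD[OF r, of k "Suc k"] rN[of k] by (intro less_imp_le[OF N]) auto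
  qed
  then have lim: "AE x in M. (\<lambda>k. F (r k) x) \<longlonglongrightarrow> ?f x"
    by eventually_elim (rule tendsto_climit)
  have sq: "sq_integrable M (\<lambda>x. F m x - F n x)" for m n by (intro sq_integrable_diff F)
  have b: "(\<integral>\<^sup>+x. ennreal ((norm (F n x - ?f x))\<^sup>2) \<partial>M) \<le> ennreal e"
    if "\<And>m. m \<ge> n0 \<Longrightarrow> l2sq M (\<lambda>x. F n x - F m x) < e" for n n0 e
  proof (rule l2_Fatou[OF _ _ _ lim])
    have "l2sq M (\<lambda>x. F n x - F (r k) x) \<le> e" if "k \<ge> n0" for k
      using seq_suble[OF r, of k] that by (intro less_imp_le[OF \<open>\<And>m. m \<ge> n0 \<Longrightarrow> l2sq M (\<lambda>x. F n x - F m x) < e\<close>]) auto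
    then show "\<forall>\<^sub>F k in sequentially. (\<integral>\<^sup>+x. ennreal ((norm (F n x - F (r k) x))\<^sup>2) \<partial>M) \<le> ennreal e"
      unfolding nn_integral_l2sq[OF sq] by (intro eventually_sequentiallyI[of n0] ennreal_leI)
  qed auto
  have sqd: "sq_integrable M (\<lambda>x. F (N 0) x - ?f x)"
    unfolding sq_integrable_iff_nn using b[of "N 0" "N 0" 1] N[of 0]
    by (auto intro: le_less_trans)
  have sqf: "sq_integrable M ?f"
    using sq_integrable_diff[OF F sqd, of "N 0"] by simp
  have "(\<lambda>n. l2sq M (\<lambda>x. F n x - ?f x)) \<longlonglongrightarrow> 0"
  proof (rule LIMSEQ_I)
    fix e :: real assume "e > 0"
    then obtain n0 where n0: "\<And>m n. m \<ge> n0 \<Longrightarrow> n \<ge> n0 \<Longrightarrow> l2sq M (\<lambda>x. F m x - F n x) < e / 2"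
      using cauchy[of "e/2"] by auto
    have "l2sq M (\<lambda>x. F n x - ?f x) \<le> e / 2" if "n \<ge> n0" for n
      using b[of n0 n "e/2"] n0[OF that] \<open>e > 0\<close>
      by (simp add: nn_integral_l2sq sq_integrable_diff F sqf)
    then show "\<exists>no. \<forall>n\<ge>no. norm (l2sq M (\<lambda>x. F n x - ?f x) - 0) < e"
      using \<open>e > 0\<close> by (intro exI[of _ n0]) force
  qed
  with r sqf show ?thesis by (rule that)
qed

text \<open>The form in which Fubini is prepared below: the inner L^1 norm is bounded, usually by
  Cauchy-Schwarz, by an integrable function of the outer variable.\<close>

lemma (in pair_sigma_finite) integrable_pair_bound:
  fixes f :: "'a \<times> 'b \<Rightarrow> complex" and b :: "'a \<Rightarrow> real"
  assumes [measurable]: "f \<in> borel_measurable (M1 \<Otimes>\<^sub>M M2)" and b: "integrable M1 b"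
    and int: "\<And>x. x \<in> space M1 \<Longrightarrow> integrable M2 (\<lambda>y. f (x, y))"
    and le: "\<And>x. x \<in> space M1 \<Longrightarrow> (\<integral>y. norm (f (x, y)) \<partial>M2) \<le> b x"
  shows "integrable (M1 \<Otimes>\<^sub>M M2) f"
proof (rule Fubini_integrable)
  show "integrable M1 (\<lambda>x. \<integral>y. norm (f (x, y)) \<partial>M2)"
    by (rule Bochner_Integration.integrable_bound[OF b]) (measurable, use le in \<open>force intro!: AE_I2 order_trans[OF _ abs_ge_self]\<close>)
qed (use int in auto)

section \<open>Convolution on a group with invariant probability measure\<close>

definition half_coeff :: "nat \<Rightarrow> real" where
  "half_coeff k = pochhammer (1/2) k / fact k"

lemma half_coeff_nonneg: "0 \<le> half_coeff k"
  by (simp add: half_coeff_def pochhammer_nonneg)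

lemma half_coeff_gbinomial: "half_coeff k = (-1)^k * ((-1/2) gchoose k)"
proof -
  have "(-1)^k * ((-1)^k * x) = (x::real)" for x
    by (cases "even k") auto
  then show ?thesis by (simp add: half_coeff_def gbinomial_pochhammer)
qed

text \<open>These are the Taylor coefficients of \<open>(1 - b) powr (-1/2)\<close>, whose square is the geometric series.\<close>

lemma half_coeff_conv: "(\<Sum>i\<le>m. half_coeff i * half_coeff (m - i)) = 1"
proof -
  have "(\<Sum>i\<le>m. half_coeff i * half_coeff (m - i))
      = (\<Sum>i\<le>m. (-1)^m * (((-1/2) gchoose i) * ((-1/2) gchoose (m - i))))"
  proof (rule sum.cong)
    fix i assume "i \<in> {..m}"
    then have "(-1::real)^m = (-1)^i * (-1)^(m - i)" by (simp flip: power_add)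
    then show "half_coeff i * half_coeff (m - i) = (-1)^m * (((-1/2) gchoose i) * ((-1/2) gchoose (m - i)))"
      by (simp only: half_coeff_gbinomial mult_ac)
  qed simp
  \<comment> \<open>Vandermonde's identity adds the two upper entries \<open>-1/2\<close> to
    \<open>-1\<close>, and \<open>-1 gchoose m\<close> is \<open>(-1)^m\<close>.\<close>
  also have "\<dots> = (-1)^m * ((-1/2 + -1/2 :: real) gchoose m)"
    unfolding sum_distrib_left[symmetric] atMost_atLeast0 by (subst gbinomial_Vandermonde) simp
  also have "\<dots> = 1"
    by (cases "even m") (simp_all add: gbinomial_pochhammer pochhammer_fact[symmetric])
  finally show ?thesis .
qed

lemma half_coeff_triangle:
  "(\<Sum>m<n. \<tau> m) = (\<Sum>(i,j)\<in>{(i,j). i + j < n}. half_coeff i * half_coeff j * \<tau> (i + j))"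
proof -
  have "(\<Sum>(i,j)\<in>{(i,j). i + j < n}. half_coeff i * half_coeff j * \<tau> (i + j))
      = (\<Sum>m<n. \<Sum>i\<le>m. half_coeff i * half_coeff (m - i) * \<tau> m)"
    by (subst sum.triangle_reindex) simp
  then show ?thesis by (simp add: sum_distrib_right[symmetric] half_coeff_conv)
qed

text \<open>The square \<open>j, k < n\<close> lies between the triangles \<open>j + k < n\<close>
  and \<open>j + k < 2 * n\<close>. Over a triangle the coefficients add up to 1 on each diagonal,
  which leaves plain partial sums of \<open>\<tau>\<close>.\<close>

lemma half_coeff_square_bounds:
  fixes \<tau> :: "nat \<Rightarrow> real"
  assumes "\<And>m. 0 \<le> \<tau> m"
  shows "(\<Sum>m<n. \<tau> m) \<le> (\<Sum>j<n. \<Sum>k<n. half_coeff j * half_coeff k * \<tau> (j + k))"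
    and "(\<Sum>j<n. \<Sum>k<n. half_coeff j * half_coeff k * \<tau> (j + k)) \<le> (\<Sum>m<2*n. \<tau> m)"
proof -
  have fin: "finite {(i,j). i + j < (m::nat)}" for m
    by (rule finite_subset[of _ "{..<m} \<times> {..<m}"]) auto
  show "(\<Sum>m<n. \<tau> m) \<le> (\<Sum>j<n. \<Sum>k<n. half_coeff j * half_coeff k * \<tau> (j + k))"
    unfolding half_coeff_triangle[of \<tau>] sum.cartesian_product
    by (rule sum_mono2) (use assms in \<open>auto simp: half_coeff_nonneg\<close>)
  show "(\<Sum>j<n. \<Sum>k<n. half_coeff j * half_coeff k * \<tau> (j + k)) \<le> (\<Sum>m<2*n. \<tau> m)"
    unfolding half_coeff_triangle[of \<tau>] sum.cartesian_product
    by (rule sum_mono2[OF fin]) (use assms in \<open>auto simp: half_coeff_nonneg\<close>)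
qed

text \<open>The carrier is \<open>space M\<close>. The Haar measure of a compact group has all three
  invariances; for rotations the last two are derived from left invariance in
  \<open>distr_haar_right\<close> and \<open>distr_haar_inv\<close>.\<close>

locale prob_group = prob_space M for M :: "'a measure" +
  fixes mul :: "'a \<Rightarrow> 'a \<Rightarrow> 'a" (infixl "\<odot>" 70) and inv :: "'a \<Rightarrow> 'a" and one :: 'a
  assumes mul_meas: "(\<lambda>(g, h). g \<odot> h) \<in> measurable (M \<Otimes>\<^sub>M M) M"
    and inv_meas: "inv \<in> measurable M M"
    and assoc: "g \<in> space M \<Longrightarrow> h \<in> space M \<Longrightarrow> k \<in> space M \<Longrightarrow> g \<odot> h \<odot> k = g \<odot> (h \<odot> k)"
    and one_in: "one \<in> space M"
    and one_left: "g \<in> space M \<Longrightarrow> one \<odot> g = g" and one_right: "g \<in> space M \<Longrightarrow> g \<odot> one = g"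
    and inv_left: "g \<in> space M \<Longrightarrow> inv g \<odot> g = one" and inv_right: "g \<in> space M \<Longrightarrow> g \<odot> inv g = one"
    and left_inv: "g \<in> space M \<Longrightarrow> distr M M (\<lambda>h. g \<odot> h) = M"
    and right_inv: "g \<in> space M \<Longrightarrow> distr M M (\<lambda>h. h \<odot> g) = M"
    and inverse_inv: "distr M M inv = M"
begin

lemma pair_closed: "pair_sigma_finite M M" ..

lemma mul_in: "g \<in> space M \<Longrightarrow> h \<in> space M \<Longrightarrow> g \<odot> h \<in> space M"
  using measurable_space[OF mul_meas, of "(g,h)"] by (simp add: space_pair_measure)

lemma inv_in: "g \<in> space M \<Longrightarrow> inv g \<in> space M"
  using measurable_space[OF inv_meas] .

lemma measurable_mul [measurable (raw)]:
  "f \<in> measurable N M \<Longrightarrow> f' \<in> measurable N M \<Longrightarrow> (\<lambda>x. f x \<odot> f' x) \<in> measurable N M"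
  using measurable_compose[OF measurable_Pair mul_meas, of f N f'] by simp

lemma measurable_inv [measurable (raw)]:
  "f \<in> measurable N M \<Longrightarrow> (\<lambda>x. inv (f x)) \<in> measurable N M"
  using measurable_compose[OF _ inv_meas] .

lemma inv_inv: "g \<in> space M \<Longrightarrow> inv (inv g) = g"
  by (metis assoc inv_in inv_left inv_right one_left one_right)

lemma cancel_left: "g \<in> space M \<Longrightarrow> h \<in> space M \<Longrightarrow> inv g \<odot> (g \<odot> h) = h"
  by (metis assoc inv_in inv_left one_left)

lemma cancel_right: "g \<in> space M \<Longrightarrow> h \<in> space M \<Longrightarrow> h \<odot> g \<odot> inv g = h"
  by (metis assoc inv_in inv_right one_right)

lemma inv_mul: "g \<in> space M \<Longrightarrow> h \<in> space M \<Longrightarrow> inv (g \<odot> h) = inv h \<odot> inv g"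
  by (metis assoc cancel_right inv_in inv_left mul_in one_left)

lemma inv_left_inv: "g \<in> space M \<Longrightarrow> distr M M (\<lambda>h. inv h \<odot> g) = M"
proof -
  assume g: "g \<in> space M"
  have "distr (distr M M inv) M (\<lambda>h. h \<odot> g) = distr M M ((\<lambda>h. h \<odot> g) \<circ> inv)"
    by (rule distr_distr) (use g in measurable)
  then show ?thesis using g by (simp add: inverse_inv right_inv o_def)
qed

lemma integral_preserving:
  fixes f :: "'a \<Rightarrow> 'b::{banach, second_countable_topology}"
  assumes "p \<in> measurable M M" "distr M M p = M" "f \<in> borel_measurable M"
  shows "(\<integral>x. f (p x) \<partial>M) = (\<integral>x. f x \<partial>M)"
  using integral_distr[OF assms(1), of f] assms(2,3) by simp

lemma integrable_preserving:
  fixes f :: "'a \<Rightarrow> 'b::{banach, second_countable_topology}"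
  assumes "p \<in> measurable M M" "distr M M p = M" "f \<in> borel_measurable M"
  shows "integrable M (\<lambda>x. f (p x)) \<longleftrightarrow> integrable M f"
  using integrable_distr_eq[OF assms(1), of f] assms(2,3) by simp

lemma nn_integral_preserving:
  assumes "p \<in> measurable M M" "distr M M p = M" "f \<in> borel_measurable M"
  shows "(\<integral>\<^sup>+x. f (p x) \<partial>M) = (\<integral>\<^sup>+x. f x \<partial>M)"
  using nn_integral_distr[OF assms(1), of f] assms(2,3) by simp

lemma sq_integrable_preserving:
  assumes "p \<in> measurable M M" "distr M M p = M" "sq_integrable M f"
  shows "sq_integrable M (\<lambda>x. f (p x))"
proof -
  note [measurable] = assms(1) sq_integrable_measurable[OF assms(3)]
  show ?thesis
    unfolding sq_integrable_def
    by (auto intro!: sq_integrableD[OF assms(3)] simp: integrable_preserving[OF assms(1,2), of "\<lambda>x. (norm (f x))\<^sup>2"])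
qed

lemma l2sq_preserving:
  assumes "p \<in> measurable M M" "distr M M p = M" "f \<in> borel_measurable M"
  shows "l2sq M (\<lambda>x. f (p x)) = l2sq M f"
  unfolding l2sq_def using assms by (intro integral_preserving) auto

text \<open>For L^2 factors this integral exists at every point of the group and is bounded by
  \<open>conv_bound\<close>, so the identities for convolutions below hold pointwise and not only
  almost everywhere.\<close>

definition conv :: "('a \<Rightarrow> complex) \<Rightarrow> ('a \<Rightarrow> complex) \<Rightarrow> 'a \<Rightarrow> complex" where
  "conv v w g = (\<integral>h. v h * w (inv h \<odot> g) \<partial>M)"

lemma sq_integrable_one [simp]: "sq_integrable M (\<lambda>_. c)"
  by (simp add: sq_integrable_def)

lemma l2sq_const [simp]: "l2sq M (\<lambda>_. c) = (norm c)\<^sup>2"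
  by (simp add: l2sq_def prob_space)

lemma sq_integrable_integrable: "sq_integrable M v \<Longrightarrow> integrable M v"
  using integrable_mult_L2[of M v "\<lambda>_. 1"] by simp

lemma conv_shift:
  assumes "sq_integrable M w" "g \<in> space M"
  shows "sq_integrable M (\<lambda>h. w (inv h \<odot> g))" "l2sq M (\<lambda>h. w (inv h \<odot> g)) = l2sq M w"
proof -
  have m: "(\<lambda>h. inv h \<odot> g) \<in> measurable M M" using assms(2) by measurable
  show "sq_integrable M (\<lambda>h. w (inv h \<odot> g))" "l2sq M (\<lambda>h. w (inv h \<odot> g)) = l2sq M w"
    by (rule sq_integrable_preserving[OF m inv_left_inv], use assms in auto)
       (rule l2sq_preserving[OF m inv_left_inv], use assms in auto)
qed

lemma conv_integrable:
  assumes "sq_integrable M v" "sq_integrable M w" "g \<in> space M"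
  shows "integrable M (\<lambda>h. v h * w (inv h \<odot> g))"
  by (rule integrable_mult_L2[OF assms(1) conv_shift(1)[OF assms(2,3)]])

lemma conv_bound:
  assumes "sq_integrable M v" "sq_integrable M w" "g \<in> space M"
  shows "norm (conv v w g) \<le> sqrt (l2sq M v * l2sq M w)"
  using l2_cs[OF assms(1) conv_shift(1)[OF assms(2,3)]]
  unfolding conv_def conv_shift(2)[OF assms(2,3)] by (rule real_le_rsqrt)

lemma conv_measurable [measurable]:
  assumes [measurable]: "v \<in> borel_measurable M" "w \<in> borel_measurable M"
  shows "conv v w \<in> borel_measurable M"
  unfolding conv_def by measurable

lemma conv_L2:
  assumes "sq_integrable M v" "sq_integrable M w"
  shows "sq_integrable M (conv v w)"
  by (rule sq_integrable_bounded_by[of M "\<lambda>_. of_real (sqrt (l2sq M v * l2sq M w))"])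
     (use conv_bound[OF assms] assms in \<open>auto simp del: of_real_mult simp: norm_of_real real_sqrt_mult[symmetric]\<close>)

lemma l2sq_conv:
  assumes "sq_integrable M v" "sq_integrable M w"
  shows "l2sq M (conv v w) \<le> l2sq M v * l2sq M w"
proof -
  have "l2sq M (conv v w) \<le> (\<integral>x. l2sq M v * l2sq M w \<partial>M)"
    unfolding l2sq_def[of M "conv v w"]
  proof (rule integral_mono)
    fix x assume "x \<in> space M"
    from conv_bound[OF assms this] have "(norm (conv v w x))\<^sup>2 \<le> (sqrt (l2sq M v * l2sq M w))\<^sup>2"
      by (intro power_mono) auto
    then show "(norm (conv v w x))\<^sup>2 \<le> l2sq M v * l2sq M w" by simp
  qed (use sq_integrableD[OF conv_L2[OF assms]] in auto)
  then show ?thesis by (simp add: prob_space)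
qed

lemma conv_diff_left:
  assumes "sq_integrable M v" "sq_integrable M v'" "sq_integrable M w" "g \<in> space M"
  shows "conv (\<lambda>x. v x - v' x) w g = conv v w g - conv v' w g"
  by (simp add: conv_def left_diff_distrib conv_integrable[OF assms(1,3,4)] conv_integrable[OF assms(2,3,4)])

lemma conv_diff_right:
  assumes "sq_integrable M v" "sq_integrable M w'" "sq_integrable M w" "g \<in> space M"
  shows "conv v (\<lambda>x. w x - w' x) g = conv v w g - conv v w' g"
  by (simp add: conv_def right_diff_distrib conv_integrable[OF assms(1,3,4)] conv_integrable[OF assms(1,2,4)])

lemma conv_sum_right:
  assumes "sq_integrable M v" "\<And>i. i \<in> A \<Longrightarrow> sq_integrable M (w i)" "g \<in> space M"
  shows "conv v (\<lambda>x. \<Sum>i\<in>A. c i * w i x) g = (\<Sum>i\<in>A. c i * conv v (w i) g)"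
proof -
  have "conv v (\<lambda>x. \<Sum>i\<in>A. c i * w i x) g = (\<integral>h. (\<Sum>i\<in>A. c i * (v h * w i (inv h \<odot> g))) \<partial>M)"
    by (simp add: conv_def sum_distrib_left mult_ac)
  also have "\<dots> = (\<Sum>i\<in>A. c i * conv v (w i) g)"
    by (subst Bochner_Integration.integral_sum)
       (auto simp: conv_def intro!: integrable_mult_right conv_integrable assms)
  finally show ?thesis .
qed

lemma conv_cong:
  assumes "\<And>x. x \<in> space M \<Longrightarrow> v x = v' x" "\<And>x. x \<in> space M \<Longrightarrow> w x = w' x" "g \<in> space M"
  shows "conv v w g = conv v' w' g"
  unfolding conv_def by (rule Bochner_Integration.integral_cong) (use assms in \<open>auto simp: mul_in inv_in\<close>)

text \<open>Cauchy-Schwarz in \<open>h\<close> bounds the inner integral uniformly in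
  \<open>k\<close>, since translation and inversion preserve the norms of \<open>v\<close> and
  \<open>w\<close>; what remains is the integrable function \<open>u\<close>.\<close>

lemma integrable_assoc:
  assumes u: "sq_integrable M u" and v: "sq_integrable M v" and w: "sq_integrable M w" and g: "g \<in> space M"
  shows "integrable (M \<Otimes>\<^sub>M M) (\<lambda>(k, h). u k * v (inv k \<odot> h) * w (inv h \<odot> g))"
proof -
  interpret P: pair_sigma_finite M M by (rule pair_closed)
  note [measurable] = sq_integrable_measurable[OF u] sq_integrable_measurable[OF v] sq_integrable_measurable[OF w]
  have int: "integrable M (\<lambda>h. norm (v (inv k \<odot> h)) * norm (w (inv h \<odot> g)))"
    and bd: "(\<integral>h. norm (v (inv k \<odot> h)) * norm (w (inv h \<odot> g)) \<partial>M) \<le> sqrt (l2sq M v * l2sq M w)"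
    if k: "k \<in> space M" for k
  proof -
    have m: "(\<lambda>h. inv k \<odot> h) \<in> measurable M M" using inv_in[OF k] by measurable
    have v': "sq_integrable M (\<lambda>h. v (inv k \<odot> h))" "l2sq M (\<lambda>h. v (inv k \<odot> h)) = l2sq M v"
      by (rule sq_integrable_preserving[OF m left_inv v], use k in \<open>auto intro: inv_in\<close>)
         (rule l2sq_preserving[OF m left_inv], use k in \<open>auto intro: inv_in\<close>)
    show "integrable M (\<lambda>h. norm (v (inv k \<odot> h)) * norm (w (inv h \<odot> g)))"
      by (rule integrable_norm_mult[OF v'(1) conv_shift(1)[OF w g]])
    show "(\<integral>h. norm (v (inv k \<odot> h)) * norm (w (inv h \<odot> g)) \<partial>M) \<le> sqrt (l2sq M v * l2sq M w)"
      using l2sq_cs_norm[OF v'(1) conv_shift(1)[OF w g]] unfolding v'(2) conv_shift(2)[OF w g]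
      by (rule real_le_rsqrt)
  qed
  show ?thesis
  proof (rule P.integrable_pair_bound[where b = "\<lambda>k. norm (u k) * sqrt (l2sq M v * l2sq M w)"])
    show "(\<lambda>(k, h). u k * v (inv k \<odot> h) * w (inv h \<odot> g)) \<in> borel_measurable (M \<Otimes>\<^sub>M M)"
      using g by measurable
    show "integrable M (\<lambda>k. norm (u k) * sqrt (l2sq M v * l2sq M w))"
      by (intro integrable_mult_left integrable_norm sq_integrable_integrable u)
    fix k assume k: "k \<in> space M"
    have [measurable]: "inv k \<in> space M" by (rule inv_in[OF k])
    have "integrable M (\<lambda>h. norm (u k) * (norm (v (inv k \<odot> h)) * norm (w (inv h \<odot> g))))"
      by (intro integrable_mult_right int k)
    then show "integrable M (\<lambda>h. case (k, h) of (k, h) \<Rightarrow> u k * v (inv k \<odot> h) * w (inv h \<odot> g))"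
      by (rule Bochner_Integration.integrable_bound) (use g in \<open>auto simp: norm_mult\<close>)
    show "(\<integral>h. norm (case (k, h) of (k, h) \<Rightarrow> u k * v (inv k \<odot> h) * w (inv h \<odot> g)) \<partial>M) \<le> norm (u k) * sqrt (l2sq M v * l2sq M w)"
      using mult_left_mono[OF bd[OF k], of "norm (u k)"] by (simp add: norm_mult mult.assoc)
  qed
qed

lemma conv_assoc:
  assumes u: "sq_integrable M u" and v: "sq_integrable M v" and w: "sq_integrable M w" and g: "g \<in> space M"
  shows "conv (conv u v) w g = conv u (conv v w) g"
proof -
  interpret P: pair_sigma_finite M M by (rule pair_closed)
  note [measurable] = sq_integrable_measurable[OF u] sq_integrable_measurable[OF v] sq_integrable_measurable[OF w]
  have "conv (conv u v) w g = (\<integral>h. (\<integral>k. u k * v (inv k \<odot> h) * w (inv h \<odot> g) \<partial>M) \<partial>M)"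
    by (simp add: conv_def)
  also have "\<dots> = (\<integral>k. (\<integral>h. u k * v (inv k \<odot> h) * w (inv h \<odot> g) \<partial>M) \<partial>M)"
    using P.Fubini_integral[OF integrable_assoc[OF assms]] by simp
  also have "\<dots> = (\<integral>k. u k * conv v w (inv k \<odot> g) \<partial>M)"
  proof (rule Bochner_Integration.integral_cong)
    fix k assume k: "k \<in> space M"
    have [measurable]: "inv k \<in> space M" by (rule inv_in[OF k])
    have "(\<integral>h. v (inv k \<odot> h) * w (inv h \<odot> g) \<partial>M) = (\<integral>h. v (inv k \<odot> (k \<odot> h)) * w (inv (k \<odot> h) \<odot> g) \<partial>M)"
      using k g by (intro integral_preserving[symmetric, OF _ left_inv]) auto
    also have "\<dots> = conv v w (inv k \<odot> g)"
      unfolding conv_def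
      by (rule Bochner_Integration.integral_cong) (use k g in \<open>simp_all add: cancel_left inv_mul assoc inv_in mul_in\<close>)
    finally show "(\<integral>h. u k * v (inv k \<odot> h) * w (inv h \<odot> g) \<partial>M) = u k * conv v w (inv k \<odot> g)"
      by (simp add: mult.assoc)
  qed simp
  finally show ?thesis by (simp add: conv_def)
qed

end

section \<open>Square roots of positive convolution kernels\<close>

text \<open>With \<open>A v = conv v \<phi>\<close>, Hermitian symmetry makes A self-adjoint, and
  \<open>contraction\<close> is the operator inequality \<open>A <= 1\<close>, that is
  \<open>B >= 0\<close>.\<close>

locale conv_kernel = prob_group +
  fixes \<phi> :: "'a \<Rightarrow> complex"
  assumes \<phi>_L2: "sq_integrable M \<phi>"
    and \<phi>_herm: "g \<in> space M \<Longrightarrow> \<phi> (inv g) = cnj (\<phi> g)"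
    and contraction: "sq_integrable M v \<Longrightarrow> Re (l2ip M (conv v \<phi>) v) \<le> l2sq M v"
begin

definition B :: "('a \<Rightarrow> complex) \<Rightarrow> 'a \<Rightarrow> complex" where
  "B v g = v g - conv v \<phi> g"

definition Bp :: "nat \<Rightarrow> ('a \<Rightarrow> complex) \<Rightarrow> 'a \<Rightarrow> complex" where
  "Bp k v = (B ^^ k) v"

lemma Bp_0 [simp]: "Bp 0 v = v" and Bp_Suc: "Bp (Suc k) v = B (Bp k v)"
  by (simp_all add: Bp_def)

lemma Bp_add: "Bp (j + k) v = Bp j (Bp k v)"
  by (simp add: Bp_def funpow_add)

lemma B_L2: "sq_integrable M v \<Longrightarrow> sq_integrable M (B v)"
  unfolding B_def by (intro sq_integrable_diff conv_L2 \<phi>_L2)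

lemma Bp_L2: "sq_integrable M v \<Longrightarrow> sq_integrable M (Bp k v)"
  by (induction k) (auto simp: Bp_Suc B_L2)

text \<open>After Fubini, \<open>\<phi>_herm\<close> exchanges the arguments
  \<open>inv h \<odot> g\<close> and \<open>inv g \<odot> h\<close>.\<close>

lemma conv_adj:
  assumes v: "sq_integrable M v" and w: "sq_integrable M w"
  shows "l2ip M (conv v \<phi>) w = l2ip M v (conv w \<phi>)"
proof -
  interpret P: pair_sigma_finite M M by (rule pair_closed)
  note [measurable] = sq_integrable_measurable[OF v] sq_integrable_measurable[OF w] sq_integrable_measurable[OF \<phi>_L2]
  have int: "integrable (M \<Otimes>\<^sub>M M) (\<lambda>(g, h). v h * \<phi> (inv h \<odot> g) * cnj (w g))"
  proof (rule P.integrable_pair_bound[where b = "\<lambda>g. sqrt (l2sq M v * l2sq M \<phi>) * norm (w g)"])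
    show "integrable M (\<lambda>g. sqrt (l2sq M v * l2sq M \<phi>) * norm (w g))"
      by (intro integrable_mult_right integrable_norm sq_integrable_integrable w)
    fix g assume g: "g \<in> space M"
    show "integrable M (\<lambda>h. case (g, h) of (g, h) \<Rightarrow> v h * \<phi> (inv h \<odot> g) * cnj (w g))"
      using g by (auto intro!: integrable_mult_left conv_integrable[OF v \<phi>_L2])
    have "(\<integral>h. norm (v h) * norm (\<phi> (inv h \<odot> g)) \<partial>M) \<le> sqrt (l2sq M v * l2sq M \<phi>)"
      using l2sq_cs_norm[OF v conv_shift(1)[OF \<phi>_L2 g]] unfolding conv_shift(2)[OF \<phi>_L2 g]
      by (rule real_le_rsqrt)
    from mult_right_mono[OF this norm_ge_zero[of "w g"]]
    show "(\<integral>h. norm (case (g, h) of (g, h) \<Rightarrow> v h * \<phi> (inv h \<odot> g) * cnj (w g)) \<partial>M)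
        \<le> sqrt (l2sq M v * l2sq M \<phi>) * norm (w g)" by (simp add: norm_mult)
  qed measurable
  have "l2ip M (conv v \<phi>) w = (\<integral>g. \<integral>h. v h * \<phi> (inv h \<odot> g) * cnj (w g) \<partial>M \<partial>M)"
    by (simp add: l2ip_def conv_def)
  also have "\<dots> = (\<integral>h. \<integral>g. v h * \<phi> (inv h \<odot> g) * cnj (w g) \<partial>M \<partial>M)"
    using P.Fubini_integral[OF int] by simp
  also have "\<dots> = l2ip M v (conv w \<phi>)"
    unfolding l2ip_def
  proof (rule Bochner_Integration.integral_cong)
    fix h assume h: "h \<in> space M"
    have "cnj (conv w \<phi> h) = (\<integral>g. cnj (w g * \<phi> (inv g \<odot> h)) \<partial>M)"
      unfolding conv_def by (rule Bochner_Integration.integral_cnj[symmetric])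
    also have "\<dots> = (\<integral>g. \<phi> (inv h \<odot> g) * cnj (w g) \<partial>M)"
    proof (rule Bochner_Integration.integral_cong)
      fix g assume g: "g \<in> space M"
      show "cnj (w g * \<phi> (inv g \<odot> h)) = \<phi> (inv h \<odot> g) * cnj (w g)"
        using \<phi>_herm[of "inv g \<odot> h"] g h by (simp add: inv_mul inv_in mul_in inv_inv)
    qed simp
    finally show "(\<integral>g. v h * \<phi> (inv h \<odot> g) * cnj (w g) \<partial>M) = v h * cnj (conv w \<phi> h)"
      by (simp add: mult.assoc)
  qed simp
  finally show ?thesis .
qed

lemma B_adj:
  assumes v: "sq_integrable M v" and w: "sq_integrable M w"
  shows "l2ip M (B v) w = l2ip M v (B w)"
  unfolding B_def
  by (simp add: l2ip_diff_left l2ip_diff_right assms conv_L2 \<phi>_L2 conv_adj)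

lemma Bp_adj:
  assumes v: "sq_integrable M v" and w: "sq_integrable M w"
  shows "l2ip M (Bp k v) w = l2ip M v (Bp k w)"
  using w
proof (induction k arbitrary: w)
  case (Suc k)
  have "l2ip M (Bp (Suc k) v) w = l2ip M (Bp k v) (B w)"
    using Suc.prems by (simp add: Bp_Suc B_adj Bp_L2 v)
  also have "\<dots> = l2ip M v (Bp k (B w))" by (intro Suc.IH B_L2 Suc.prems)
  also have "Bp k (B w) = Bp (Suc k) w" by (simp add: Bp_def funpow_swap1)
  finally show ?case .
qed simp

lemma Bp_ip_add:
  assumes "sq_integrable M v" "sq_integrable M w"
  shows "l2ip M (Bp j v) (Bp k w) = l2ip M (Bp (j + k) v) w"
  using Bp_adj[OF Bp_L2[OF assms(1)] assms(2), of k j] by (simp add: Bp_add[symmetric] add.commute)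

text \<open>For even \<open>m\<close> the form is the squared norm of \<open>B^j v\<close>. For odd
  \<open>m\<close> it is \<open><B w, w>\<close> with \<open>w = B^j v\<close>, which is nonnegative
  by \<open>contraction\<close>.\<close>

lemma Bp_pos: "sq_integrable M v \<Longrightarrow> 0 \<le> Re (l2ip M (Bp m v) v)"
proof -
  assume v: "sq_integrable M v"
  obtain j where "m = j + j \<or> m = Suc j + j" by (metis add_Suc evenE mult_2 oddE Suc_eq_plus1)
  then show ?thesis
  proof
    assume "m = j + j"
    then show ?thesis using Bp_ip_add[OF v v, of j j] unfolding l2ip_self
      by (metis Re_complex_of_real l2sq_nonneg)
  next
    assume m: "m = Suc j + j"
    have w: "sq_integrable M (Bp j v)" by (rule Bp_L2[OF v])
    have "l2ip M (Bp m v) v = l2ip M (B (Bp j v)) (Bp j v)"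
      using Bp_ip_add[OF v v, of "Suc j" j] m by (simp add: Bp_Suc)
    also have "\<dots> = of_real (l2sq M (Bp j v)) - l2ip M (conv (Bp j v) \<phi>) (Bp j v)"
      unfolding B_def by (simp add: l2ip_diff_left w conv_L2 \<phi>_L2 l2ip_self)
    finally show ?thesis using contraction[OF w] by simp
  qed
qed

text \<open>Convolution on the left commutes with A by associativity. This moves powers of B from a
  kernel to the function it acts on and back.\<close>

lemma conv_Bp:
  assumes v: "sq_integrable M v" and w: "sq_integrable M w" and g: "g \<in> space M"
  shows "conv v (Bp k w) g = Bp k (conv v w) g"
  using g
proof (induction k arbitrary: g)
  case (Suc k)
  have "conv v (Bp (Suc k) w) g = conv v (Bp k w) g - conv v (conv (Bp k w) \<phi>) g"
    unfolding Bp_Suc B_def using Suc.prems by (intro conv_diff_right v Bp_L2 w conv_L2 \<phi>_L2)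
  also have "conv v (conv (Bp k w) \<phi>) g = conv (conv v (Bp k w)) \<phi> g"
    using Suc.prems by (intro conv_assoc[symmetric] v Bp_L2 w \<phi>_L2)
  also have "\<dots> = conv (Bp k (conv v w)) \<phi> g"
    by (rule conv_cong) (use Suc in auto)
  finally show ?case using Suc by (simp add: Bp_Suc B_def)
qed simp

text \<open>For \<open>a = \<phi>\<close> this is the trace of \<open>B^m A^2\<close>, because the
  Hilbert-Schmidt norm of a convolution operator is the L^2 norm of its kernel. For
  \<open>a = conv v \<phi>\<close> it is the same operator tested on the vector
  \<open>v\<close>.\<close>

definition tau :: "('a \<Rightarrow> complex) \<Rightarrow> nat \<Rightarrow> real" where
  "tau a m = Re (l2ip M (Bp m a) a)"

definition approx_root :: "nat \<Rightarrow> 'a \<Rightarrow> complex" where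
  "approx_root n g = (\<Sum>k<n. of_real (half_coeff k) * Bp k \<phi> g)"

lemma approx_root_L2: "sq_integrable M (approx_root n)"
  unfolding approx_root_def by (intro sq_integrable_sum sq_integrable_scale Bp_L2 \<phi>_L2)

text \<open>Self-adjointness of B leaves only the sum \<open>j + k\<close> of the two
  exponents.\<close>

lemma l2sq_Bp_sum:
  assumes a: "sq_integrable M a" and "finite S"
  shows "l2sq M (\<lambda>g. \<Sum>k\<in>S. of_real (half_coeff k) * Bp k a g)
    = (\<Sum>j\<in>S. \<Sum>k\<in>S. half_coeff j * half_coeff k * tau a (j + k))"
proof -
  let ?u = "\<lambda>k g. of_real (half_coeff k) * Bp k a g"
  have u: "sq_integrable M (?u k)" for k by (intro sq_integrable_scale Bp_L2 a)
  have "of_real (l2sq M (\<lambda>g. \<Sum>k\<in>S. ?u k g)) = l2ip M (\<lambda>g. \<Sum>j\<in>S. ?u j g) (\<lambda>g. \<Sum>k\<in>S. ?u k g)"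
    by (simp add: l2ip_self)
  also have "\<dots> = (\<Sum>j\<in>S. \<Sum>k\<in>S. l2ip M (?u j) (?u k))"
    by (subst l2ip_sum_left) (use u in \<open>auto intro!: sum.cong l2ip_sum_right sq_integrable_sum\<close>)
  also have "\<dots> = (\<Sum>j\<in>S. \<Sum>k\<in>S. of_real (half_coeff j * half_coeff k) * l2ip M (Bp (j + k) a) a)"
    by (simp add: l2ip_scale_left l2ip_scale_right Bp_ip_add a mult_ac)
  finally have "l2sq M (\<lambda>g. \<Sum>k\<in>S. ?u k g) =
      Re (\<Sum>j\<in>S. \<Sum>k\<in>S. of_real (half_coeff j * half_coeff k) * l2ip M (Bp (j + k) a) a)"
    by (metis Re_complex_of_real)
  then show ?thesis by (simp add: tau_def)
qed

lemma tau_nonneg: "sq_integrable M a \<Longrightarrow> 0 \<le> tau a m"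
  unfolding tau_def by (rule Bp_pos)

text \<open>One factor A moves to the other side of the inner product, and \<open>A = 1 - B\<close>
  turns it into a difference.\<close>

lemma tau_conv_telescope:
  assumes v: "sq_integrable M v"
  defines "a \<equiv> conv v \<phi>"
  shows "tau a m = Re (l2ip M (Bp m a) v) - Re (l2ip M (Bp (Suc m) a) v)"
proof -
  have a: "sq_integrable M a" unfolding a_def by (intro conv_L2 v \<phi>_L2)
  have "l2ip M (Bp m a) a = l2ip M (conv (Bp m a) \<phi>) v"
    unfolding a_def[symmetric] using conv_adj[OF Bp_L2[OF a] v] by (simp add: a_def)
  also have "\<dots> = l2ip M (\<lambda>g. Bp m a g - Bp (Suc m) a g) v"
    by (simp add: Bp_Suc B_def)
  finally show ?thesis by (simp add: tau_def l2ip_diff_left Bp_L2 a v)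
qed

lemma tau_conv_sums:
  assumes v: "sq_integrable M v"
  defines "a \<equiv> conv v \<phi>"
  shows "(\<Sum>m<n. tau a m) = Re (l2ip M a v) - Re (l2ip M (Bp n a) v)"
  unfolding a_def tau_conv_telescope[OF v]
  using sum_lessThan_telescope'[of "\<lambda>m. Re (l2ip M (Bp m (conv v \<phi>)) v)" n] by simp

text \<open>The norm of \<open>conv v f\<close> is found from the partial sums: by
  \<open>half_coeff_square_bounds\<close> theirs lies between partial sums of
  \<open>tau (conv v \<phi>)\<close>, which telescope to \<open><A v, v> - <B^n A v, v>\<close>. The
  bound on the traces serves twice, for the Cauchy property and for the vanishing of this
  remainder.\<close>

theorem sqrt_conv:
  assumes trace: "\<And>n. (\<Sum>m<n. tau \<phi> m) \<le> C"
  obtains r where "strict_mono r" and "sq_integrable M (\<lambda>x. climit (\<lambda>k. approx_root (r k) x))"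
    and "\<And>v. sq_integrable M v \<Longrightarrow>
      l2sq M (conv v (\<lambda>x. climit (\<lambda>k. approx_root (r k) x))) = Re (l2ip M (conv v \<phi>) v)"
proof -
  let ?L = "\<lambda>a n. \<Sum>j<n. \<Sum>k<n. half_coeff j * half_coeff k * tau a (j + k)"
  note tau_nn = tau_nonneg[OF \<phi>_L2]
  have L_mono: "mono (?L \<phi>)"
    unfolding sum.cartesian_product
    by (intro monoI sum_mono2) (auto simp: half_coeff_nonneg tau_nn)
  have L_bd: "?L \<phi> n \<le> C" for n
    using half_coeff_square_bounds(2)[of "tau \<phi>" n] tau_nn trace[of "2*n"] by force
  \<comment> \<open>Only the indices from \<open>n\<close> to \<open>m - 1\<close> survive in the
    difference, and their square lies in the larger index square minus the smaller one.\<close>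
  have diff: "l2sq M (\<lambda>x. approx_root m x - approx_root n x) \<le> ?L \<phi> m - ?L \<phi> n" if "n \<le> m" for m n
  proof -
    have split: "{..<m} = {..<n} \<union> {n..<m}" "{..<n} \<inter> {n..<m} = {}" using that by auto
    have "approx_root m x - approx_root n x = (\<Sum>k\<in>{n..<m}. of_real (half_coeff k) * Bp k \<phi> x)" for x
      unfolding approx_root_def split by (subst sum.union_disjoint) auto
    then have "l2sq M (\<lambda>x. approx_root m x - approx_root n x)
       = (\<Sum>j\<in>{n..<m}. \<Sum>k\<in>{n..<m}. half_coeff j * half_coeff k * tau \<phi> (j + k))"
      by (simp add: l2sq_Bp_sum[OF \<phi>_L2])
    also have "\<dots> \<le> (\<Sum>(j,k)\<in>{..<m} \<times> {..<m} - {..<n} \<times> {..<n}. half_coeff j * half_coeff k * tau \<phi> (j + k))"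
      unfolding sum.cartesian_product
      by (intro sum_mono2) (auto simp: half_coeff_nonneg tau_nn)
    also have "\<dots> = ?L \<phi> m - ?L \<phi> n"
      unfolding sum.cartesian_product using that by (intro sum_diff) auto
    finally show ?thesis .
  qed
  obtain l where "?L \<phi> \<longlonglongrightarrow> l"
    using incseq_convergent[OF L_mono, of C] L_bd by blast
  then have "Cauchy (?L \<phi>)" by (rule LIMSEQ_imp_Cauchy)
  have cauchy: "\<exists>N. \<forall>m\<ge>N. \<forall>n\<ge>N. l2sq M (\<lambda>x. approx_root m x - approx_root n x) < e" if "e > 0" for e
  proof -
    obtain N where N: "\<And>m n. m \<ge> N \<Longrightarrow> n \<ge> N \<Longrightarrow> dist (?L \<phi> m) (?L \<phi> n) < e"
      using \<open>Cauchy (?L \<phi>)\<close> \<open>e > 0\<close> unfolding Cauchy_def by blast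
    have "l2sq M (\<lambda>x. approx_root m x - approx_root n x) < e" if "m \<ge> N" "n \<ge> N" for m n
    proof (cases "n \<le> m")
      case True
      then show ?thesis using diff[of n m] N[OF that] by (auto simp: dist_real_def)
    next
      case False
      then show ?thesis using diff[of m n] N[OF that] l2sq_minus_commute[of M "approx_root m" "approx_root n"]
        by (auto simp: dist_real_def)
    qed
    then show ?thesis by blast
  qed
  obtain r where r: "strict_mono r" and fL: "sq_integrable M (\<lambda>x. climit (\<lambda>k. approx_root (r k) x))"
    and lim: "(\<lambda>n. l2sq M (\<lambda>x. approx_root n x - climit (\<lambda>k. approx_root (r k) x))) \<longlonglongrightarrow> 0"
    using L2_complete[OF approx_root_L2 cauchy] by blast
  let ?f = "\<lambda>x. climit (\<lambda>k. approx_root (r k) x)"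
  have "l2sq M (conv v ?f) = Re (l2ip M (conv v \<phi>) v)" if v: "sq_integrable M v" for v
  proof -
    let ?a = "conv v \<phi>"
    have a: "sq_integrable M ?a" by (intro conv_L2 v \<phi>_L2)
    have "(\<lambda>n. l2sq M (\<lambda>x. conv v (approx_root n) x - conv v ?f x)) \<longlonglongrightarrow> 0"
    proof (rule real_tendsto_sandwich[of "\<lambda>_. 0" _ _ "\<lambda>n. l2sq M v * l2sq M (\<lambda>x. approx_root n x - ?f x)"])
      show "\<forall>\<^sub>F n in sequentially. l2sq M (\<lambda>x. conv v (approx_root n) x - conv v ?f x)
          \<le> l2sq M v * l2sq M (\<lambda>x. approx_root n x - ?f x)"
      proof (rule always_eventually, rule allI)
        fix n
        have "l2sq M (\<lambda>x. conv v (approx_root n) x - conv v ?f x) = l2sq M (conv v (\<lambda>x. approx_root n x - ?f x))"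
          by (rule l2sq_cong) (simp add: conv_diff_right v approx_root_L2 fL)
        also have "\<dots> \<le> l2sq M v * l2sq M (\<lambda>x. approx_root n x - ?f x)"
          by (intro l2sq_conv v sq_integrable_diff approx_root_L2 fL)
        finally show "l2sq M (\<lambda>x. conv v (approx_root n) x - conv v ?f x)
          \<le> l2sq M v * l2sq M (\<lambda>x. approx_root n x - ?f x)" .
      qed
      show "(\<lambda>n. l2sq M v * l2sq M (\<lambda>x. approx_root n x - ?f x)) \<longlonglongrightarrow> 0"
        using tendsto_mult_right_zero[OF lim] by simp
    qed auto
    then have 1: "(\<lambda>n. l2sq M (conv v (approx_root n))) \<longlonglongrightarrow> l2sq M (conv v ?f)"
      by (intro l2sq_tendsto conv_L2 v approx_root_L2 fL)
    have 2: "l2sq M (conv v (approx_root n)) = ?L ?a n" for n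
    proof -
      have "l2sq M (conv v (approx_root n)) = l2sq M (\<lambda>g. \<Sum>k<n. of_real (half_coeff k) * Bp k ?a g)"
        by (rule l2sq_cong) (simp add: approx_root_def[abs_def] conv_sum_right v Bp_L2 \<phi>_L2 conv_Bp)
      then show ?thesis by (simp add: l2sq_Bp_sum[OF a])
    qed
    \<comment> \<open>Since \<open>B^n A v = conv v (B^n \<phi>)\<close>, its norm is at most the
      norm of \<open>v\<close> times that of \<open>B^n \<phi>\<close>, whose square
      \<open>tau \<phi> (2 * n)\<close> is a term of a convergent series.\<close>
    have "(\<lambda>n. Re (l2ip M (Bp n ?a) v)) \<longlonglongrightarrow> 0"
    proof (rule Lim_null_comparison)
      have "norm (Re (l2ip M (Bp n ?a) v)) \<le> sqrt (tau \<phi> (2 * n)) * l2sq M v" for n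
      proof -
        have "norm (Re (l2ip M (Bp n ?a) v)) \<le> sqrt (l2sq M (Bp n ?a)) * sqrt (l2sq M v)"
          using l2ip_cs[OF Bp_L2[OF a, of n] v] abs_Re_le_cmod[of "l2ip M (Bp n ?a) v"] by simp
        also have "l2sq M (Bp n ?a) = l2sq M (conv v (Bp n \<phi>))"
          by (rule l2sq_cong) (simp add: conv_Bp v \<phi>_L2)
        also have "sqrt \<dots> \<le> sqrt (l2sq M v * l2sq M (Bp n \<phi>))"
          by (intro real_sqrt_le_mono l2sq_conv v Bp_L2 \<phi>_L2)
        also have "l2sq M (Bp n \<phi>) = tau \<phi> (2 * n)"
          using Bp_ip_add[OF \<phi>_L2 \<phi>_L2, of n n] unfolding tau_def l2ip_self mult_2
          by (metis Re_complex_of_real)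
        also have "sqrt (l2sq M v * tau \<phi> (2 * n)) * sqrt (l2sq M v)
            = sqrt (tau \<phi> (2 * n)) * (sqrt (l2sq M v) * sqrt (l2sq M v))"
          by (simp only: real_sqrt_mult mult_ac)
        finally show ?thesis by (simp add: mult_right_mono)
      qed
      then show "\<forall>\<^sub>F n in sequentially. norm (Re (l2ip M (Bp n ?a) v)) \<le> sqrt (tau \<phi> (2 * n)) * l2sq M v"
        by simp
      have "summable (tau \<phi>)"
        by (rule summableI_nonneg_bounded[OF tau_nn trace])
      then have "(\<lambda>n. tau \<phi> (2 * n)) \<longlonglongrightarrow> 0"
        using LIMSEQ_subseq_LIMSEQ[OF summable_LIMSEQ_zero, of "tau \<phi>" "\<lambda>n. 2 * n"]
        by (simp add: strict_mono_def o_def)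
      from tendsto_real_sqrt[OF this] show "(\<lambda>n. sqrt (tau \<phi> (2 * n)) * l2sq M v) \<longlonglongrightarrow> 0"
        by (intro tendsto_mult_left_zero) simp
    qed
    then have S: "(\<lambda>n. \<Sum>m<n. tau ?a m) \<longlonglongrightarrow> Re (l2ip M ?a v)"
      unfolding tau_conv_sums[OF v] using tendsto_diff[OF tendsto_const[of "Re (l2ip M ?a v)"]] by fastforce
    have S2: "(\<lambda>n. \<Sum>m<2*n. tau ?a m) \<longlonglongrightarrow> Re (l2ip M ?a v)"
      using LIMSEQ_subseq_LIMSEQ[OF S, of "\<lambda>n. 2 * n"] by (simp add: strict_mono_def o_def)
    have "(\<lambda>n. ?L ?a n) \<longlonglongrightarrow> Re (l2ip M ?a v)"
      by (rule real_tendsto_sandwich[OF _ _ S S2])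
         (use half_coeff_square_bounds[of "tau ?a"] tau_nonneg[OF a] in auto)
    with 1 show ?thesis unfolding 2 by (rule LIMSEQ_unique)
  qed
  with r fL show ?thesis by (rule that)
qed

text \<open>By induction every \<open>Bp j \<phi>\<close> inherits both symmetries: left translation
  is absorbed by invariance of the measure, right translation reaches only the right factor of the
  convolution.\<close>

lemma approx_root_scale:
  assumes k: "k1 \<in> space M" "k2 \<in> space M"
    and \<phi>: "\<And>g. g \<in> space M \<Longrightarrow> \<phi> (k1 \<odot> g) = c1 * \<phi> g" "\<And>g. g \<in> space M \<Longrightarrow> \<phi> (g \<odot> k2) = c2 * \<phi> g"
    and g: "g \<in> space M"
  shows "approx_root n (k1 \<odot> g \<odot> k2) = c1 * c2 * approx_root n g"
proof -
  have "Bp j \<phi> (k1 \<odot> g) = c1 * Bp j \<phi> g \<and> Bp j \<phi> (g \<odot> k2) = c2 * Bp j \<phi> g" if "g \<in> space M" for g j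
    using that
  proof (induction j arbitrary: g)
    case 0
    then show ?case using \<phi> by simp
  next
    case (Suc j)
    have [measurable]: "Bp j \<phi> \<in> borel_measurable M" "\<phi> \<in> borel_measurable M"
      using Bp_L2[OF \<phi>_L2] \<phi>_L2 by auto
    have "conv (Bp j \<phi>) \<phi> (k1 \<odot> g) = (\<integral>h. Bp j \<phi> (k1 \<odot> h) * \<phi> (inv (k1 \<odot> h) \<odot> (k1 \<odot> g)) \<partial>M)"
      unfolding conv_def using Suc.prems k
      by (intro integral_preserving[symmetric, OF _ left_inv] measurable_mul) (auto simp: mul_in)
    also have "\<dots> = (\<integral>h. c1 * (Bp j \<phi> h * \<phi> (inv h \<odot> g)) \<partial>M)"
      by (rule Bochner_Integration.integral_cong)
         (use Suc k in \<open>simp_all add: inv_mul assoc inv_in mul_in cancel_left\<close>)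
    finally have 1: "conv (Bp j \<phi>) \<phi> (k1 \<odot> g) = c1 * conv (Bp j \<phi>) \<phi> g" by (simp add: conv_def)
    have "conv (Bp j \<phi>) \<phi> (g \<odot> k2) = (\<integral>h. c2 * (Bp j \<phi> h * \<phi> (inv h \<odot> g)) \<partial>M)"
      unfolding conv_def using Suc.prems k \<phi>(2)
      by (intro Bochner_Integration.integral_cong) (simp_all add: assoc[symmetric] inv_in mul_in)
    then have 2: "conv (Bp j \<phi>) \<phi> (g \<odot> k2) = c2 * conv (Bp j \<phi>) \<phi> g" by (simp add: conv_def)
    show ?case using Suc 1 2 by (simp add: Bp_Suc B_def right_diff_distrib)
  qed
  then show ?thesis
    using g k by (simp add: approx_root_def sum_distrib_left mul_in mult_ac)
qed

end

section \<open>Stationary second-order fields\<close>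

text \<open>The covariance is prescribed at all pairs of points, so the properties of the kernel
  \<open>\<phi>\<close> can be read off from \<open>Z\<close>: positivity from
  \<open>quadratic_form\<close>, the size of the operator from \<open>form_integrable\<close>, the
  trace bound from \<open>trace_form\<close>.\<close>

locale stationary_field = prob_group M mul inv one + P: prob_space P
  for M :: "'a measure" and mul (infixl "\<odot>" 70) and inv and one and P :: "'w measure" +
  fixes Z :: "'a \<Rightarrow> 'w \<Rightarrow> complex" and \<phi> :: "'a \<Rightarrow> complex" and C :: real
  assumes Z_measurable: "(\<lambda>(g, w). Z g w) \<in> borel_measurable (M \<Otimes>\<^sub>M P)"
    and Z_L2: "g \<in> space M \<Longrightarrow> sq_integrable P (Z g)"
    and Z_norm: "g \<in> space M \<Longrightarrow> l2sq P (Z g) = C"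
    and cov: "g \<in> space M \<Longrightarrow> h \<in> space M \<Longrightarrow> l2ip P (Z g) (Z h) = \<phi> (inv h \<odot> g)"
    and \<phi>_measurable: "\<phi> \<in> borel_measurable M"
begin

lemma Z_meas [measurable (raw)]:
  "f \<in> measurable N M \<Longrightarrow> f' \<in> measurable N P \<Longrightarrow> (\<lambda>x. Z (f x) (f' x)) \<in> borel_measurable N"
  using measurable_compose[OF measurable_Pair Z_measurable, of f N f'] by simp

lemma C_nonneg: "0 \<le> C"
  using Z_norm[OF one_in] l2sq_nonneg by metis

lemma \<phi>_eq: "g \<in> space M \<Longrightarrow> \<phi> g = l2ip P (Z g) (Z one)"
  using cov[of g one] one_left[of "inv one"] inv_right[OF one_in] inv_in[OF one_in] one_in
  by (simp add: one_left)

lemma \<phi>_bound: "g \<in> space M \<Longrightarrow> norm (\<phi> g) \<le> C"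
  using l2ip_cs[OF Z_L2 Z_L2, of g one] one_in C_nonneg by (simp add: \<phi>_eq Z_norm)

lemma \<phi>_L2: "sq_integrable M \<phi>"
  by (rule sq_integrable_bounded_by[of M "\<lambda>_. of_real C"])
     (use \<phi>_bound C_nonneg \<phi>_measurable in auto)

lemma \<phi>_herm: "g \<in> space M \<Longrightarrow> \<phi> (inv g) = cnj (\<phi> g)"
  using cov[of one g] one_in by (simp add: \<phi>_eq l2ip_cnj_swap one_right inv_in)

lemma integrable_cross:
  assumes a: "integrable (M \<Otimes>\<^sub>M M) a"
  shows "integrable ((M \<Otimes>\<^sub>M M) \<Otimes>\<^sub>M P) (\<lambda>(x, w). a x * (cnj (Z (snd x) w) * Z (fst x) w))"
proof -
  interpret MM: pair_prob_space M M ..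
  interpret Q: pair_sigma_finite "M \<Otimes>\<^sub>M M" P ..
  have [measurable]: "a \<in> borel_measurable (M \<Otimes>\<^sub>M M)" using a by auto
  show ?thesis
  proof (rule Q.integrable_pair_bound[where b = "\<lambda>x. C * norm (a x)"])
    show "integrable (M \<Otimes>\<^sub>M M) (\<lambda>x. C * norm (a x))" using a by simp
    fix x assume "x \<in> space (M \<Otimes>\<^sub>M M)"
    then have x: "fst x \<in> space M" "snd x \<in> space M" by (auto simp: space_pair_measure)
    show "integrable P (\<lambda>w. case (x, w) of (x, w) \<Rightarrow> a x * (cnj (Z (snd x) w) * Z (fst x) w))"
      using integrable_l2ip[OF Z_L2[OF x(1)] Z_L2[OF x(2)]] by (simp add: mult.commute)
    have "(\<integral>w. norm (Z (snd x) w) * norm (Z (fst x) w) \<partial>P)\<^sup>2 \<le> C\<^sup>2"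
      using l2sq_cs_norm[OF Z_L2[OF x(2)] Z_L2[OF x(1)]] by (simp add: Z_norm x power2_eq_square[of C])
    then have "(\<integral>w. norm (Z (snd x) w) * norm (Z (fst x) w) \<partial>P) \<le> C"
      by (rule power2_le_imp_le[OF _ C_nonneg])
    from mult_left_mono[OF this norm_ge_zero[of "a x"]]
    show "(\<integral>w. norm (case (x, w) of (x, w) \<Rightarrow> a x * (cnj (Z (snd x) w) * Z (fst x) w)) \<partial>P) \<le> C * norm (a x)"
      by (simp add: norm_mult mult_ac)
  qed measurable
qed

lemma integrable_times_\<phi>:
  assumes a: "integrable (M \<Otimes>\<^sub>M M) a"
  shows "integrable (M \<Otimes>\<^sub>M M) (\<lambda>x. a x * \<phi> (inv (snd x) \<odot> fst x))"
proof (rule Bochner_Integration.integrable_bound[OF integrable_mult_right[OF a, of "of_real C"]])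
  note [measurable] = \<phi>_measurable borel_measurable_integrable[OF a]
  show "(\<lambda>x. a x * \<phi> (inv (snd x) \<odot> fst x)) \<in> borel_measurable (M \<Otimes>\<^sub>M M)" by measurable
  show "AE x in M \<Otimes>\<^sub>M M. norm (a x * \<phi> (inv (snd x) \<odot> fst x)) \<le> norm (of_real C * a x)"
  proof (rule AE_I2)
    fix x assume "x \<in> space (M \<Otimes>\<^sub>M M)"
    then have x: "fst x \<in> space M" "snd x \<in> space M" by (auto simp: space_pair_measure)
    then have "norm (\<phi> (inv (snd x) \<odot> fst x)) \<le> C" by (intro \<phi>_bound mul_in inv_in)
    from mult_left_mono[OF this norm_ge_zero[of "a x"]] C_nonneg
    show "norm (a x * \<phi> (inv (snd x) \<odot> fst x)) \<le> norm (of_real C * a x)"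
      by (simp add: norm_mult mult_ac)
  qed
qed

text \<open>The weight \<open>a\<close> is left open because it will be
  \<open>v h * cnj (v g)\<close> for the quadratic form and a translated kernel for the
  trace.\<close>

lemma cross_integral:
  assumes a: "integrable (M \<Otimes>\<^sub>M M) a"
  shows "integrable P (\<lambda>w. \<integral>x. a x * (cnj (Z (snd x) w) * Z (fst x) w) \<partial>(M \<Otimes>\<^sub>M M))" (is ?A)
    and "(\<integral>w. (\<integral>x. a x * (cnj (Z (snd x) w) * Z (fst x) w) \<partial>(M \<Otimes>\<^sub>M M)) \<partial>P)
      = (\<integral>x. a x * \<phi> (inv (snd x) \<odot> fst x) \<partial>(M \<Otimes>\<^sub>M M))" (is ?B)
    and "AE w in P. integrable (M \<Otimes>\<^sub>M M) (\<lambda>x. a x * (cnj (Z (snd x) w) * Z (fst x) w))" (is ?C)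
proof -
  interpret MM: pair_prob_space M M ..
  interpret Q: pair_sigma_finite "M \<Otimes>\<^sub>M M" P ..
  note int = integrable_cross[OF a]
  show ?A using Q.integrable_snd[OF int] .
  show ?C using Q.AE_integrable_snd[OF int] .
  have "(\<integral>w. (\<integral>x. a x * (cnj (Z (snd x) w) * Z (fst x) w) \<partial>(M \<Otimes>\<^sub>M M)) \<partial>P)
      = (\<integral>x. (\<integral>w. a x * (cnj (Z (snd x) w) * Z (fst x) w) \<partial>P) \<partial>(M \<Otimes>\<^sub>M M))"
    using Q.Fubini_integral[OF int] by simp
  also have "\<dots> = (\<integral>x. a x * \<phi> (inv (snd x) \<odot> fst x) \<partial>(M \<Otimes>\<^sub>M M))"
  proof (rule Bochner_Integration.integral_cong)
    fix x assume "x \<in> space (M \<Otimes>\<^sub>M M)"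
    then have x: "fst x \<in> space M" "snd x \<in> space M" by (auto simp: space_pair_measure)
    show "(\<integral>w. a x * (cnj (Z (snd x) w) * Z (fst x) w) \<partial>P) = a x * \<phi> (inv (snd x) \<odot> fst x)"
      using cov[OF x] by (simp add: l2ip_def mult.commute)
  qed simp
  finally show ?B .
qed

lemma path_L2:
  shows "AE w in P. sq_integrable M (\<lambda>g. Z g w)"
    and "integrable P (\<lambda>w. l2sq M (\<lambda>g. Z g w))"
    and "(\<integral>w. l2sq M (\<lambda>g. Z g w) \<partial>P) = C"
proof -
  interpret Q: pair_sigma_finite M P ..
  have "integrable (M \<Otimes>\<^sub>M P) (\<lambda>x. case x of (g, w) \<Rightarrow> (norm (Z g w))\<^sup>2)"
  proof (rule Q.Fubini_integrable)
    have "(\<integral>w. norm (case (g, w) of (g, w) \<Rightarrow> (norm (Z g w))\<^sup>2) \<partial>P) = C" if "g \<in> space M" for g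
      using Z_norm[OF that] by (simp add: l2sq_def)
    then show "integrable M (\<lambda>g. \<integral>w. norm (case (g, w) of (g, w) \<Rightarrow> (norm (Z g w))\<^sup>2) \<partial>P)"
      by (subst Bochner_Integration.integrable_cong[of M M _ "\<lambda>_. C"]) auto
    show "AE g in M. integrable P (\<lambda>w. case (g, w) of (g, w) \<Rightarrow> (norm (Z g w))\<^sup>2)"
      using Z_L2 by (intro AE_I2) (auto simp: sq_integrable_def)
  qed measurable
  then have int: "integrable (M \<Otimes>\<^sub>M P) (\<lambda>(g, w). (norm (Z g w))\<^sup>2)" by simp
  have "AE w in P. integrable M (\<lambda>g. (norm (Z g w))\<^sup>2)" using Q.AE_integrable_snd[OF int] .
  then show "AE w in P. sq_integrable M (\<lambda>g. Z g w)"
    using AE_space by eventually_elim (auto simp: sq_integrable_def)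
  show "integrable P (\<lambda>w. l2sq M (\<lambda>g. Z g w))"
    unfolding l2sq_def using Q.integrable_snd[OF int] .
  have "(\<integral>w. l2sq M (\<lambda>g. Z g w) \<partial>P) = (\<integral>g. l2sq P (Z g) \<partial>M)"
    unfolding l2sq_def using Q.Fubini_integral[OF int] by simp
  also have "\<dots> = (\<integral>g. C \<partial>M)" by (rule Bochner_Integration.integral_cong) (auto simp: Z_norm)
  finally show "(\<integral>w. l2sq M (\<lambda>g. Z g w) \<partial>P) = C" by (simp add: prob_space)
qed

text \<open>Once \<open>\<phi>\<close> is written as a covariance, the double integral factors path
  by path into a number times its conjugate. In particular A is positive.\<close>

lemma quadratic_form:
  assumes v: "sq_integrable M v"
  shows "l2ip M (conv v \<phi>) v = of_real (\<integral>w. (norm (\<integral>g. v g * cnj (Z g w) \<partial>M))\<^sup>2 \<partial>P)"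
proof -
  interpret MM: pair_prob_space M M ..
  note [measurable] = sq_integrable_measurable[OF v] \<phi>_measurable
  let ?a = "\<lambda>x. v (snd x) * cnj (v (fst x))"
  have iv: "integrable M v" by (rule sq_integrable_integrable[OF v])
  have "integrable (M \<Otimes>\<^sub>M M) (\<lambda>x. case x of (g, h) \<Rightarrow> v h * cnj (v g))"
    by (rule MM.Fubini_integrable) (use iv in \<open>auto simp: norm_mult intro!: integrable_mult_left\<close>)
  then have a: "integrable (M \<Otimes>\<^sub>M M) ?a" by (simp add: case_prod_unfold)
  note aphi_int = integrable_times_\<phi>[OF a]
  have "l2ip M (conv v \<phi>) v = (\<integral>g. \<integral>h. v h * cnj (v g) * \<phi> (inv h \<odot> g) \<partial>M \<partial>M)"
    unfolding l2ip_def conv_def by (simp add: mult_ac flip: Bochner_Integration.integral_mult_right_zero)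
  also have "\<dots> = (\<integral>x. ?a x * \<phi> (inv (snd x) \<odot> fst x) \<partial>(M \<Otimes>\<^sub>M M))"
    using MM.integral_fst'[OF aphi_int] by simp
  also have "\<dots> = (\<integral>w. (\<integral>x. ?a x * (cnj (Z (snd x) w) * Z (fst x) w) \<partial>(M \<Otimes>\<^sub>M M)) \<partial>P)"
    by (rule cross_integral(2)[OF a, symmetric])
  also have "\<dots> = (\<integral>w. of_real ((norm (\<integral>g. v g * cnj (Z g w) \<partial>M))\<^sup>2) \<partial>P)"
  proof (rule integral_cong_AE)
    show "AE w in P. (\<integral>x. ?a x * (cnj (Z (snd x) w) * Z (fst x) w) \<partial>(M \<Otimes>\<^sub>M M))
        = of_real ((norm (\<integral>g. v g * cnj (Z g w) \<partial>M))\<^sup>2)"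
      using cross_integral(3)[OF a]
    proof eventually_elim
      case (elim w)
      have "(\<integral>x. ?a x * (cnj (Z (snd x) w) * Z (fst x) w) \<partial>(M \<Otimes>\<^sub>M M))
          = (\<integral>g. \<integral>h. v h * cnj (v g) * (cnj (Z h w) * Z g w) \<partial>M \<partial>M)"
        using MM.integral_fst'[OF elim] by simp
      also have "\<dots> = (\<integral>g. cnj (v g * cnj (Z g w)) * (\<integral>h. v h * cnj (Z h w) \<partial>M) \<partial>M)"
        by (simp add: mult_ac flip: Bochner_Integration.integral_mult_right_zero)
      also have "\<dots> = cnj (\<integral>g. v g * cnj (Z g w) \<partial>M) * (\<integral>h. v h * cnj (Z h w) \<partial>M)"
        by (simp only: Bochner_Integration.integral_mult_left_zero Bochner_Integration.integral_cnj)
      also have "\<dots> = of_real ((norm (\<integral>g. v g * cnj (Z g w) \<partial>M))\<^sup>2)"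
        by (metis complex_norm_square mult.commute of_real_power)
      finally show ?case .
    qed
  qed measurable
  finally show ?thesis by (simp only: integral_complex_of_real)
qed

text \<open>Cauchy-Schwarz on each path gives the upper bound \<open>C\<close> for A, which fixes
  the scaling in \<open>square_root\<close>.\<close>

lemma form_integrable:
  assumes v: "sq_integrable M v"
  shows "integrable P (\<lambda>w. (norm (\<integral>g. v g * cnj (Z g w) \<partial>M))\<^sup>2)"
    and "(\<integral>w. (norm (\<integral>g. v g * cnj (Z g w) \<partial>M))\<^sup>2 \<partial>P) \<le> C * l2sq M v"
proof -
  note [measurable] = sq_integrable_measurable[OF v]
  have int: "integrable P (\<lambda>w. l2sq M v * l2sq M (\<lambda>g. Z g w))" using path_L2(2) by simp
  have le: "AE w in P. (norm (\<integral>g. v g * cnj (Z g w) \<partial>M))\<^sup>2 \<le> l2sq M v * l2sq M (\<lambda>g. Z g w)"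
    using path_L2(1)
  proof eventually_elim
    case (elim w)
    then show ?case using l2_cs[of M v "\<lambda>g. cnj (Z g w)"] v by simp
  qed
  show i: "integrable P (\<lambda>w. (norm (\<integral>g. v g * cnj (Z g w) \<partial>M))\<^sup>2)"
    by (rule Bochner_Integration.integrable_bound[OF int], measurable) (use le in eventually_elim, simp)
  have "(\<integral>w. (norm (\<integral>g. v g * cnj (Z g w) \<partial>M))\<^sup>2 \<partial>P) \<le> (\<integral>w. l2sq M v * l2sq M (\<lambda>g. Z g w) \<partial>P)"
    by (rule integral_mono_AE[OF i int le])
  then show "(\<integral>w. (norm (\<integral>g. v g * cnj (Z g w) \<partial>M))\<^sup>2 \<partial>P) \<le> C * l2sq M v"
    using path_L2(3) by (simp add: mult.commute)
qed

text \<open>Kernel and covariance both depend on \<open>inv h \<odot> g\<close> alone, so the inner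
  integral does not depend on \<open>g\<close> and the double integral collapses to a pairing of
  kernels. Read backwards, a trace becomes an expectation along paths.\<close>

lemma trace_form:
  assumes b: "sq_integrable M b"
  shows "integrable P (\<lambda>w. l2ip M (conv (\<lambda>g. Z g w) b) (\<lambda>g. Z g w))"
    and "(\<integral>w. l2ip M (conv (\<lambda>g. Z g w) b) (\<lambda>g. Z g w) \<partial>P) = l2ip M b \<phi>"
proof -
  interpret MM: pair_prob_space M M ..
  note [measurable] = sq_integrable_measurable[OF b] \<phi>_measurable
  \<comment> \<open>The conjugate fits the order of the factors in \<open>cross_integral\<close>;
    what is computed below is the conjugate of the claim.\<close>
  let ?a = "\<lambda>x. cnj (b (inv (snd x) \<odot> fst x))"
  have ib: "integrable M b" by (rule sq_integrable_integrable[OF b])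
  have shift: "(\<integral>h. f (inv h \<odot> g) \<partial>M) = (\<integral>h. f h \<partial>M)" if "f \<in> borel_measurable M" "g \<in> space M"
    for f :: "'a \<Rightarrow> 'b::{banach, second_countable_topology}" and g
    using that by (intro integral_preserving inv_left_inv) measurable
  have ish: "integrable M (\<lambda>h. b (inv h \<odot> g))" if "g \<in> space M" for g
    using that ib by (subst integrable_preserving[OF _ inv_left_inv]) measurable
  have "integrable (M \<Otimes>\<^sub>M M) (\<lambda>x. case x of (g, h) \<Rightarrow> cnj (b (inv h \<odot> g)))"
  proof (rule MM.Fubini_integrable)
    show "integrable M (\<lambda>g. \<integral>h. norm (case (g, h) of (g, h) \<Rightarrow> cnj (b (inv h \<odot> g))) \<partial>M)"
      by (subst Bochner_Integration.integrable_cong[of M M _ "\<lambda>_. \<integral>h. norm (b h) \<partial>M"])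
         (use shift[of "\<lambda>h. norm (b h)"] in auto)
    show "AE g in M. integrable M (\<lambda>h. case (g, h) of (g, h) \<Rightarrow> cnj (b (inv h \<odot> g)))"
      using ish by (intro AE_I2) simp
  qed measurable
  then have a: "integrable (M \<Otimes>\<^sub>M M) ?a" by (simp add: case_prod_unfold)
  note aphi_int = integrable_times_\<phi>[OF a]
  have inner: "AE w in P. (\<integral>x. ?a x * (cnj (Z (snd x) w) * Z (fst x) w) \<partial>(M \<Otimes>\<^sub>M M))
      = cnj (l2ip M (conv (\<lambda>g. Z g w) b) (\<lambda>g. Z g w))"
    using cross_integral(3)[OF a]
  proof eventually_elim
    case (elim w)
    have "(\<integral>x. ?a x * (cnj (Z (snd x) w) * Z (fst x) w) \<partial>(M \<Otimes>\<^sub>M M))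
        = (\<integral>g. \<integral>h. cnj (b (inv h \<odot> g)) * (cnj (Z h w) * Z g w) \<partial>M \<partial>M)"
      using MM.integral_fst'[OF elim] by simp
    also have "\<dots> = (\<integral>g. Z g w * (\<integral>h. cnj (Z h w * b (inv h \<odot> g)) \<partial>M) \<partial>M)"
      by (simp add: mult_ac flip: Bochner_Integration.integral_mult_right_zero)
    also have "\<dots> = (\<integral>g. cnj (conv (\<lambda>g. Z g w) b g * cnj (Z g w)) \<partial>M)"
    proof (rule Bochner_Integration.integral_cong)
      fix g
      have "(\<integral>h. cnj (Z h w * b (inv h \<odot> g)) \<partial>M) = cnj (conv (\<lambda>g. Z g w) b g)"
        unfolding conv_def by (rule Bochner_Integration.integral_cnj)
      then show "Z g w * (\<integral>h. cnj (Z h w * b (inv h \<odot> g)) \<partial>M) = cnj (conv (\<lambda>g. Z g w) b g * cnj (Z g w))"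
        by simp
    qed simp
    also have "\<dots> = cnj (l2ip M (conv (\<lambda>g. Z g w) b) (\<lambda>g. Z g w))"
      unfolding l2ip_def by (rule Bochner_Integration.integral_cnj)
    finally show ?case .
  qed
  have m: "(\<lambda>w. l2ip M (conv (\<lambda>g. Z g w) b) (\<lambda>g. Z g w)) \<in> borel_measurable P"
    unfolding l2ip_def conv_def by measurable
  have "integrable P (\<lambda>w. cnj (l2ip M (conv (\<lambda>g. Z g w) b) (\<lambda>g. Z g w)))"
    by (rule integrable_cong_AE_imp[OF cross_integral(1)[OF a] measurable_cnj[OF m] inner])
  then show "integrable P (\<lambda>w. l2ip M (conv (\<lambda>g. Z g w) b) (\<lambda>g. Z g w))" by simp
  have "cnj (\<integral>w. l2ip M (conv (\<lambda>g. Z g w) b) (\<lambda>g. Z g w) \<partial>P)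
      = (\<integral>w. cnj (l2ip M (conv (\<lambda>g. Z g w) b) (\<lambda>g. Z g w)) \<partial>P)"
    by (rule Bochner_Integration.integral_cnj[symmetric])
  also have "\<dots> = (\<integral>w. (\<integral>x. ?a x * (cnj (Z (snd x) w) * Z (fst x) w) \<partial>(M \<Otimes>\<^sub>M M)) \<partial>P)"
    by (rule integral_cong_AE[OF measurable_cnj[OF m] borel_measurable_integrable[OF cross_integral(1)[OF a]]])
       (use inner in \<open>simp add: eq_commute\<close>)
  also have "\<dots> = (\<integral>x. ?a x * \<phi> (inv (snd x) \<odot> fst x) \<partial>(M \<Otimes>\<^sub>M M))"
    by (rule cross_integral(2)[OF a])
  also have "\<dots> = (\<integral>g. \<integral>h. cnj (b (inv h \<odot> g)) * \<phi> (inv h \<odot> g) \<partial>M \<partial>M)"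
    using MM.integral_fst'[OF aphi_int] by simp
  also have "\<dots> = (\<integral>g. (\<integral>h. cnj (b h) * \<phi> h \<partial>M) \<partial>M)"
    by (rule Bochner_Integration.integral_cong) (use shift[of "\<lambda>h. cnj (b h) * \<phi> h"] in auto)
  also have "\<dots> = cnj (l2ip M b \<phi>)"
    unfolding l2ip_def Bochner_Integration.integral_cnj[symmetric] by (simp add: prob_space)
  finally show "(\<integral>w. l2ip M (conv (\<lambda>g. Z g w) b) (\<lambda>g. Z g w) \<partial>P) = l2ip M b \<phi>"
    by (simp only: complex_cnj_cancel_iff)
qed

end

context conv_kernel begin

text \<open>\<open>A = 1 - B\<close> commutes with the powers of B.\<close>

lemma conv_kernel_Bp:
  assumes v: "sq_integrable M v" and g: "g \<in> space M"
  shows "Bp m (conv v \<phi>) g = Bp m v g - Bp (Suc m) v g"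
  using g
proof (induction m arbitrary: g)
  case (Suc m)
  have "conv (Bp m (conv v \<phi>)) \<phi> g = conv (\<lambda>g. Bp m v g - Bp (Suc m) v g) \<phi> g"
    by (rule conv_cong) (use Suc in auto)
  also have "\<dots> = conv (Bp m v) \<phi> g - conv (Bp (Suc m) v) \<phi> g"
    using Suc.prems by (intro conv_diff_left Bp_L2 v \<phi>_L2)
  finally show ?case using Suc by (simp add: Bp_Suc B_def)
qed (simp add: Bp_Suc B_def)

text \<open>\<open>conv v (Bp m \<phi>)\<close> is \<open>B^m A v = B^m v - B^(m+1) v\<close>, and
  the last term of the telescope is nonnegative by \<open>Bp_pos\<close>. The bound holds for every
  \<open>v\<close>, hence for every square integrable path.\<close>

lemma trace_telescope:
  assumes v: "sq_integrable M v"
  shows "(\<Sum>m<n. Re (l2ip M (conv v (Bp m \<phi>)) v)) \<le> l2sq M v"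
proof -
  have "Re (l2ip M (conv v (Bp m \<phi>)) v) = Re (l2ip M (Bp m v) v) - Re (l2ip M (Bp (Suc m) v) v)" for m
  proof -
    have "l2ip M (conv v (Bp m \<phi>)) v = l2ip M (\<lambda>g. Bp m v g - Bp (Suc m) v g) v"
      by (rule l2ip_cong) (simp_all add: conv_Bp v \<phi>_L2 conv_kernel_Bp)
    then show ?thesis by (simp add: l2ip_diff_left Bp_L2 v)
  qed
  then have "(\<Sum>m<n. Re (l2ip M (conv v (Bp m \<phi>)) v)) = Re (l2ip M v v) - Re (l2ip M (Bp n v) v)"
    using sum_lessThan_telescope'[of "\<lambda>m. Re (l2ip M (Bp m v) v)" n] by simp
  then show ?thesis using Bp_pos[OF v, of n] by (simp add: l2ip_self)
qed

end

context stationary_field begin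

theorem square_root:
  obtains f where "sq_integrable M f"
    and "\<And>v. sq_integrable M v \<Longrightarrow> l2sq M (conv v f) = (\<integral>w. (norm (\<integral>g. v g * cnj (Z g w) \<partial>M))\<^sup>2 \<partial>P)"
    and "\<And>k1 k2 c1 c2 g. k1 \<in> space M \<Longrightarrow> k2 \<in> space M \<Longrightarrow> g \<in> space M \<Longrightarrow> c1 \<noteq> 0 \<Longrightarrow> c2 \<noteq> 0 \<Longrightarrow>
      (\<And>g. g \<in> space M \<Longrightarrow> \<phi> (k1 \<odot> g) = c1 * \<phi> g) \<Longrightarrow> (\<And>g. g \<in> space M \<Longrightarrow> \<phi> (g \<odot> k2) = c2 * \<phi> g) \<Longrightarrow>
      f (k1 \<odot> g \<odot> k2) = c1 * c2 * f g"
proof -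
  \<comment> \<open>\<open>form_integrable\<close> bounds A by \<open>C\<close>. The scale
    \<open>C + 1\<close> makes A a contraction and stays positive for \<open>C = 0\<close>.\<close>
  define \<kappa> where "\<kappa> = 1 / (C + 1)"
  have \<kappa>: "0 < \<kappa>" "\<kappa> * C \<le> 1" using C_nonneg by (auto simp: \<kappa>_def field_simps)
  define \<psi> where "\<psi> g = of_real \<kappa> * \<phi> g" for g
  have \<psi>_L2: "sq_integrable M \<psi>" unfolding \<psi>_def by (rule sq_integrable_scale[OF \<phi>_L2])
  have conv_\<psi>: "conv v \<psi> g = of_real \<kappa> * conv v \<phi> g" for v g
    by (simp add: conv_def \<psi>_def mult.left_commute)
  have form: "Re (l2ip M (conv v \<psi>) v) = \<kappa> * (\<integral>w. (norm (\<integral>g. v g * cnj (Z g w) \<partial>M))\<^sup>2 \<partial>P)"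
    if v: "sq_integrable M v" for v
    using quadratic_form[OF v] unfolding conv_\<psi>[abs_def] l2ip_scale_left by simp
  interpret K: conv_kernel M mul inv one \<psi>
  proof
    show "sq_integrable M \<psi>" by (rule \<psi>_L2)
    show "\<psi> (inv g) = cnj (\<psi> g)" if "g \<in> space M" for g
      using \<phi>_herm[OF that] by (simp add: \<psi>_def)
    fix v assume v: "sq_integrable M v"
    have "Re (l2ip M (conv v \<psi>) v) \<le> \<kappa> * (C * l2sq M v)"
      unfolding form[OF v] using form_integrable(2)[OF v] \<kappa>(1) by (intro mult_left_mono) auto
    also have "\<dots> \<le> 1 * l2sq M v"
      unfolding mult.assoc[symmetric] by (intro mult_right_mono \<kappa>) auto
    finally show "Re (l2ip M (conv v \<psi>) v) \<le> l2sq M v" by simp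
  qed
  \<comment> \<open>One of the two kernels in \<open>tau\<close> is a multiple of
    \<open>\<phi>\<close>, so \<open>trace_form\<close> applies; the sum telescopes on each path,
    and the mean squared norm of a path is \<open>C\<close>.\<close>
  have trace: "(\<Sum>m<n. K.tau \<psi> m) \<le> 1" for n
  proof -
    have L: "sq_integrable M (K.Bp m \<psi>)" for m by (rule K.Bp_L2[OF \<psi>_L2])
    have "K.tau \<psi> m = \<kappa> * Re (l2ip M (K.Bp m \<psi>) \<phi>)" for m
      unfolding K.tau_def using l2ip_scale_right[of M "K.Bp m \<psi>" "of_real \<kappa>" \<phi>]
      by (simp add: \<psi>_def[abs_def, symmetric])
    then have "(\<Sum>m<n. K.tau \<psi> m) = \<kappa> * (\<Sum>m<n. Re (l2ip M (K.Bp m \<psi>) \<phi>))"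
      by (simp add: sum_distrib_left)
    also have "(\<Sum>m<n. Re (l2ip M (K.Bp m \<psi>) \<phi>))
        = (\<integral>w. (\<Sum>m<n. Re (l2ip M (conv (\<lambda>g. Z g w) (K.Bp m \<psi>)) (\<lambda>g. Z g w))) \<partial>P)"
      using trace_form[OF L] by (simp add: integral_Re[symmetric] Bochner_Integration.integral_sum)
    also have "\<dots> \<le> (\<integral>w. l2sq M (\<lambda>g. Z g w) \<partial>P)"
    proof (rule integral_mono_AE)
      show "integrable P (\<lambda>w. \<Sum>m<n. Re (l2ip M (conv (\<lambda>g. Z g w) (K.Bp m \<psi>)) (\<lambda>g. Z g w)))"
        using trace_form(1)[OF L] by (intro Bochner_Integration.integrable_sum integrable_Re)
      show "AE w in P. (\<Sum>m<n. Re (l2ip M (conv (\<lambda>g. Z g w) (K.Bp m \<psi>)) (\<lambda>g. Z g w))) \<le> l2sq M (\<lambda>g. Z g w)"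
        using path_L2(1) by eventually_elim (rule K.trace_telescope)
    qed (rule path_L2)
    also have "\<dots> = C" by (rule path_L2)
    finally show ?thesis using \<kappa> by (auto intro: order_trans[OF mult_left_mono])
  qed
  obtain r where fL: "sq_integrable M (\<lambda>x. climit (\<lambda>k. K.approx_root (r k) x))"
    and fform: "\<And>v. sq_integrable M v \<Longrightarrow>
      l2sq M (conv v (\<lambda>x. climit (\<lambda>k. K.approx_root (r k) x))) = Re (l2ip M (conv v \<psi>) v)"
    using K.sqrt_conv[OF trace] by blast
  define f0 where "f0 x = climit (\<lambda>k. K.approx_root (r k) x)" for x
  \<comment> \<open>\<open>f0\<close> is the root of the scaled kernel; the factor undoes the
    scaling.\<close>
  define f where "f x = of_real (sqrt (1 / \<kappa>)) * f0 x" for x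
  show ?thesis
  proof (rule that[of f])
    show "sq_integrable M f"
      unfolding f_def f0_def by (rule sq_integrable_scale[OF fL])
    fix v assume v: "sq_integrable M v"
    have "conv v f g = of_real (sqrt (1 / \<kappa>)) * conv v f0 g" for g
    proof -
      have "conv v f g = (\<integral>h. of_real (sqrt (1 / \<kappa>)) * (v h * f0 (inv h \<odot> g)) \<partial>M)"
        unfolding conv_def f_def by (rule Bochner_Integration.integral_cong) (simp_all only: mult_ac)
      then show ?thesis by (simp add: conv_def)
    qed
    then have "l2sq M (conv v f) = (1 / \<kappa>) * l2sq M (conv v f0)"
      using \<kappa>(1) l2sq_scale[of M "of_real (sqrt (1 / \<kappa>))" "conv v f0"] unfolding fun_eq_iff[symmetric]
      by (simp add: l2sq_def norm_mult power_mult_distrib)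
    then show "l2sq M (conv v f) = (\<integral>w. (norm (\<integral>g. v g * cnj (Z g w) \<partial>M))\<^sup>2 \<partial>P)"
      using fform[OF v] form[OF v] \<kappa>(1) unfolding f0_def[abs_def, symmetric] by simp
  next
    fix k1 k2 c1 c2 g
    assume k: "k1 \<in> space M" "k2 \<in> space M" and g: "g \<in> space M" and c: "c1 \<noteq> 0" "c2 \<noteq> 0"
      and "\<And>g. g \<in> space M \<Longrightarrow> \<phi> (k1 \<odot> g) = c1 * \<phi> g" "\<And>g. g \<in> space M \<Longrightarrow> \<phi> (g \<odot> k2) = c2 * \<phi> g"
    then have "K.approx_root n (k1 \<odot> g \<odot> k2) = c1 * c2 * K.approx_root n g" for n
      by (intro K.approx_root_scale) (auto simp: \<psi>_def)
    then show "f (k1 \<odot> g \<odot> k2) = c1 * c2 * f g"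
      using climit_scale[of "c1 * c2" "\<lambda>k. K.approx_root (r k) g"] c by (simp add: f_def f0_def)
  qed
qed

end

section \<open>Haar measure on the rotation group\<close>

lemma SO3_iff: "g \<in> SO3 \<longleftrightarrow> orthogonal_matrix g \<and> det g = 1"
  by (simp add: SO3_def rotation_matrix_def)

lemma SO3_one: "mat 1 \<in> SO3"
  by (simp add: SO3_iff orthogonal_matrix_id)

lemma SO3_mult: "g \<in> SO3 \<Longrightarrow> h \<in> SO3 \<Longrightarrow> g ** h \<in> SO3"
  by (simp add: SO3_iff orthogonal_matrix_mul det_mul)

lemma SO3_transpose: "g \<in> SO3 \<Longrightarrow> transpose g \<in> SO3"
  by (simp add: SO3_iff det_transpose)

lemma SO3_transpose_mult: "g \<in> SO3 \<Longrightarrow> transpose g ** g = mat 1" "g \<in> SO3 \<Longrightarrow> g ** transpose g = mat 1"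
  by (auto simp: SO3_iff orthogonal_matrix_def)

lemma SO3_matrix_inv: assumes "g \<in> SO3" shows "matrix_inv g = transpose g"
proof -
  have "\<exists>A'. g ** A' = mat 1 \<and> A' ** g = mat 1" using SO3_transpose_mult[OF assms] by blast
  then have "g ** matrix_inv g = mat 1" unfolding matrix_inv_def by (rule someI2_ex) simp
  then have "transpose g ** (g ** matrix_inv g) = transpose g" by simp
  then show ?thesis by (simp add: matrix_mul_assoc SO3_transpose_mult assms)
qed

lemma SO3_inv: "g \<in> SO3 \<Longrightarrow> matrix_inv g \<in> SO3"
  by (simp add: SO3_matrix_inv SO3_transpose)

lemma SO3_inv_mult: "g \<in> SO3 \<Longrightarrow> matrix_inv g ** g = mat 1" "g \<in> SO3 \<Longrightarrow> g ** matrix_inv g = mat 1"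
  by (simp_all add: SO3_matrix_inv SO3_transpose_mult)

lemma SO3_inv_cancel: "g \<in> SO3 \<Longrightarrow> matrix_inv g ** (g ** h) = h" "g \<in> SO3 \<Longrightarrow> g ** (matrix_inv g ** h) = h"
  by (simp_all add: matrix_mul_assoc SO3_inv_mult)

lemma SO3_inv_inv: "g \<in> SO3 \<Longrightarrow> matrix_inv (matrix_inv g) = g"
  by (simp add: SO3_matrix_inv SO3_transpose)

lemma SO3_inv_prod: "g \<in> SO3 \<Longrightarrow> h \<in> SO3 \<Longrightarrow> matrix_inv (g ** h) = matrix_inv h ** matrix_inv g"
  by (simp add: SO3_matrix_inv SO3_mult matrix_transpose_mul)

lemma SO3_norm: "g \<in> SO3 \<Longrightarrow> norm (g *v x) = norm x"
  using orthogonal_transformation_norm[of "(*v) g" x]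
  by (simp add: SO3_iff orthogonal_transformation_matrix)

lemma SO3_rotation: "g \<in> SO3 \<Longrightarrow> rotation_matrix g"
  by (simp add: SO3_def)

section \<open>Measurability of matrix operations\<close>

lemma borel_measurable_matrix:
  fixes f :: "'a \<Rightarrow> real^'n^'m"
  assumes "\<And>i j. (\<lambda>x. f x $ i $ j) \<in> borel_measurable N"
  shows "f \<in> borel_measurable N"
  unfolding borel_measurable_euclidean_space[of f]
  by (auto simp: Basis_vec_def inner_axis assms)

lemma borel_measurable_vector:
  fixes f :: "'a \<Rightarrow> real^'n"
  assumes "\<And>i. (\<lambda>x. f x $ i) \<in> borel_measurable N"
  shows "f \<in> borel_measurable N"
  unfolding borel_measurable_euclidean_space[of f]
  by (auto simp: Basis_vec_def inner_axis assms)

lemma borel_measurable_nth [measurable (raw)]: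
  fixes f :: "'a \<Rightarrow> 'b::euclidean_space^'n"
  shows "f \<in> borel_measurable N \<Longrightarrow> (\<lambda>x. f x $ i) \<in> borel_measurable N"
  by (rule measurable_compose[OF _ borel_measurable_continuous_onI]) (auto intro: continuous_intros)

lemma borel_measurable_matrix_mult [measurable (raw)]:
  fixes f h :: "'a \<Rightarrow> real^3^3"
  assumes [measurable]: "f \<in> borel_measurable N" "h \<in> borel_measurable N"
  shows "(\<lambda>x. f x ** h x) \<in> borel_measurable N"
  by (rule borel_measurable_matrix) (simp add: matrix_matrix_mult_def)

lemma borel_measurable_matrix_vector_mult [measurable (raw)]:
  fixes f :: "'a \<Rightarrow> real^3^3" and h :: "'a \<Rightarrow> real^3"
  assumes [measurable]: "f \<in> borel_measurable N" "h \<in> borel_measurable N"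
  shows "(\<lambda>x. f x *v h x) \<in> borel_measurable N"
  by (rule borel_measurable_vector) (simp add: matrix_vector_mult_def)

lemma borel_measurable_transpose [measurable (raw)]:
  fixes f :: "'a \<Rightarrow> real^3^3"
  assumes [measurable]: "f \<in> borel_measurable N"
  shows "(\<lambda>x. transpose (f x)) \<in> borel_measurable N"
  by (rule borel_measurable_matrix) (simp add: transpose_def)

lemma borel_measurable_cross3 [measurable (raw)]:
  assumes [measurable]: "f \<in> borel_measurable N" "h \<in> borel_measurable N"
  shows "(\<lambda>x. cross3 (f x) (h x)) \<in> borel_measurable N"
proof (rule borel_measurable_vector)
  fix i :: 3
  show "(\<lambda>x. cross3 (f x) (h x) $ i) \<in> borel_measurable N"
    using exhaust_3[of i] by (auto simp: cross_components)
qed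

abbreviation SO3_space :: "(real^3^3) measure" where
  "SO3_space \<equiv> restrict_space borel SO3"

lemma measurable_SO3_iff: "f \<in> measurable N SO3_space \<longleftrightarrow> f \<in> borel_measurable N \<and> (\<forall>x\<in>space N. f x \<in> SO3)"
  by (auto simp: measurable_restrict_space2_iff)

lemma measurable_SO3_mult [measurable (raw)]:
  "f \<in> measurable N SO3_space \<Longrightarrow> h \<in> measurable N SO3_space \<Longrightarrow> (\<lambda>x. f x ** h x) \<in> measurable N SO3_space"
  unfolding measurable_SO3_iff by (auto simp: SO3_mult)

lemma measurable_SO3_inv [measurable (raw)]:
  assumes "f \<in> measurable N SO3_space"
  shows "(\<lambda>x. matrix_inv (f x)) \<in> measurable N SO3_space"
proof -
  have "(\<lambda>x. transpose (f x)) \<in> measurable N SO3_space"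
    using assms unfolding measurable_SO3_iff by (auto simp: SO3_transpose)
  then show ?thesis
    using assms by (subst measurable_cong[of _ _ "\<lambda>x. transpose (f x)"])
      (auto simp: SO3_matrix_inv measurable_SO3_iff)
qed

lemma measurable_SO3_borel [measurable_dest]:
  "f \<in> measurable N SO3_space \<Longrightarrow> f \<in> borel_measurable N"
  by (simp add: measurable_SO3_iff)

text \<open>Gram-Schmidt by cross products: the third column is the direction of \<open>a\<close>,
  the first is orthogonal to \<open>a\<close> and \<open>b\<close>. The construction commutes with
  rotations (\<open>frame_rotate\<close>) and has a prescribed image of the pole
  (\<open>frame_north\<close>), which makes it a source both of Haar measure and of lifts from the
  sphere.\<close>

definition frame :: "real^3 \<Rightarrow> real^3 \<Rightarrow> real^3^3" where
  "frame a b = (let c3 = a /\<^sub>R norm a; c1 = cross3 a b /\<^sub>R norm (cross3 a b) in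
     if cross3 a b = 0 then mat 1 else transpose (vector [c1, cross3 c3 c1, c3]))"

lemma frame_SO3: "frame a b \<in> SO3"
proof (cases "cross3 a b = 0")
  case False
  define c3 where "c3 = a /\<^sub>R norm a"
  define c1 where "c1 = cross3 a b /\<^sub>R norm (cross3 a b)"
  have "a \<noteq> 0" using False by auto
  then have n: "c3 \<bullet> c3 = 1" "c1 \<bullet> c1 = 1"
    using False by (auto simp: c3_def c1_def dot_square_norm norm_eq_1[symmetric])
  have o: "c3 \<bullet> c1 = 0" "c1 \<bullet> c3 = 0" by (simp_all add: c3_def c1_def dot_cross_self)
  have c2: "cross3 c3 c1 \<bullet> cross3 c3 c1 = 1"
    using norm_cross_dot[of c3 c1] n o by (simp add: dot_square_norm norm_eq_1[symmetric] power_mult_distrib)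
  have "orthogonal_matrix (vector [c1, cross3 c3 c1, c3] :: real^3^3)"
    unfolding orthogonal_matrix_orthonormal_rows
    using n o c2 by (simp add: forall_3 row_def vector_3 norm_eq_1 orthogonal_def dot_cross_self)
  moreover have "det (vector [c1, cross3 c3 c1, c3] :: real^3^3) = 1"
    unfolding dot_cross_det[symmetric] using n o by (simp add: Lagrange cross_skew[of "cross3 c3 c1" c3] inner_diff_right)
  ultimately show ?thesis
    using False by (simp add: frame_def Let_def c3_def c1_def SO3_iff det_transpose)
qed (simp add: frame_def SO3_one)

lemma frame_north: "cross3 a b \<noteq> 0 \<Longrightarrow> frame a b *v north = a /\<^sub>R norm a"
proof -
  assume "cross3 a b \<noteq> 0"
  then obtain c1 c2 where "frame a b = transpose (vector [c1, c2, a /\<^sub>R norm a])"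
    by (auto simp: frame_def Let_def)
  then show ?thesis
    by (simp add: north_def matrix_vector_mult_def axis_def vec_eq_iff transpose_def vector_3 sum_3)
qed

lemma frame_rotate:
  assumes g: "g \<in> SO3" and ab: "cross3 a b \<noteq> 0"
  shows "frame (g *v a) (g *v b) = g ** frame a b"
proof -
  have mult: "g ** transpose (vector [x, y, z]) = (transpose (vector [g *v x, g *v y, g *v z]) :: real^3^3)" for x y z :: "real^3"
  proof -
    have "(g ** transpose (vector [x, y, z])) $ i $ j = transpose (vector [g *v x, g *v y, g *v z]) $ i $ j" for i j :: 3
      using exhaust_3[of j]
      by (auto simp: matrix_matrix_mult_def matrix_vector_mult_def transpose_def vector_3 sum_3)
    then show ?thesis by (simp add: vec_eq_iff)
  qed
  have c: "cross3 (g *v x) (g *v y) = g *v cross3 x y" for x y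
    by (rule cross_rotation_matrix[OF SO3_rotation[OF g]])
  have n: "norm (g *v x) = norm x" for x by (rule SO3_norm[OF g])
  then have "g *v cross3 a b \<noteq> 0" using ab by (metis norm_eq_zero)
  then show ?thesis
    using ab by (simp add: frame_def Let_def mult c n matrix_vector_mult_scaleR[symmetric])
qed

lemma borel_measurable_vector3:
  fixes f1 f2 f3 :: "'a \<Rightarrow> real^3"
  assumes [measurable]: "f1 \<in> borel_measurable N" "f2 \<in> borel_measurable N" "f3 \<in> borel_measurable N"
  shows "(\<lambda>x. vector [f1 x, f2 x, f3 x] :: real^3^3) \<in> borel_measurable N"
proof (rule borel_measurable_matrix)
  fix i j :: 3
  show "(\<lambda>x. (vector [f1 x, f2 x, f3 x] :: real^3^3) $ i $ j) \<in> borel_measurable N"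
    using exhaust_3[of i] by (auto simp: vector_3)
qed

lemma measurable_frame [measurable (raw)]:
  assumes [measurable]: "f \<in> borel_measurable N" "h \<in> borel_measurable N"
  shows "(\<lambda>x. frame (f x) (h x)) \<in> measurable N SO3_space"
  unfolding measurable_SO3_iff
proof (intro conjI ballI frame_SO3)
  have [measurable]: "(\<lambda>x. transpose (vector [cross3 (f x) (h x) /\<^sub>R norm (cross3 (f x) (h x)),
      cross3 (f x /\<^sub>R norm (f x)) (cross3 (f x) (h x) /\<^sub>R norm (cross3 (f x) (h x))), f x /\<^sub>R norm (f x)]
      :: real^3^3)) \<in> borel_measurable N"
    by (intro borel_measurable_transpose borel_measurable_vector3) measurable
  show "(\<lambda>x. frame (f x) (h x)) \<in> borel_measurable N"
    unfolding frame_def Let_def by measurable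
qed

section \<open>Existence and uniqueness of Haar measure\<close>

abbreviation ball_law :: "(real^3) measure" where
  "ball_law \<equiv> uniform_measure lborel (ball 0 1)"

lemma ball_emeasure: "emeasure lborel (ball (0::real^3) 1) \<noteq> 0" "emeasure lborel (ball (0::real^3) 1) \<noteq> \<infinity>"
proof -
  show "emeasure lborel (ball (0::real^3) 1) \<noteq> \<infinity>" using emeasure_lborel_ball_finite[of "0::real^3" 1] by simp
  have "measure lborel (ball (0::real^3) 1) > 0" by (rule content_ball_pos) simp
  then show "emeasure lborel (ball (0::real^3) 1) \<noteq> 0" by (auto simp: measure_def)
qed

lemma prob_ball_law: "prob_space ball_law"
  by (rule prob_space_uniform_measure[OF ball_emeasure])

lemma sets_ball_law [measurable_cong, simp]: "sets ball_law = sets borel" by simp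

text \<open>Orthogonal maps preserve both Lebesgue measure and the unit ball.\<close>

lemma ball_law_rotate:
  assumes g: "g \<in> SO3"
  shows "distr ball_law borel (\<lambda>x. g *v x) = ball_law"
proof (rule measure_eqI)
  have [measurable]: "(\<lambda>x. g *v x) \<in> borel_measurable borel" by measurable
  fix A assume "A \<in> sets (distr ball_law borel (\<lambda>x. g *v x))"
  then have A [measurable]: "A \<in> sets borel" by simp
  let ?B = "ball (0::real^3) 1"
  let ?S = "?B \<inter> (\<lambda>x. g *v x) -` A"
  have S: "?S \<in> sets borel" using measurable_sets_borel[of "\<lambda>x. g *v x" borel A] by simp
  have im: "(\<lambda>x. g *v x) ` ?S = ?B \<inter> A"
  proof safe
    fix y assume y: "y \<in> ?B" "y \<in> A"
    have "g *v (transpose g *v y) = y"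
      by (simp add: matrix_vector_mul_assoc SO3_transpose_mult g del: transpose_matrix_vector)
    moreover have "norm (transpose g *v y) < 1" using y SO3_norm[OF SO3_transpose[OF g], of y] by (simp del: transpose_matrix_vector)
    ultimately show "y \<in> (\<lambda>x. g *v x) ` ?S" using y by (intro image_eqI[of _ _ "transpose g *v y"]) auto
  qed (auto simp: SO3_norm[OF g])
  have fin: "?B \<inter> X \<in> lmeasurable" if "X \<in> sets borel" for X
    by (rule fmeasurable_Int_fmeasurable) (use that in auto)
  have "orthogonal_transformation ((*v) g)" using g by (simp add: SO3_iff orthogonal_transformation_matrix)
  from measure_orthogonal_image[OF this fin[of "(\<lambda>x. g *v x) -` A"]]
  have "measure lebesgue (?B \<inter> A) = measure lebesgue ?S"
    using measurable_sets_borel[of "\<lambda>x. g *v x" borel A] unfolding im by simp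
  then have "emeasure lebesgue (?B \<inter> A) = emeasure lebesgue ?S"
    using fin[OF A] fin[of "(\<lambda>x. g *v x) -` A"] measurable_sets_borel[of "\<lambda>x. g *v x" borel A]
    by (simp add: emeasure_eq_measure2)
  then have "emeasure lborel (?B \<inter> A) = emeasure lborel ?S" using S by simp
  then show "emeasure (distr ball_law borel (\<lambda>x. g *v x)) A = emeasure ball_law A"
    using measurable_sets_borel[of "\<lambda>x. g *v x" borel A] by (subst emeasure_distr) auto
qed simp

text \<open>For fixed \<open>a \<noteq> 0\<close> some \<open>c = cross3 a (axis i 1)\<close> is
  nonzero, and every \<open>b\<close> parallel to \<open>a\<close> lies in the null set given by
  \<open>c \<bullet> b = 0\<close>.\<close>

lemma ball_law_generic: "AE x in ball_law \<Otimes>\<^sub>M ball_law. cross3 (fst x) (snd x) \<noteq> 0"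
proof -
  interpret A: prob_space ball_law by (rule prob_ball_law)
  interpret AA: pair_sigma_finite ball_law ball_law ..
  have null: "AE x in ball_law. x \<notin> S" if "negligible S" "S \<in> sets borel" for S
  proof -
    have "S \<in> null_sets lborel"
      using that by (simp add: negligible_iff_null_sets null_sets_completion_iff)
    then have "AE x in lborel. x \<notin> S" by (rule AE_not_in)
    then show ?thesis by (intro AE_uniform_measureI) auto
  qed
  show ?thesis
  proof (rule AA.AE_pair_measure)
    show "{x \<in> space (ball_law \<Otimes>\<^sub>M ball_law). cross3 (fst x) (snd x) \<noteq> 0} \<in> sets (ball_law \<Otimes>\<^sub>M ball_law)"
      by measurable
    have "AE a in ball_law. a \<noteq> 0" using null[of "{0}"] by auto
    then show "AE a in ball_law. AE b in ball_law. cross3 (fst (a, b)) (snd (a, b)) \<noteq> 0"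
    proof eventually_elim
      case (elim a)
      have "\<exists>i. cross3 a (axis i 1) \<noteq> 0"
      proof (rule ccontr)
        assume "\<nexists>i. cross3 a (axis i 1) \<noteq> 0"
        then have "cross3 a (axis 1 1) = 0" "cross3 a (axis 2 1) = 0" by auto
        with elim show False by (auto simp: cross3_simps axis_def forall_3)
      qed
      then obtain i where i: "cross3 a (axis i 1) \<noteq> 0" by blast
      let ?c = "cross3 a (axis i 1)"
      have "AE b in ball_law. b \<notin> {b. ?c \<bullet> b = 0}"
        by (rule null[OF negligible_hyperplane]) (use i closed_hyperplane[of ?c 0] in auto)
      then show ?case
      proof eventually_elim
        case (elim b)
        have "?c \<bullet> b = - (cross3 a b \<bullet> axis i 1)"
          by (simp add: cross3_def inner_vec_def sum_3 vector_3 algebra_simps)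
        then show ?case using elim by auto
      qed
    qed
  qed
qed

text \<open>Haar measure is the law of the frame of two independent points of the ball: multiplying
  the frame by \<open>g\<close> rotates both points, which keeps their joint law.\<close>

lemma haar_exists: "\<exists>\<mu>. is_haar_SO3 \<mu>"
proof -
  interpret A: prob_space ball_law by (rule prob_ball_law)
  interpret AA: pair_prob_space ball_law ball_law ..
  let ?\<mu> = "distr (ball_law \<Otimes>\<^sub>M ball_law) SO3_space (\<lambda>x. frame (fst x) (snd x))"
  have F [measurable]: "(\<lambda>x. frame (fst x) (snd x)) \<in> measurable (ball_law \<Otimes>\<^sub>M ball_law) SO3_space"
    by measurable
  have "is_haar_SO3 ?\<mu>"
    unfolding is_haar_SO3_def
  proof (intro conjI ballI)
    show "prob_space ?\<mu>" by (rule AA.prob_space_distr[OF F])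
    show "sets ?\<mu> = sets SO3_space" by simp
    fix g assume g: "g \<in> SO3"
    have R [measurable]: "(\<lambda>x. g *v x) \<in> measurable ball_law borel" by measurable
    have L [measurable]: "(\<lambda>h. g ** h) \<in> measurable SO3_space SO3_space"
      using g by (auto simp: measurable_SO3_iff SO3_mult space_restrict_space intro!: borel_measurable_matrix_mult measurable_restrict_space1)
    have [measurable]: "(\<lambda>x. (g *v fst x, g *v snd x)) \<in> measurable (ball_law \<Otimes>\<^sub>M ball_law) (borel \<Otimes>\<^sub>M borel)"
      by measurable
    have F' [measurable]: "(\<lambda>x. frame (fst x) (snd x)) \<in> measurable (borel \<Otimes>\<^sub>M borel) SO3_space"
      by measurable
    have "distr ?\<mu> ?\<mu> (\<lambda>h. g ** h) = distr ?\<mu> SO3_space (\<lambda>h. g ** h)" by (rule distr_cong) auto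
    also have "\<dots> = distr (ball_law \<Otimes>\<^sub>M ball_law) SO3_space (\<lambda>x. g ** frame (fst x) (snd x))"
      by (subst distr_distr) (auto simp: o_def)
    also have "\<dots> = distr (ball_law \<Otimes>\<^sub>M ball_law) SO3_space (\<lambda>x. frame (g *v fst x) (g *v snd x))"
    proof (rule distr_cong_AE)
      show "AE x in ball_law \<Otimes>\<^sub>M ball_law. g ** frame (fst x) (snd x) = frame (g *v fst x) (g *v snd x)"
        using ball_law_generic by eventually_elim (simp add: frame_rotate[OF g])
    qed (use L F in auto)
    also have "\<dots> = distr (distr (ball_law \<Otimes>\<^sub>M ball_law) (borel \<Otimes>\<^sub>M borel) (\<lambda>(a, b). (g *v a, g *v b)))
        SO3_space (\<lambda>x. frame (fst x) (snd x))"
      by (subst distr_distr) (auto simp: o_def case_prod_unfold)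
    also have "distr (ball_law \<Otimes>\<^sub>M ball_law) (borel \<Otimes>\<^sub>M borel) (\<lambda>(a, b). (g *v a, g *v b)) = ball_law \<Otimes>\<^sub>M ball_law"
      using pair_measure_distr[OF R R] by (simp add: ball_law_rotate[OF g] A.sigma_finite_measure_axioms)
    finally show "distr ?\<mu> ?\<mu> (\<lambda>h. g ** h) = ?\<mu>" .
  qed
  then show ?thesis by blast
qed


lemma haar_space: "is_haar_SO3 \<mu> \<Longrightarrow> space \<mu> = SO3"
  unfolding is_haar_SO3_def by (metis sets_eq_imp_space_eq space_restrict_space space_borel Int_UNIV_right)

text \<open>The indicator of \<open>A\<close> at \<open>matrix_inv k ** h\<close> is integrated in
  both orders; left invariance of \<mu> settles one and left invariance of \<nu> the other. With
  equal measures this is invariance under inversion, and the two facts together give the uniqueness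
  that the \<open>THE\<close> in \<open>haar_SO3\<close> requires.\<close>

lemma haar_eq_inverse:
  assumes \<mu>: "is_haar_SO3 \<mu>" and \<nu>: "is_haar_SO3 \<nu>"
  shows "\<mu> = distr \<nu> \<nu> matrix_inv"
proof (rule measure_eqI)
  interpret \<mu>: prob_space \<mu> using \<mu> by (simp add: is_haar_SO3_def)
  interpret \<nu>: prob_space \<nu> using \<nu> by (simp add: is_haar_SO3_def)
  interpret PP: pair_sigma_finite \<nu> \<mu> ..
  have [measurable_cong]: "sets \<mu> = sets SO3_space" "sets \<nu> = sets SO3_space"
    using \<mu> \<nu> by (simp_all add: is_haar_SO3_def)
  note sp = haar_space[OF \<mu>] haar_space[OF \<nu>]
  show "sets \<mu> = sets (distr \<nu> \<nu> matrix_inv)"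
    using \<mu> \<nu> by (simp add: is_haar_SO3_def)
  fix A assume "A \<in> sets \<mu>"
  then have A [measurable]: "A \<in> sets SO3_space" using \<mu> by (simp add: is_haar_SO3_def)
  have id [measurable]: "(\<lambda>x. x) \<in> measurable \<nu> SO3_space" "(\<lambda>x. x) \<in> measurable \<mu> SO3_space" by measurable
  have c: "(\<lambda>h. g) \<in> measurable N SO3_space" if "g \<in> SO3" for g and N :: "(real^3^3) measure"
    using that by (intro measurable_const) (simp add: space_restrict_space)
  have L: "(\<integral>\<^sup>+h. indicator A (g ** h) \<partial>\<rho>) = emeasure \<rho> A" if g: "g \<in> SO3" and \<rho>: "is_haar_SO3 \<rho>" for g \<rho>
  proof -
    have [measurable_cong]: "sets \<rho> = sets SO3_space" using \<rho> by (simp add: is_haar_SO3_def)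
    note [measurable] = c[OF g]
    have "(\<integral>\<^sup>+h. indicator A (g ** h) \<partial>\<rho>) = (\<integral>\<^sup>+h. indicator A h \<partial>distr \<rho> \<rho> (\<lambda>h. g ** h))"
      by (rule nn_integral_distr[symmetric]) measurable
    also have "\<dots> = emeasure \<rho> A" using \<rho> g by (simp add: is_haar_SO3_def)
    finally show ?thesis .
  qed
  have "emeasure \<mu> A = (\<integral>\<^sup>+k. (\<integral>\<^sup>+h. indicator A (matrix_inv k ** h) \<partial>\<mu>) \<partial>\<nu>)"
  proof -
    have "(\<integral>\<^sup>+k. (\<integral>\<^sup>+h. indicator A (matrix_inv k ** h) \<partial>\<mu>) \<partial>\<nu>) = (\<integral>\<^sup>+k. emeasure \<mu> A \<partial>\<nu>)"
      by (rule nn_integral_cong) (simp add: L[OF SO3_inv \<mu>] sp)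
    then show ?thesis by (simp add: \<nu>.emeasure_space_1)
  qed
  also have "\<dots> = (\<integral>\<^sup>+h. (\<integral>\<^sup>+k. indicator A (matrix_inv k ** h) \<partial>\<nu>) \<partial>\<mu>)"
    by (rule PP.Fubini'[symmetric]) measurable
  also have "\<dots> = (\<integral>\<^sup>+h. emeasure (distr \<nu> \<nu> matrix_inv) A \<partial>\<mu>)"
  proof (rule nn_integral_cong)
    fix h assume "h \<in> space \<mu>"
    then have h: "h \<in> SO3" by (simp add: sp)
    note [measurable] = c[OF SO3_inv[OF h]]
    have "(\<integral>\<^sup>+k. indicator A (matrix_inv k ** h) \<partial>\<nu>) = (\<integral>\<^sup>+k. indicator A (matrix_inv (matrix_inv h ** k)) \<partial>\<nu>)"
      by (rule nn_integral_cong) (simp add: sp SO3_inv_prod SO3_inv SO3_inv_inv h)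
    also have "\<dots> = (\<integral>\<^sup>+k. indicator A (matrix_inv k) \<partial>distr \<nu> \<nu> (\<lambda>k. matrix_inv h ** k))"
      by (rule nn_integral_distr[symmetric]) measurable
    also have "\<dots> = (\<integral>\<^sup>+k. indicator A (matrix_inv k) \<partial>\<nu>)"
      using \<nu> SO3_inv[OF h] by (simp add: is_haar_SO3_def)
    also have "\<dots> = (\<integral>\<^sup>+k. indicator A k \<partial>distr \<nu> \<nu> matrix_inv)"
      by (rule nn_integral_distr[symmetric]) measurable
    finally show "(\<integral>\<^sup>+k. indicator A (matrix_inv k ** h) \<partial>\<nu>) = emeasure (distr \<nu> \<nu> matrix_inv) A"
      by simp
  qed
  also have "\<dots> = emeasure (distr \<nu> \<nu> matrix_inv) A"
    by (simp add: \<mu>.emeasure_space_1)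
  finally show "emeasure \<mu> A = emeasure (distr \<nu> \<nu> matrix_inv) A" .
qed

lemma is_haar_haar: "is_haar_SO3 haar_SO3"
proof -
  have "\<mu> = \<nu>" if "is_haar_SO3 \<mu>" "is_haar_SO3 \<nu>" for \<mu> \<nu>
    using haar_eq_inverse[OF that] haar_eq_inverse[OF that(2,2)] by simp
  then show ?thesis
    unfolding haar_SO3_def using haar_exists by (metis theI')
qed

lemma space_haar [simp]: "space haar_SO3 = SO3"
  by (rule haar_space[OF is_haar_haar])

lemma sets_haar [measurable_cong]: "sets haar_SO3 = sets SO3_space"
  using is_haar_haar by (simp add: is_haar_SO3_def)

lemma measurable_haar_iff: "measurable N haar_SO3 = measurable N SO3_space"
  by (rule measurable_cong_sets) (simp_all add: sets_haar)

lemma distr_haar_inv: "distr haar_SO3 haar_SO3 matrix_inv = haar_SO3"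
  using haar_eq_inverse[OF is_haar_haar is_haar_haar] by simp

lemma distr_haar_left: "g \<in> SO3 \<Longrightarrow> distr haar_SO3 haar_SO3 (\<lambda>h. g ** h) = haar_SO3"
  using is_haar_haar by (simp add: is_haar_SO3_def)

text \<open>Right translation is left translation conjugated by inversion.\<close>

lemma distr_haar_right:
  assumes g: "g \<in> SO3"
  shows "distr haar_SO3 haar_SO3 (\<lambda>h. h ** g) = haar_SO3"
proof -
  have [measurable]: "g \<in> space SO3_space" "matrix_inv g \<in> space SO3_space"
    using g SO3_inv[OF g] by (simp_all add: space_restrict_space)
  have "haar_SO3 = distr (distr (distr haar_SO3 haar_SO3 matrix_inv) haar_SO3 (\<lambda>h. matrix_inv g ** h)) haar_SO3 matrix_inv"
    by (simp add: distr_haar_inv distr_haar_left SO3_inv g)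
  also have "\<dots> = distr haar_SO3 haar_SO3 (\<lambda>h. matrix_inv (matrix_inv g ** matrix_inv h))"
    by (subst distr_distr, measurable, subst distr_distr, measurable) (simp add: o_def)
  also have "\<dots> = distr haar_SO3 haar_SO3 (\<lambda>h. h ** g)"
    by (rule distr_cong) (auto simp: SO3_inv_prod SO3_inv SO3_inv_inv g)
  finally show ?thesis by simp
qed

interpretation haar: prob_group haar_SO3 "(**)" matrix_inv "mat 1"
proof (rule prob_group.intro)
  show "prob_space haar_SO3" using is_haar_haar by (simp add: is_haar_SO3_def)
  show "prob_group_axioms haar_SO3 (**) matrix_inv (mat 1)"
  proof
    show "(\<lambda>(g, h). g ** h) \<in> haar_SO3 \<Otimes>\<^sub>M haar_SO3 \<rightarrow>\<^sub>M haar_SO3" by measurable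
    show "matrix_inv \<in> haar_SO3 \<rightarrow>\<^sub>M haar_SO3" by measurable
  qed (simp_all add: SO3_one SO3_inv_mult distr_haar_inv distr_haar_left distr_haar_right matrix_mul_assoc)
qed

section \<open>The spin bundle\<close>

lemma K_north_SO3: "k \<in> K_north \<Longrightarrow> k \<in> SO3"
  by (simp add: K_north_def)

lemma K_north_fix: "k \<in> K_north \<Longrightarrow> k *v north = north"
  by (simp add: K_north_def)

lemma K_north_one: "mat 1 \<in> K_north"
  by (simp add: K_north_def SO3_one)

lemma K_north_mult: "k \<in> K_north \<Longrightarrow> l \<in> K_north \<Longrightarrow> k ** l \<in> K_north"
  by (simp add: K_north_def SO3_mult matrix_vector_mul_assoc[symmetric])

lemma K_north_inv: assumes "k \<in> K_north" shows "matrix_inv k \<in> K_north"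
proof -
  have "matrix_inv k *v (k *v north) = north"
    using assms by (simp add: matrix_vector_mul_assoc SO3_inv_mult K_north_SO3)
  then show ?thesis using assms by (simp add: K_north_def SO3_inv)
qed

text \<open>The rotation angle as a point of the unit circle. Unlike \<open>rot_angle\<close>, whose
  \<open>Arg\<close> jumps, it is multiplicative, and \<open>chi s k\<close> becomes its power with
  exponent \<open>s\<close>.\<close>

definition zk :: "real^3^3 \<Rightarrow> complex" where
  "zk k = Complex (k $ 1 $ 1) (k $ 2 $ 1)"

text \<open>The last column is \<open>north\<close>, and so is the last row because the transpose
  also fixes \<open>north\<close>; orthogonality and determinant 1 leave a plane rotation.\<close>

lemma K_north_entries:
  assumes "k \<in> K_north"
  shows "k $ 1 $ 3 = 0" "k $ 2 $ 3 = 0" "k $ 3 $ 3 = 1" "k $ 3 $ 1 = 0" "k $ 3 $ 2 = 0"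
    "k $ 2 $ 2 = k $ 1 $ 1" "k $ 1 $ 2 = - k $ 2 $ 1" "(k $ 1 $ 1)\<^sup>2 + (k $ 2 $ 1)\<^sup>2 = 1"
proof -
  have col: "l $ i $ 3 = (if i = 3 then 1 else 0)" if "l *v north = north" for l :: "real^3^3" and i
    using arg_cong[OF that, of "\<lambda>x. x $ i"]
    by (simp add: north_def matrix_vector_mult_def axis_def sum_3 if_distrib cong: if_cong)
  show c: "k $ 1 $ 3 = 0" "k $ 2 $ 3 = 0" "k $ 3 $ 3 = 1"
    using col[OF K_north_fix[OF assms]] by auto
  have "transpose k *v north = north"
    using K_north_fix[OF K_north_inv[OF assms]] SO3_matrix_inv[OF K_north_SO3[OF assms]] by simp
  from col[OF this] show r: "k $ 3 $ 1 = 0" "k $ 3 $ 2 = 0" by (auto simp: transpose_def)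
  have det: "k $ 1 $ 1 * k $ 2 $ 2 - k $ 1 $ 2 * k $ 2 $ 1 = 1"
    using K_north_SO3[OF assms] c r by (simp add: SO3_iff det_3)
  have T: "(transpose k ** k) $ i $ j = (if i = j then 1 else 0)" for i j
    using SO3_transpose_mult(1)[OF K_north_SO3[OF assms]] by (simp add: mat_def)
  have 1: "k $ 1 $ 1 * k $ 1 $ 1 + k $ 2 $ 1 * k $ 2 $ 1 = 1"
    using T[of 1 1] c r by (simp add: matrix_matrix_mult_def transpose_def sum_3)
  have 2: "k $ 1 $ 1 * k $ 1 $ 2 + k $ 2 $ 1 * k $ 2 $ 2 = 0"
    using T[of 1 2] c r by (simp add: matrix_matrix_mult_def transpose_def sum_3)
  show "k $ 2 $ 2 = k $ 1 $ 1" "k $ 1 $ 2 = - k $ 2 $ 1" using 1 2 det by algebra+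
  show "(k $ 1 $ 1)\<^sup>2 + (k $ 2 $ 1)\<^sup>2 = 1" using 1 by (simp add: power2_eq_square)
qed

lemma zk_norm: "k \<in> K_north \<Longrightarrow> norm (zk k) = 1"
  using K_north_entries(8) by (simp add: zk_def cmod_def)

lemma zk_mult: "k \<in> K_north \<Longrightarrow> l \<in> K_north \<Longrightarrow> zk (k ** l) = zk k * zk l"
  using K_north_entries[of k] K_north_entries[of l]
  by (simp add: zk_def complex_eq_iff matrix_matrix_mult_def sum_3)

lemma K_north_eqI: "k \<in> K_north \<Longrightarrow> l \<in> K_north \<Longrightarrow> zk k = zk l \<Longrightarrow> k = l"
  using K_north_entries[of k] K_north_entries[of l]
  by (simp add: vec_eq_iff forall_3 zk_def)

lemma K_north_commute: "k \<in> K_north \<Longrightarrow> l \<in> K_north \<Longrightarrow> k ** l = l ** k"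
  by (rule K_north_eqI) (auto simp: K_north_mult zk_mult)

lemma chi_powi: assumes "k \<in> K_north" shows "chi s k = zk k powi s"
proof -
  have "zk k = exp (\<i> * of_real (Arg (zk k)))"
    using Arg_eq[of "zk k"] zk_norm[OF assms] by fastforce
  then have "zk k powi s = exp (of_int s * (\<i> * of_real (Arg (zk k))))"
    by (metis exp_power_int)
  then show ?thesis by (simp add: chi_def rot_angle_def zk_def mult_ac)
qed

lemma chi_norm: "k \<in> K_north \<Longrightarrow> norm (chi s k) = 1"
  by (simp add: chi_powi norm_power_int zk_norm)

lemma chi_nonzero: "k \<in> K_north \<Longrightarrow> chi s k \<noteq> 0"
  using chi_norm[of k s] by force

lemma chi_mult: "k \<in> K_north \<Longrightarrow> l \<in> K_north \<Longrightarrow> chi s (k ** l) = chi s k * chi s l"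
  by (simp add: chi_powi K_north_mult zk_mult power_int_mult_distrib)

lemma chi_one: "chi s (mat 1) = 1"
  using K_north_one by (simp add: chi_powi zk_def mat_def complex_eq_iff one_complex.code[symmetric])

lemma chi_cnj_mult: "k \<in> K_north \<Longrightarrow> chi s k * cnj (chi s k) = 1" "k \<in> K_north \<Longrightarrow> cnj (chi s k) * chi s k = 1"
  using chi_norm[of k s] by (simp_all add: complex_norm_square[symmetric] mult.commute)

lemma chi_inv: assumes "k \<in> K_north" shows "chi s (matrix_inv k) = cnj (chi s k)"
proof -
  have "chi s k * chi s (matrix_inv k) = 1"
    using chi_mult[OF assms K_north_inv[OF assms], of s] assms by (simp add: SO3_inv_mult K_north_SO3 chi_one)
  then have "cnj (chi s k) * (chi s k * chi s (matrix_inv k)) = cnj (chi s k)" by simp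
  then show ?thesis unfolding mult.assoc[symmetric] chi_cnj_mult(2)[OF assms] by simp
qed

lemma chi_inv_cnj: "k \<in> K_north \<Longrightarrow> cnj (chi s (matrix_inv k)) = chi s k"
  by (simp add: chi_inv)

text \<open>One element serves both uses of \<open>s \<noteq> 0\<close>: integrals that it
  multiplies by \<open>-\<i>\<close> vanish, and so do integrals of squares that it multiplies by
  -1.\<close>

lemma chi_imaginary_unit: assumes "s \<noteq> 0" obtains k where "k \<in> K_north" "chi s k = \<i>"
proof -
  define a where "a = pi / (2 * of_int s)"
  define c1 :: "real^3" where "c1 = vector [cos a, sin a, 0]"
  let ?e = "axis 3 1 :: real^3"
  \<comment> \<open>The second argument of \<open>frame\<close> is chosen so that the first column
    becomes \<open>c1\<close>.\<close>
  have c: "cross3 ?e (cross3 c1 ?e) = c1"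
    by (simp add: c1_def cross3_def vec_eq_iff forall_3 vector_3 axis_def)
  have n: "norm c1 = 1" by (simp add: norm_eq_1 inner_vec_def sum_3 c1_def vector_3 power2_eq_square[symmetric])
  let ?k = "frame ?e (cross3 c1 ?e)"
  have nz: "cross3 ?e (cross3 c1 ?e) \<noteq> 0" using n c by auto
  have k: "?k \<in> K_north"
    using frame_north[OF nz] by (simp add: K_north_def frame_SO3 north_def)
  have "zk ?k = cis a"
    using n nz unfolding frame_def Let_def c
    by (simp add: zk_def transpose_def vector_3 c1_def complex_eq_iff)
  then have "chi s ?k = cis (of_int s * a)" by (simp add: chi_powi[OF k] cis_power_int)
  also have "of_int s * a = pi / 2" using assms by (simp add: a_def)
  finally show ?thesis using k that by simp
qed

text \<open>A Borel choice of a rotation taking the pole to \<open>x\<close>; a continuous one does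
  not exist on the whole sphere. Two reference axes are enough because a unit vector is parallel to
  at most one of them.\<close>

definition pole_lift :: "real^3 \<Rightarrow> real^3^3" where
  "pole_lift x = (if cross3 x (axis 1 1) \<noteq> 0 then frame x (axis 1 1) else frame x (axis 2 1))"

lemma pole_lift_SO3: "pole_lift x \<in> SO3"
  by (simp add: pole_lift_def frame_SO3)

lemma pole_lift_north: assumes "norm x = 1" shows "pole_lift x *v north = x"
proof -
  have "cross3 x (axis 1 1) \<noteq> 0 \<or> cross3 x (axis 2 1) \<noteq> 0"
  proof (rule ccontr)
    assume "\<not> ?thesis"
    then have "x = 0" by (auto simp: cross3_simps axis_def forall_3)
    with assms show False by simp
  qed
  then show ?thesis using assms by (auto simp: pole_lift_def frame_north)
qed

lemma measurable_pole_lift [measurable (raw)]: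
  assumes [measurable]: "f \<in> borel_measurable N"
  shows "(\<lambda>x. pole_lift (f x)) \<in> measurable N SO3_space"
  unfolding pole_lift_def by measurable

lemma SO3_north_norm: "g \<in> SO3 \<Longrightarrow> norm (g *v north) = 1"
  by (simp add: SO3_norm north_def)

text \<open>The \<open>K_north\<close> factor of \<open>g\<close> relative to the chosen lift. By
  \<open>stab_part_mult\<close> and right invariance it transports Haar measure to an invariant
  measure on \<open>K_north\<close>, which is how averages over the stabiliser are taken.\<close>

definition stab_part :: "real^3^3 \<Rightarrow> real^3^3" where
  "stab_part g = matrix_inv (pole_lift (g *v north)) ** g"

lemma stab_part_K: assumes g: "g \<in> SO3" shows "stab_part g \<in> K_north"
proof -
  let ?l = "pole_lift (g *v north)"
  have "matrix_inv ?l *v (?l *v north) = north"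
    by (simp add: matrix_vector_mul_assoc SO3_inv_mult pole_lift_SO3)
  then have "matrix_inv ?l *v (g *v north) = north"
    by (simp add: pole_lift_north SO3_north_norm g)
  then show ?thesis
    using g by (simp add: stab_part_def K_north_def SO3_mult SO3_inv pole_lift_SO3 matrix_vector_mul_assoc[symmetric])
qed

lemma stab_part_mult: "k \<in> K_north \<Longrightarrow> stab_part (g ** k) = stab_part g ** k"
  by (simp add: stab_part_def K_north_fix matrix_vector_mul_assoc[symmetric] matrix_mul_assoc)

lemma lift_stab: "g \<in> SO3 \<Longrightarrow> pole_lift (g *v north) ** stab_part g = g"
  by (simp add: stab_part_def SO3_inv_cancel pole_lift_SO3)

lemma same_north:
  assumes "g \<in> SO3" "h \<in> SO3" "g *v north = h *v north"
  obtains k where "k \<in> K_north" "h = g ** k"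
proof (rule that)
  show "matrix_inv g ** h \<in> K_north"
    using assms(1,2) unfolding K_north_def
    by (simp add: SO3_mult SO3_inv matrix_vector_mul_assoc[symmetric] assms(3)[symmetric])
       (simp add: matrix_vector_mul_assoc SO3_inv_mult)
qed (use assms in \<open>simp add: SO3_inv_cancel\<close>)

section \<open>Fibres and their coordinates\<close>

lemma theta_mem: "(g, z) \<in> theta s g z"
  unfolding theta_def using K_north_one SO3_inv_mult(1)[OF SO3_one]
  by (intro CollectI exI[of _ "mat 1"]) (simp add: chi_one SO3_matrix_inv SO3_one)

lemma theta_eq_iff: assumes "g \<in> SO3" shows "theta s g z = theta s g w \<longleftrightarrow> z = w"
proof
  assume "theta s g z = theta s g w"
  then have "(g, z) \<in> theta s g w" using theta_mem by metis
  then obtain k where k: "k \<in> K_north" "g = g ** k" "z = chi s (matrix_inv k) * w"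
    by (auto simp: theta_def)
  then have "k = mat 1" using SO3_inv_cancel(1)[OF assms, of k] SO3_inv_mult(1)[OF assms] by simp
  then show "z = w" using k by (simp add: SO3_matrix_inv SO3_one chi_one)
qed simp

lemma theta_shift: assumes k: "k \<in> K_north" shows "theta s (g ** k) z = theta s g (chi s k * z)"
proof -
  let ?f = "\<lambda>l. (g ** k ** l, chi s (matrix_inv l) * z)"
  let ?h = "\<lambda>m. (g ** m, chi s (matrix_inv m) * (chi s k * z))"
  have fh: "?f l = ?h (k ** l)" if "l \<in> K_north" for l
    using k that chi_cnj_mult(2)[OF k, of s]
    by (simp add: matrix_mul_assoc chi_inv K_north_mult chi_mult mult_ac)
  have "?f ` K_north = ?h ` K_north"
  proof (intro equalityI image_subsetI)
    fix l assume l: "l \<in> K_north"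
    show "?f l \<in> ?h ` K_north" unfolding fh[OF l] by (intro imageI K_north_mult k l)
  next
    fix m assume m: "m \<in> K_north"
    have l: "matrix_inv k ** m \<in> K_north" by (intro K_north_mult K_north_inv k m)
    have "?h m = ?f (matrix_inv k ** m)"
      unfolding fh[OF l] SO3_inv_cancel(2)[OF K_north_SO3[OF k]] ..
    then show "?h m \<in> ?f ` K_north" using l by blast
  qed
  then show ?thesis by (simp only: theta_def Setcompr_eq_image Collect_mem_eq)
qed

lemma theta_in_bundle: "g \<in> SO3 \<Longrightarrow> theta s g z \<in> spin_bundle s"
  by (auto simp: spin_bundle_def)

lemma theta_north: "(h, w) \<in> theta s g z \<Longrightarrow> h *v north = g *v north"
  by (auto simp: theta_def matrix_vector_mul_assoc[symmetric] K_north_fix)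

lemma bundle_proj_theta: "bundle_proj (theta s g z) = g *v north"
  unfolding bundle_proj_def
proof (rule the_equality)
  show "\<exists>(h, w)\<in>theta s g z. g *v north = h *v north" using theta_mem[of g z s] by auto
  show "x = g *v north" if "\<exists>(h, w)\<in>theta s g z. x = h *v north" for x
    using that theta_north by auto
qed

lemma theta_fiber:
  assumes "p \<in> spin_bundle s" "bundle_proj p = g *v north" "g \<in> SO3"
  shows "\<exists>z. p = theta s g z"
proof -
  obtain h w where h: "p = theta s h w" "h \<in> SO3" using assms(1) by (auto simp: spin_bundle_def)
  then have "g *v north = h *v north" using assms(2) by (simp add: bundle_proj_theta)
  then obtain k where "k \<in> K_north" "h = g ** k" using same_north assms(3) h(2) by metis
  then show ?thesis using h by (auto simp: theta_shift)
qed

definition pull :: "int \<Rightarrow> real^3^3 \<Rightarrow> bundle_point \<Rightarrow> complex" where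
  "pull s g p = (THE z. p = theta s g z)"

lemma pull_theta: "g \<in> SO3 \<Longrightarrow> pull s g (theta s g z) = z"
  unfolding pull_def by (rule the_equality) (auto simp: theta_eq_iff)

lemma theta_pull:
  "p \<in> spin_bundle s \<Longrightarrow> bundle_proj p = g *v north \<Longrightarrow> g \<in> SO3 \<Longrightarrow> theta s g (pull s g p) = p"
  using theta_fiber pull_theta by metis

lemma fiber_inner_theta:
  assumes g: "g \<in> SO3"
  shows "fiber_inner s (theta s g z) (theta s g w) = z * cnj w"
  unfolding fiber_inner_def
proof (rule the_equality)
  show "\<exists>g' z' w'. g' \<in> SO3 \<and> theta s g z = theta s g' z' \<and> theta s g w = theta s g' w' \<and> z * cnj w = z' * cnj w'"
    using g by blast
  fix c assume "\<exists>g' z' w'. g' \<in> SO3 \<and> theta s g z = theta s g' z' \<and> theta s g w = theta s g' w' \<and> c = z' * cnj w'"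
  then obtain g' z' w' where g': "g' \<in> SO3" "theta s g z = theta s g' z'" "theta s g w = theta s g' w'" "c = z' * cnj w'"
    by blast
  have "g *v north = g' *v north" using g'(2) bundle_proj_theta by metis
  then obtain k where k: "k \<in> K_north" "g' = g ** k" using same_north g g'(1) by metis
  have "z = chi s k * z'" "w = chi s k * w'" using g' k g by (simp_all add: theta_shift theta_eq_iff)
  then show "c = z * cnj w" using g'(4) chi_cnj_mult[OF k(1), of s] by (simp add: mult_ac)
qed

lemma fiber_norm_theta: "g \<in> SO3 \<Longrightarrow> fiber_norm s (theta s g z) = norm z"
  by (simp add: fiber_norm_def fiber_inner_theta complex_norm_square[symmetric] flip: of_real_power)

lemma bundle_act_theta: "bundle_act h (theta s g z) = theta s (h ** g) z"
  by (simp add: bundle_act_def theta_def Setcompr_eq_image image_image matrix_mul_assoc)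

text \<open>The maps \<open>equiv_coord s j\<close> are continuous and transform like pullbacks of sections of \<open>\<xi>\<^sub>s\<close>; they have no common
  zero, so a point of the bundle is determined by its inner products with the corresponding three sections.\<close>

definition equiv_coord :: "int \<Rightarrow> 3 \<Rightarrow> real^3^3 \<Rightarrow> complex" where
  "equiv_coord s j g = (if s \<ge> 0 then Complex (g $ j $ 1) (g $ j $ 2) ^ nat s
     else Complex (g $ j $ 1) (- (g $ j $ 2)) ^ nat (- s))"

text \<open>Right multiplication by \<open>k\<close> turns the first two entries of each row by the
  angle of \<open>k\<close>. The sign of \<open>s\<close> decides whether these entries or their
  conjugates are raised to a power.\<close>

lemma equiv_coord_shift:
  assumes k: "k \<in> K_north"
  shows "equiv_coord s j (g ** k) = cnj (chi s k) * equiv_coord s j g"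
proof -
  have c: "Complex ((g ** k) $ j $ 1) ((g ** k) $ j $ 2) = cnj (zk k) * Complex (g $ j $ 1) (g $ j $ 2)"
    using K_north_entries[OF k] by (simp add: zk_def complex_eq_iff matrix_matrix_mult_def sum_3)
  have c': "Complex ((g ** k) $ j $ 1) (- ((g ** k) $ j $ 2)) = zk k * Complex (g $ j $ 1) (- (g $ j $ 2))"
    using K_north_entries[OF k] by (simp add: zk_def complex_eq_iff matrix_matrix_mult_def sum_3)
  show ?thesis
  proof (cases "s \<ge> 0")
    case True
    then show ?thesis by (simp add: equiv_coord_def c power_mult_distrib chi_powi[OF k] power_int_def)
  next
    case False
    have "cnj (inverse (zk k)) = zk k"
      using zk_norm[OF k] complex_norm_square[of "zk k"] by (auto simp: inverse_eq_divide divide_eq_eq mult.commute)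
    with False show ?thesis
      by (simp add: equiv_coord_def c' power_mult_distrib chi_powi[OF k] power_int_def del: complex_cnj_inverse)
  qed
qed

lemma equiv_coord_pos:
  assumes g: "g \<in> SO3"
  shows "(\<Sum>j\<in>UNIV. (norm (equiv_coord s j g))\<^sup>2) > 0"
proof -
  have T: "(transpose g ** g) $ 1 $ 1 = 1" using SO3_transpose_mult(1)[OF g] by (simp add: mat_def)
  have "\<exists>j. g $ j $ 1 \<noteq> 0"
  proof (rule ccontr)
    assume "\<nexists>j. g $ j $ 1 \<noteq> 0"
    then show False using T by (simp add: matrix_matrix_mult_def transpose_def)
  qed
  then obtain j where "g $ j $ 1 \<noteq> 0" by blast
  then have "Complex (g $ j $ 1) x \<noteq> 0" for x by (simp add: complex_eq_iff)
  then have "equiv_coord s j g \<noteq> 0" by (simp add: equiv_coord_def)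
  then show ?thesis by (intro sum_pos2[of _ j]) auto
qed

lemma continuous_equiv_coord: "continuous_on UNIV (equiv_coord s j)"
  unfolding equiv_coord_def Complex_eq by (cases "s \<ge> 0") (auto intro!: continuous_intros)

lemma measurable_equiv_coord [measurable (raw)]:
  "f \<in> borel_measurable N \<Longrightarrow> (\<lambda>x. equiv_coord s j (f x)) \<in> borel_measurable N"
  by (rule measurable_compose[OF _ borel_measurable_continuous_onI[OF continuous_equiv_coord]])

definition bundle_coord :: "int \<Rightarrow> 3 \<Rightarrow> bundle_point \<Rightarrow> complex" where
  "bundle_coord s j p = (THE c. \<exists>g z. g \<in> SO3 \<and> p = theta s g z \<and> c = z * cnj (equiv_coord s j g))"

lemma bundle_coord_theta:
  assumes g: "g \<in> SO3"
  shows "bundle_coord s j (theta s g z) = z * cnj (equiv_coord s j g)"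
  unfolding bundle_coord_def
proof (rule the_equality)
  show "\<exists>g' z'. g' \<in> SO3 \<and> theta s g z = theta s g' z' \<and> z * cnj (equiv_coord s j g) = z' * cnj (equiv_coord s j g')"
    using g by blast
  fix c assume "\<exists>g' z'. g' \<in> SO3 \<and> theta s g z = theta s g' z' \<and> c = z' * cnj (equiv_coord s j g')"
  then obtain g' z' where g': "g' \<in> SO3" "theta s g z = theta s g' z'" "c = z' * cnj (equiv_coord s j g')"
    by blast
  have "g *v north = g' *v north" using g'(2) bundle_proj_theta by metis
  then obtain k where k: "k \<in> K_north" "g' = g ** k" using same_north g g'(1) by metis
  have "z = chi s k * z'" using g' k g by (simp add: theta_shift theta_eq_iff)
  then show "c = z * cnj (equiv_coord s j g)" using g'(3) by (simp add: k equiv_coord_shift)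
qed

section \<open>Borel structure of the total space\<close>

lemma space_bundle_borel: "space (bundle_borel s) = spin_bundle s"
  unfolding bundle_borel_def by (rule space_measure_of) auto

text \<open>Open sets of the quotient have relatively open preimages by definition;
  \<open>borel_prod\<close> turns open subsets of the product into members of the product
  sigma-algebra.\<close>

lemma measurable_theta: "(\<lambda>(g, z). theta s g z) \<in> measurable (SO3_space \<Otimes>\<^sub>M borel) (bundle_borel s)"
  unfolding bundle_borel_def
proof (rule measurable_sigma_sets[OF sets_measure_of])
  let ?G = "{A. A \<subseteq> spin_bundle s \<and> openin (top_of_set (SO3 \<times> UNIV)) {(g, z). g \<in> SO3 \<and> theta s g z \<in> A}}"
  show "?G \<subseteq> Pow (spin_bundle s)" by auto
  then show "?G \<subseteq> Pow (spin_bundle s)" .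
  have sp: "space (SO3_space \<Otimes>\<^sub>M borel) = SO3 \<times> (UNIV :: complex set)"
    by (simp add: space_pair_measure space_restrict_space)
  then show "(\<lambda>(g, z). theta s g z) \<in> space (SO3_space \<Otimes>\<^sub>M borel) \<rightarrow> spin_bundle s"
    by (auto simp: theta_in_bundle)
  fix A assume "A \<in> ?G"
  then obtain T where T: "open T" "{(g, z). g \<in> SO3 \<and> theta s g z \<in> A} = (SO3 \<times> UNIV) \<inter> T"
    by (auto simp: openin_open)
  have "(\<lambda>(g, z). theta s g z) -` A \<inter> space (SO3_space \<Otimes>\<^sub>M borel) = (\<lambda>x. x) -` T \<inter> space (SO3_space \<Otimes>\<^sub>M borel)"
    unfolding sp using T(2) by (auto simp: set_eq_iff)
  also have "\<dots> \<in> sets (SO3_space \<Otimes>\<^sub>M borel)"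
  proof (rule measurable_sets)
    have "(\<lambda>x. (fst x, snd x)) \<in> measurable (SO3_space \<Otimes>\<^sub>M (borel :: complex measure)) (borel \<Otimes>\<^sub>M borel)"
      by measurable
    then show "(\<lambda>x. x) \<in> measurable (SO3_space \<Otimes>\<^sub>M (borel :: complex measure)) borel"
      unfolding borel_prod by simp
  qed (use T in auto)
  finally show "(\<lambda>(g, z). theta s g z) -` A \<inter> space (SO3_space \<Otimes>\<^sub>M borel) \<in> sets (SO3_space \<Otimes>\<^sub>M borel)" .
qed

lemma measurable_theta_raw [measurable (raw)]:
  "f \<in> measurable N SO3_space \<Longrightarrow> h \<in> borel_measurable N \<Longrightarrow> (\<lambda>x. theta s (f x) (h x)) \<in> measurable N (bundle_borel s)"
  using measurable_compose[OF measurable_Pair measurable_theta, of f N h] by simp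

text \<open>Continuity on the quotient is checked upstairs, where the coordinate is an explicit
  continuous function.\<close>

lemma measurable_bundle_coord [measurable]: "bundle_coord s j \<in> borel_measurable (bundle_borel s)"
proof (rule borel_measurableI)
  fix O' :: "complex set" assume O': "open O'"
  let ?A = "bundle_coord s j -` O' \<inter> space (bundle_borel s)"
  have "{(g, z). g \<in> SO3 \<and> theta s g z \<in> ?A} = (SO3 \<times> UNIV) \<inter> (\<lambda>(g, z). z * cnj (equiv_coord s j g)) -` O'"
    by (auto simp: bundle_coord_theta space_bundle_borel theta_in_bundle)
  moreover have "open ((\<lambda>(g, z). z * cnj (equiv_coord s j g)) -` O')"
    unfolding case_prod_unfold
    by (intro open_vimage O' continuous_intros continuous_on_compose2[OF continuous_equiv_coord]) auto
  ultimately have "openin (top_of_set (SO3 \<times> UNIV)) {(g, z). g \<in> SO3 \<and> theta s g z \<in> ?A}"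
    by (simp add: openin_open_Int)
  then show "?A \<in> sets (bundle_borel s)"
    unfolding bundle_borel_def by (intro in_measure_of) (auto simp: space_bundle_borel[unfolded bundle_borel_def])
qed

text \<open>The fibre coordinate is recovered from three inner products. These are measurable and
  the denominator is positive, so \<open>pull\<close>, a mere description by \<open>THE\<close>,
  becomes accessible to measurability arguments.\<close>

lemma pull_formula:
  assumes "g \<in> SO3" "p \<in> spin_bundle s" "bundle_proj p = g *v north"
  shows "pull s g p = (\<Sum>j\<in>UNIV. bundle_coord s j p * equiv_coord s j g) / of_real (\<Sum>j\<in>UNIV. (norm (equiv_coord s j g))\<^sup>2)"
proof -
  obtain z where p: "p = theta s g z" using theta_fiber assms by blast
  define n where "n = (\<Sum>j\<in>UNIV. (norm (equiv_coord s j g))\<^sup>2)"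
  have n: "n > 0" unfolding n_def by (rule equiv_coord_pos[OF assms(1)])
  have "(\<Sum>j\<in>UNIV. bundle_coord s j p * equiv_coord s j g) = (\<Sum>j\<in>UNIV. z * of_real ((norm (equiv_coord s j g))\<^sup>2))"
    unfolding p bundle_coord_theta[OF assms(1)] complex_norm_square
    by (rule sum.cong) (simp_all only: mult_ac)
  also have "\<dots> = z * of_real n" by (simp add: n_def sum_distrib_left)
  finally show ?thesis using n assms(1) p unfolding n_def[symmetric] by (simp add: pull_theta)
qed

section \<open>Sections and equivariant functions\<close>

lemma measurable_haar_id [measurable]:
  "(\<lambda>g. g) \<in> measurable haar_SO3 SO3_space" "(\<lambda>g. g) \<in> borel_measurable haar_SO3"
proof -
  show "(\<lambda>g. g) \<in> measurable haar_SO3 SO3_space" by (simp flip: measurable_haar_iff)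
  then show "(\<lambda>g. g) \<in> borel_measurable haar_SO3" by (rule measurable_SO3_borel)
qed

section \<open>Integration on the sphere through the group\<close>

lemma sets_S2_measure [measurable_cong]: "sets S2_measure = sets (restrict_space borel S2)"
  by (simp add: S2_measure_def)

lemma space_S2_measure [simp]: "space S2_measure = S2"
  by (simp add: S2_measure_def space_restrict_space)

lemma measurable_north: "(\<lambda>g. g *v north) \<in> measurable haar_SO3 (restrict_space borel S2)"
  by (auto simp: measurable_restrict_space2_iff SO3_north_norm)

lemma measurable_north_S2 [measurable]: "(\<lambda>g. g *v north) \<in> measurable haar_SO3 S2_measure"
  using measurable_north by (simp cong: measurable_cong_sets add: sets_S2_measure)

lemma measurable_lift_S2 [measurable]: "pole_lift \<in> measurable S2_measure haar_SO3"
  unfolding measurable_haar_iff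
  by (subst measurable_cong_sets[OF sets_S2_measure refl]) (intro measurable_pole_lift measurable_restrict_space1, simp)

text \<open>A function on the sphere is its pullback composed with the measurable
  \<open>pole_lift\<close>. This reduces questions on the sphere to the group.\<close>

lemma S2_fun_measurable:
  assumes "\<And>g. g \<in> SO3 \<Longrightarrow> F (g *v north) = f g" "f \<in> measurable haar_SO3 N"
  shows "F \<in> measurable S2_measure N"
proof -
  have "F x = f (pole_lift x)" if "x \<in> S2" for x
    using assms(1)[OF pole_lift_SO3, of x] that by (simp add: pole_lift_north)
  moreover have "(\<lambda>x. f (pole_lift x)) \<in> measurable S2_measure N"
    by (rule measurable_compose[OF measurable_lift_S2 assms(2)])
  ultimately show ?thesis by (subst measurable_cong[of _ F "\<lambda>x. f (pole_lift x)"]) auto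
qed

lemma S2_integral:
  fixes f :: "real^3^3 \<Rightarrow> complex"
  assumes "\<And>g. g \<in> SO3 \<Longrightarrow> F (g *v north) = f g" "f \<in> borel_measurable haar_SO3"
  shows "(\<integral>x. F x \<partial>S2_measure) = (\<integral>g. f g \<partial>haar_SO3)"
proof -
  have "F \<in> borel_measurable S2_measure" by (rule S2_fun_measurable[OF assms])
  then have "F \<in> borel_measurable (restrict_space borel S2)" by (simp cong: measurable_cong_sets add: sets_S2_measure)
  then have "(\<integral>x. F x \<partial>S2_measure) = (\<integral>g. F (g *v north) \<partial>haar_SO3)"
    unfolding S2_measure_def by (rule integral_distr[OF measurable_north])
  also have "\<dots> = (\<integral>g. f g \<partial>haar_SO3)" by (rule Bochner_Integration.integral_cong) (auto simp: assms)
  finally show ?thesis .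
qed

lemma S2_nn_integral:
  assumes "\<And>g. g \<in> SO3 \<Longrightarrow> F (g *v north) = f g" "f \<in> borel_measurable haar_SO3"
  shows "(\<integral>\<^sup>+x. F x \<partial>S2_measure) = (\<integral>\<^sup>+g. f g \<partial>haar_SO3)"
proof -
  have "F \<in> borel_measurable S2_measure" by (rule S2_fun_measurable[OF assms])
  then have "F \<in> borel_measurable (restrict_space borel S2)" by (simp cong: measurable_cong_sets add: sets_S2_measure)
  then have "(\<integral>\<^sup>+x. F x \<partial>S2_measure) = (\<integral>\<^sup>+g. F (g *v north) \<partial>haar_SO3)"
    unfolding S2_measure_def by (intro nn_integral_distr[OF measurable_north]) simp
  also have "\<dots> = (\<integral>\<^sup>+g. f g \<partial>haar_SO3)" by (rule nn_integral_cong) (auto simp: assms)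
  finally show ?thesis .
qed

definition spin_fun :: "int \<Rightarrow> (real^3^3 \<Rightarrow> complex) \<Rightarrow> bool" where
  "spin_fun s U \<longleftrightarrow> (\<forall>g\<in>SO3. \<forall>k\<in>K_north. U (g ** k) = cnj (chi s k) * U g)"

definition pullback :: "int \<Rightarrow> (real^3 \<Rightarrow> bundle_point) \<Rightarrow> real^3^3 \<Rightarrow> complex" where
  "pullback s u g = pull s g (u (g *v north))"

text \<open>Inverse to \<open>pullback\<close> on spin functions, for which the choice of the lift
  is immaterial by \<open>sec_of_theta\<close>. For any \<open>U\<close> the result is still a
  section.\<close>

definition sec_of :: "int \<Rightarrow> (real^3^3 \<Rightarrow> complex) \<Rightarrow> real^3 \<Rightarrow> bundle_point" where
  "sec_of s U x = theta s (pole_lift x) (U (pole_lift x))"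

lemma section_theta: "is_section s u \<Longrightarrow> g \<in> SO3 \<Longrightarrow> u (g *v north) = theta s g (pullback s u g)"
  unfolding pullback_def by (rule theta_pull[symmetric]) (auto simp: is_section_def SO3_north_norm)

lemma pullback_eqI: "g \<in> SO3 \<Longrightarrow> u (g *v north) = theta s g z \<Longrightarrow> pullback s u g = z"
  by (simp add: pullback_def pull_theta)

lemma spin_fun_pullback: assumes "is_section s u" shows "spin_fun s (pullback s u)"
  unfolding spin_fun_def
proof (intro ballI)
  fix g k assume g: "g \<in> SO3" and k: "k \<in> K_north"
  have "(g ** k) *v north = g *v north" using K_north_fix[OF k] by (simp add: matrix_vector_mul_assoc[symmetric])
  then have "theta s (g ** k) (pullback s u (g ** k)) = theta s g (pullback s u g)"
    using section_theta[OF assms g] section_theta[OF assms SO3_mult[OF g K_north_SO3[OF k]]] by simp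
  then have "chi s k * pullback s u (g ** k) = pullback s u g"
    by (simp add: theta_shift[OF k] theta_eq_iff[OF g])
  then have "cnj (chi s k) * (chi s k * pullback s u (g ** k)) = cnj (chi s k) * pullback s u g" by simp
  then show "pullback s u (g ** k) = cnj (chi s k) * pullback s u g"
    unfolding mult.assoc[symmetric] chi_cnj_mult(2)[OF k] by simp
qed

lemma sec_of_theta: assumes "spin_fun s U" "g \<in> SO3" shows "sec_of s U (g *v north) = theta s g (U g)"
proof -
  let ?l = "pole_lift (g *v north)"
  have k: "stab_part g \<in> K_north" by (rule stab_part_K[OF assms(2)])
  have "theta s g (U g) = theta s (?l ** stab_part g) (U (?l ** stab_part g))"
    by (simp add: lift_stab assms(2))
  also have "\<dots> = theta s ?l (chi s (stab_part g) * (cnj (chi s (stab_part g)) * U ?l))"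
    using assms(1) k pole_lift_SO3 by (simp add: theta_shift[OF k] spin_fun_def)
  also have "\<dots> = theta s ?l (U ?l)"
    unfolding mult.assoc[symmetric] chi_cnj_mult(1)[OF k] by simp
  finally show ?thesis by (simp add: sec_of_def)
qed

lemma pullback_sec_of: "spin_fun s U \<Longrightarrow> g \<in> SO3 \<Longrightarrow> pullback s (sec_of s U) g = U g"
  by (rule pullback_eqI) (auto simp: sec_of_theta)

lemma is_section_sec_of: "is_section s (sec_of s U)"
  unfolding is_section_def sec_of_def
  by (auto simp: theta_in_bundle pole_lift_SO3 bundle_proj_theta pole_lift_north)

lemma pull_measurable:
  assumes [measurable]: "G \<in> measurable N haar_SO3" "Q \<in> measurable N (bundle_borel s)"
    and proj: "\<And>x. x \<in> space N \<Longrightarrow> bundle_proj (Q x) = G x *v north"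
  shows "(\<lambda>x. pull s (G x) (Q x)) \<in> borel_measurable N"
proof -
  have [measurable]: "G \<in> borel_measurable N" using assms(1) unfolding measurable_haar_iff by (rule measurable_SO3_borel)
  have [measurable]: "(\<lambda>x. bundle_coord s j (Q x)) \<in> borel_measurable N" for j
    by (rule measurable_compose[OF assms(2) measurable_bundle_coord])
  have "pull s (G x) (Q x) = (\<Sum>j\<in>UNIV. bundle_coord s j (Q x) * equiv_coord s j (G x))
      / of_real (\<Sum>j\<in>UNIV. (norm (equiv_coord s j (G x)))\<^sup>2)" if "x \<in> space N" for x
    using that proj measurable_space[OF assms(1) that] measurable_space[OF assms(2) that]
    by (intro pull_formula) (auto simp: space_bundle_borel)
  moreover have "(\<lambda>x. (\<Sum>j\<in>UNIV. bundle_coord s j (Q x) * equiv_coord s j (G x))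
      / of_real (\<Sum>j\<in>UNIV. (norm (equiv_coord s j (G x)))\<^sup>2)) \<in> borel_measurable N"
    by measurable
  ultimately show ?thesis by (subst measurable_cong) 
qed

lemma pullback_measurable:
  assumes "is_section s u" "u \<in> measurable S2_measure (bundle_borel s)"
  shows "pullback s u \<in> borel_measurable haar_SO3"
  unfolding pullback_def
  by (rule pull_measurable)
     (use assms(1) in \<open>auto intro: measurable_compose[OF measurable_north_S2 assms(2)] simp: is_section_def SO3_north_norm\<close>)

lemma L2_section_pullback:
  assumes "L2_section s u"
  shows "sq_integrable haar_SO3 (pullback s u)" "spin_fun s (pullback s u)"
proof -
  have u: "is_section s u" "u \<in> measurable S2_measure (bundle_borel s)" using assms by (auto simp: L2_section_def)
  note m = pullback_measurable[OF u]
  have "(\<integral>\<^sup>+x. ennreal ((fiber_norm s (u x))\<^sup>2) \<partial>S2_measure) = (\<integral>\<^sup>+g. ennreal ((norm (pullback s u g))\<^sup>2) \<partial>haar_SO3)"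
    by (rule S2_nn_integral) (use m in \<open>auto simp: section_theta[OF u(1)] fiber_norm_theta\<close>)
  then show "sq_integrable haar_SO3 (pullback s u)"
    using assms m by (simp add: sq_integrable_iff_nn L2_section_def)
  show "spin_fun s (pullback s u)" by (rule spin_fun_pullback[OF u(1)])
qed

lemma L2_section_sec_of:
  assumes U: "sq_integrable haar_SO3 U" "spin_fun s U"
  shows "L2_section s (sec_of s U)"
proof -
  have [measurable]: "U \<in> borel_measurable haar_SO3" using U by auto
  have "sec_of s U \<in> measurable S2_measure (bundle_borel s)"
    by (rule S2_fun_measurable[where f = "\<lambda>g. theta s g (U g)", OF sec_of_theta[OF U(2)]]) measurable
  moreover have "(\<integral>\<^sup>+x. ennreal ((fiber_norm s (sec_of s U x))\<^sup>2) \<partial>S2_measure) = (\<integral>\<^sup>+g. ennreal ((norm (U g))\<^sup>2) \<partial>haar_SO3)"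
    by (rule S2_nn_integral) (auto simp: sec_of_theta[OF U(2)] fiber_norm_theta)
  ultimately show ?thesis
    using U(1) by (simp add: L2_section_def is_section_sec_of sq_integrable_iff_nn)
qed

lemma section_act_pullback:
  assumes u: "is_section s u" and h: "h \<in> SO3" and g: "g \<in> SO3"
  shows "section_act h u (g *v north) = theta s g (pullback s u (matrix_inv h ** g))"
proof -
  have "matrix_inv h *v (g *v north) = (matrix_inv h ** g) *v north" by (simp add: matrix_vector_mul_assoc)
  then show ?thesis
    using section_theta[OF u SO3_mult[OF SO3_inv[OF h] g]]
    by (simp add: section_act_def bundle_act_theta SO3_inv_cancel h)
qed

locale spin_random_section = prob_space M for M :: "'w measure" +
  fixes s :: int and T :: "real^3 \<Rightarrow> 'w \<Rightarrow> bundle_point"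
  assumes T: "random_section s M T"
begin

definition X :: "real^3^3 \<Rightarrow> 'w \<Rightarrow> complex" where
  "X g \<omega> = pullback s (\<lambda>x. T x \<omega>) g"

lemma section_path: "\<omega> \<in> space M \<Longrightarrow> is_section s (\<lambda>x. T x \<omega>)"
  using T by (simp add: random_section_def)

lemma X_theta: "\<omega> \<in> space M \<Longrightarrow> g \<in> SO3 \<Longrightarrow> T (g *v north) \<omega> = theta s g (X g \<omega>)"
  unfolding X_def by (rule section_theta[OF section_path])

lemma X_spin: "\<omega> \<in> space M \<Longrightarrow> g \<in> SO3 \<Longrightarrow> k \<in> K_north \<Longrightarrow> X (g ** k) \<omega> = cnj (chi s k) * X g \<omega>"
  using spin_fun_pullback[OF section_path] by (simp add: X_def spin_fun_def)

lemma X_measurable: "(\<lambda>(g, \<omega>). X g \<omega>) \<in> borel_measurable (haar_SO3 \<Otimes>\<^sub>M M)"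
proof -
  have T': "(\<lambda>(x, \<omega>). T x \<omega>) \<in> measurable (S2_measure \<Otimes>\<^sub>M M) (bundle_borel s)"
    using T by (simp add: random_section_def)
  have "(\<lambda>y. (fst y *v north, snd y)) \<in> measurable (haar_SO3 \<Otimes>\<^sub>M M) (S2_measure \<Otimes>\<^sub>M M)"
    by (intro measurable_Pair measurable_compose[OF measurable_fst measurable_north_S2] measurable_snd)
  from measurable_compose[OF this T']
  have m: "(\<lambda>y. T (fst y *v north) (snd y)) \<in> measurable (haar_SO3 \<Otimes>\<^sub>M M) (bundle_borel s)" by simp
  have "(\<lambda>y. pull s (fst y) (T (fst y *v north) (snd y))) \<in> borel_measurable (haar_SO3 \<Otimes>\<^sub>M M)"
    by (rule pull_measurable[OF measurable_fst m]) (auto simp: space_pair_measure X_theta bundle_proj_theta)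
  then show ?thesis by (simp add: X_def pullback_def case_prod_unfold)
qed

lemma X_meas [measurable (raw)]:
  "f \<in> measurable N haar_SO3 \<Longrightarrow> f' \<in> measurable N M \<Longrightarrow> (\<lambda>x. X (f x) (f' x)) \<in> borel_measurable N"
  using measurable_compose[OF measurable_Pair X_measurable, of f N f'] by (simp only: prod.case)

lemma pairing_eq:
  assumes \<omega>: "\<omega> \<in> space M" and u: "L2_section s u"
  shows "pairing s T u \<omega> = (\<integral>g. X g \<omega> * cnj (pullback s u g) \<partial>haar_SO3)"
  unfolding pairing_def
proof (rule S2_integral)
  have "is_section s u" using u by (simp add: L2_section_def)
  then show "fiber_inner s (T (g *v north) \<omega>) (u (g *v north)) = X g \<omega> * cnj (pullback s u g)" if "g \<in> SO3" for g
    using that \<omega> by (simp add: X_theta section_theta fiber_inner_theta)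
  have [measurable]: "pullback s u \<in> borel_measurable haar_SO3" using L2_section_pullback(1)[OF u] by auto
  show "(\<lambda>g. X g \<omega> * cnj (pullback s u g)) \<in> borel_measurable haar_SO3" using \<omega> by measurable
qed

lemma path_norm:
  assumes \<omega>: "\<omega> \<in> space M"
  shows "(\<integral>\<^sup>+x. ennreal ((fiber_norm s (T x \<omega>))\<^sup>2) \<partial>S2_measure) = (\<integral>\<^sup>+g. ennreal ((norm (X g \<omega>))\<^sup>2) \<partial>haar_SO3)"
  by (rule S2_nn_integral) (use \<omega> in \<open>auto simp: X_theta fiber_norm_theta\<close>)

lemma pairing_measurable:
  assumes u: "L2_section s u"
  shows "pairing s T u \<in> borel_measurable M"
proof -
  have [measurable]: "pullback s u \<in> borel_measurable haar_SO3" using L2_section_pullback(1)[OF u] by auto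
  have "(\<lambda>\<omega>. \<integral>g. X g \<omega> * cnj (pullback s u g) \<partial>haar_SO3) \<in> borel_measurable M" by measurable
  then show ?thesis by (subst measurable_cong[OF pairing_eq[OF _ u]])
qed

end

section \<open>Gaussian moments and orthonormal bases\<close>

lemma std_normal_moments:
  "(\<integral>x. x \<partial>std_normal_distribution) = 0" "(\<integral>x. x\<^sup>2 \<partial>std_normal_distribution) = 1"
  "(\<integral>x. x^3 \<partial>std_normal_distribution) = 0" "(\<integral>x. x^4 \<partial>std_normal_distribution) = 3"
proof -
  show "(\<integral>x. x \<partial>std_normal_distribution) = 0" using integral_std_normal_distribution_moment_odd[of 1] by simp
  show "(\<integral>x. x^3 \<partial>std_normal_distribution) = 0" using integral_std_normal_distribution_moment_odd[of 3] by simp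
  show "(\<integral>x. x\<^sup>2 \<partial>std_normal_distribution) = 1" using std_normal_distribution_even_moments(1)[of 1] by simp
  have "fact 4 = (24::real)" by (simp add: fact_numeral)
  then show "(\<integral>x. x^4 \<partial>std_normal_distribution) = 3" using std_normal_distribution_even_moments(1)[of 2] by simp
qed

text \<open>The fourth moment is compared with the uncentred second moment, because the means of the
  pairings are shown to vanish only after the second moment of the path is known to be
  finite.\<close>

lemma gaussian_law_facts:
  assumes R: "R \<in> borel_measurable M" and law: "distr M borel R = gaussian_law a \<sigma>"
  shows "integrable M R" "(\<integral>x. R x \<partial>M) = a"
    and "integrable M (\<lambda>x. (R x)\<^sup>2)" "(\<integral>x. (R x)\<^sup>2 \<partial>M) = a\<^sup>2 + \<sigma>\<^sup>2"
    and "integrable M (\<lambda>x. (R x)^4)" "(\<integral>x. (R x)^4 \<partial>M) \<le> 3 * (a\<^sup>2 + \<sigma>\<^sup>2)\<^sup>2"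
    and "(\<integral>x. exp (\<i> * of_real (R x)) \<partial>M) = exp (\<i> * of_real a - of_real (\<sigma>\<^sup>2 / 2))"
proof -
  define SN where "SN = std_normal_distribution"
  interpret S: real_distribution SN unfolding SN_def by (rule real_dist_normal_dist)
  have law': "distr M borel R = distr SN borel (\<lambda>x. a + \<sigma> * x)" using law by (simp add: SN_def gaussian_law_def)
  have mom: "integrable SN (\<lambda>x. x^k)" for k unfolding SN_def by (rule integrable_std_normal_distribution_moment)
  have mom1: "integrable SN (\<lambda>x. x)" using mom[of 1] by simp
  note std_moments = std_normal_moments[folded SN_def]
  have char: "char SN t = of_real (exp (- (t\<^sup>2) / 2))" for t by (simp add: SN_def char_std_normal_distribution)
  have I: "(\<integral>x. f (R x) \<partial>M) = (\<integral>x. f (a + \<sigma> * x) \<partial>SN)"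
    if "f \<in> borel_measurable borel" for f :: "real \<Rightarrow> 'b::{banach, second_countable_topology}"
  proof -
    have "(\<integral>x. f (R x) \<partial>M) = (\<integral>x. f x \<partial>distr M borel R)" by (rule integral_distr[symmetric, OF R that])
    also have "\<dots> = (\<integral>x. f (a + \<sigma> * x) \<partial>SN)"
      unfolding law' by (rule integral_distr) (use that in auto)
    finally show ?thesis .
  qed
  have J: "integrable M (\<lambda>x. f (R x)) \<longleftrightarrow> integrable SN (\<lambda>x. f (a + \<sigma> * x))"
    if "f \<in> borel_measurable borel" for f :: "real \<Rightarrow> real"
  proof -
    have "integrable M (\<lambda>x. f (R x)) \<longleftrightarrow> integrable (distr M borel R) f" by (rule integrable_distr_eq[symmetric, OF R that])
    also have "\<dots> \<longleftrightarrow> integrable SN (\<lambda>x. f (a + \<sigma> * x))"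
      unfolding law' by (rule integrable_distr_eq) (use that in auto)
    finally show ?thesis .
  qed
  have e2: "(a + \<sigma> * x)\<^sup>2 = a\<^sup>2 + (2 * a * \<sigma>) * x + \<sigma>\<^sup>2 * x\<^sup>2" for x
    by (simp add: power2_eq_square algebra_simps)
  have e4: "(a + \<sigma> * x)^4 = a^4 + (4 * a^3 * \<sigma>) * x + (6 * a\<^sup>2 * \<sigma>\<^sup>2) * x\<^sup>2 + (4 * a * \<sigma>^3) * x^3 + \<sigma>^4 * x^4" for x
    by algebra
  note add = Bochner_Integration.integrable_add and mult = integrable_mult_right
  have p1: "integrable SN (\<lambda>x. a + \<sigma> * x)" by (intro add mult mom1 S.integrable_const)
  have p2: "integrable SN (\<lambda>x. (a + \<sigma> * x)\<^sup>2)" unfolding e2 by (intro add mult mom mom1 S.integrable_const)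
  have p4: "integrable SN (\<lambda>x. (a + \<sigma> * x)^4)" unfolding e4 by (intro add mult mom mom1 S.integrable_const)
  have b: "(\<lambda>x::real. x) \<in> borel_measurable borel" "(\<lambda>x::real. x^n) \<in> borel_measurable borel" for n by measurable
  show "integrable M R" using J[OF b(1)] p1 by blast
  show "integrable M (\<lambda>x. (R x)\<^sup>2)" using J[OF b(2)] p2 by blast
  show "integrable M (\<lambda>x. (R x)^4)" using J[OF b(2)] p4 by blast
  have c: "(\<integral>x. c \<partial>SN) = c" for c :: real using S.prob_space by simp
  have "(\<integral>x. R x \<partial>M) = (\<integral>x. a \<partial>SN) + \<sigma> * (\<integral>x. x \<partial>SN)"
    unfolding I[OF b(1)] by (subst Bochner_Integration.integral_add) (auto intro: mult mom1)
  then show "(\<integral>x. R x \<partial>M) = a" by (simp only: c std_moments mult_zero_right add_0_right mult_1_right mult.commute[of _ 3])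
  have "(\<integral>x. (R x)\<^sup>2 \<partial>M) = (\<integral>x. a\<^sup>2 \<partial>SN) + (2 * a * \<sigma>) * (\<integral>x. x \<partial>SN) + \<sigma>\<^sup>2 * (\<integral>x. x\<^sup>2 \<partial>SN)"
    unfolding I[OF b(2)] e2
    by (subst Bochner_Integration.integral_add, (intro add mult mom mom1 S.integrable_const)+)+
       (simp only: Bochner_Integration.integral_mult_right_zero)
  then show "(\<integral>x. (R x)\<^sup>2 \<partial>M) = a\<^sup>2 + \<sigma>\<^sup>2" by (simp only: c std_moments mult_zero_right add_0_right mult_1_right mult.commute[of _ 3])
  have "(\<integral>x. (R x)^4 \<partial>M) = (\<integral>x. a^4 \<partial>SN) + (4 * a^3 * \<sigma>) * (\<integral>x. x \<partial>SN) + (6 * a\<^sup>2 * \<sigma>\<^sup>2) * (\<integral>x. x\<^sup>2 \<partial>SN)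
      + (4 * a * \<sigma>^3) * (\<integral>x. x^3 \<partial>SN) + \<sigma>^4 * (\<integral>x. x^4 \<partial>SN)"
    unfolding I[OF b(2)] e4
    by (subst Bochner_Integration.integral_add, (intro add mult mom mom1 S.integrable_const)+)+
       (simp only: Bochner_Integration.integral_mult_right_zero)
  then have "(\<integral>x. (R x)^4 \<partial>M) = a^4 + 6 * a\<^sup>2 * \<sigma>\<^sup>2 + 3 * \<sigma>^4" by (simp only: c std_moments mult_zero_right add_0_right mult_1_right mult.commute[of _ 3])
  also have "\<dots> \<le> 3 * (a\<^sup>2 + \<sigma>\<^sup>2)\<^sup>2"
  proof -
    have "3 * (a\<^sup>2 + \<sigma>\<^sup>2)\<^sup>2 - (a^4 + 6 * a\<^sup>2 * \<sigma>\<^sup>2 + 3 * \<sigma>^4) = 2 * (a\<^sup>2)\<^sup>2" by algebra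
    then show ?thesis using zero_le_power2[of "a\<^sup>2"] by linarith
  qed
  finally show "(\<integral>x. (R x)^4 \<partial>M) \<le> 3 * (a\<^sup>2 + \<sigma>\<^sup>2)\<^sup>2" .
  have "(\<integral>x. exp (\<i> * of_real (R x)) \<partial>M) = (\<integral>x. exp (\<i> * of_real (a + \<sigma> * x)) \<partial>SN)"
    using I[of "\<lambda>x. exp (\<i> * of_real x)"] by simp
  also have "\<dots> = (\<integral>x. exp (\<i> * of_real a) * iexp (\<sigma> * x) \<partial>SN)"
    by (simp add: exp_add[symmetric] algebra_simps)
  also have "\<dots> = exp (\<i> * of_real a) * char SN \<sigma>" by (simp add: char_def)
  also have "char SN \<sigma> = exp (of_real (- \<sigma>\<^sup>2 / 2))" unfolding char by (rule exp_of_real[symmetric])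
  also have "exp (\<i> * of_real a) * exp (of_real (- \<sigma>\<^sup>2 / 2)) = exp (\<i> * of_real a - of_real (\<sigma>\<^sup>2 / 2))"
    unfolding mult_exp_exp by simp
  finally show "(\<integral>x. exp (\<i> * of_real (R x)) \<partial>M) = exp (\<i> * of_real a - of_real (\<sigma>\<^sup>2 / 2))" .
qed

text \<open>The constant 6 is the Gaussian factor 3 times the 2 lost in splitting into real and
  imaginary part.\<close>

lemma complex_gaussian_moments:
  assumes "complex_gaussian_var M Y"
  shows "sq_integrable M Y" "integrable M (\<lambda>x. (norm (Y x))^4)"
    "(\<integral>x. (norm (Y x))^4 \<partial>M) \<le> 6 * (l2sq M Y)\<^sup>2"
proof -
  obtain a b \<sigma> where Y [measurable]: "Y \<in> borel_measurable M"
    and re: "distr M borel (\<lambda>\<omega>. Re (Y \<omega>)) = gaussian_law a \<sigma>"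
    and im: "distr M borel (\<lambda>\<omega>. Im (Y \<omega>)) = gaussian_law b \<sigma>"
    using assms by (auto simp: complex_gaussian_var_def)
  have "(\<lambda>\<omega>. Re (Y \<omega>)) \<in> borel_measurable M" "(\<lambda>\<omega>. Im (Y \<omega>)) \<in> borel_measurable M" by measurable
  note R = gaussian_law_facts[OF this(1) re] and I = gaussian_law_facts[OF this(2) im]
  have n2: "(norm (Y x))\<^sup>2 = (Re (Y x))\<^sup>2 + (Im (Y x))\<^sup>2" for x by (rule cmod_power2)
  show sq: "sq_integrable M Y" using R(3) I(3) by (simp add: sq_integrable_def n2)
  have n4: "(norm (Y x))^4 \<le> 2 * (Re (Y x))^4 + 2 * (Im (Y x))^4" for x
  proof -
    have "(norm (Y x))^4 = ((Re (Y x))\<^sup>2 + (Im (Y x))\<^sup>2)\<^sup>2" using n2[of x] by (metis power2_eq_square power4_eq_xxxx mult.assoc)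
    also have "\<dots> \<le> 2 * ((Re (Y x))\<^sup>2)\<^sup>2 + 2 * ((Im (Y x))\<^sup>2)\<^sup>2"
      using sum_squares_bound[of "(Re (Y x))\<^sup>2" "(Im (Y x))\<^sup>2"] by (simp add: power2_sum)
    finally show ?thesis by (simp flip: power_mult)
  qed
  have int: "integrable M (\<lambda>x. 2 * (Re (Y x))^4 + 2 * (Im (Y x))^4)" using R(5) I(5) by simp
  show i4: "integrable M (\<lambda>x. (norm (Y x))^4)"
    by (rule Bochner_Integration.integrable_bound[OF int]) (use n4 in \<open>auto intro!: AE_I2 order_trans[OF n4]\<close>)
  have "(\<integral>x. (norm (Y x))^4 \<partial>M) \<le> (\<integral>x. 2 * (Re (Y x))^4 + 2 * (Im (Y x))^4 \<partial>M)"
    by (rule integral_mono[OF i4 int n4])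
  also have "\<dots> \<le> 6 * (a\<^sup>2 + \<sigma>\<^sup>2)\<^sup>2 + 6 * (b\<^sup>2 + \<sigma>\<^sup>2)\<^sup>2" using R(5,6) I(5,6) by simp
  also have "\<dots> \<le> 6 * ((a\<^sup>2 + \<sigma>\<^sup>2) + (b\<^sup>2 + \<sigma>\<^sup>2))\<^sup>2"
  proof -
    have "6 * x\<^sup>2 + 6 * y\<^sup>2 \<le> 6 * (x + y)\<^sup>2" if "0 \<le> x" "0 \<le> y" for x y :: real
      using that by (simp add: power2_sum)
    from this[of "a\<^sup>2 + \<sigma>\<^sup>2" "b\<^sup>2 + \<sigma>\<^sup>2"] show ?thesis by (meson add_nonneg_nonneg zero_le_power2)
  qed
  also have "(a\<^sup>2 + \<sigma>\<^sup>2) + (b\<^sup>2 + \<sigma>\<^sup>2) = l2sq M Y" using R(3,4) I(3,4) by (simp add: l2sq_def n2)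
  finally show "(\<integral>x. (norm (Y x))^4 \<partial>M) \<le> 6 * (l2sq M Y)\<^sup>2" .
qed

text \<open>The fourth moment controls how much of the variance an event of small probability can carry.\<close>

lemma (in prob_space) gaussian_truncation:
  assumes Y: "complex_gaussian_var M Y" and A: "A \<in> events" and p: "prob (space M - A) \<le> 1/24"
  shows "l2sq M Y \<le> 2 * (\<integral>x. indicator A x * (norm (Y x))\<^sup>2 \<partial>M)"
proof (cases "l2sq M Y = 0")
  case False
  define m where "m = l2sq M Y"
  have m: "m > 0" using False by (simp add: m_def less_le)
  have [measurable]: "Y \<in> borel_measurable M" "A \<in> events" "space M - A \<in> events" using Y A by (auto simp: complex_gaussian_var_def)
  note mom = complex_gaussian_moments[OF Y]
  note i2 = sq_integrableD[OF mom(1)]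
  have iA: "integrable M (\<lambda>x. indicator A x * (norm (Y x))\<^sup>2)"
    by (rule Bochner_Integration.integrable_bound[OF i2]) (auto split: split_indicator)
  have iB: "integrable M (\<lambda>x. (norm (Y x))^4 / (24 * m) + 6 * m * indicator (space M - A) x)"
    using mom(2) by (auto intro!: Bochner_Integration.integrable_add integrable_real_indicator simp: emeasure_eq_measure)
  have pt: "(norm (Y x))\<^sup>2 \<le> indicator A x * (norm (Y x))\<^sup>2 + ((norm (Y x))^4 / (24 * m) + 6 * m * indicator (space M - A) x)"
    if "x \<in> space M" for x
  proof (cases "x \<in> A")
    case True
    then show ?thesis using m by simp
  next
    case False
    \<comment> \<open>A completed square bounds \<open>(norm (Y x))^2\<close> off \<open>A\<close>
      by a fourth moment term and a probability term. With these weights each contributes at most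
      \<open>m / 4\<close>, so half of the variance remains on \<open>A\<close>.\<close>
    have "0 \<le> ((norm (Y x))\<^sup>2 - 12 * m)\<^sup>2 / (24 * m)" using m by simp
    also have "\<dots> = (norm (Y x))^4 / (24 * m) + 6 * m - (norm (Y x))\<^sup>2"
      using m by (simp add: power2_diff field_simps flip: power_mult) (simp add: power2_eq_square)
    finally show ?thesis using False that by simp
  qed
  have "m = (\<integral>x. (norm (Y x))\<^sup>2 \<partial>M)" by (simp add: m_def l2sq_def)
  also have "\<dots> \<le> (\<integral>x. indicator A x * (norm (Y x))\<^sup>2 + ((norm (Y x))^4 / (24 * m) + 6 * m * indicator (space M - A) x) \<partial>M)"
    by (rule integral_mono[OF i2 Bochner_Integration.integrable_add[OF iA iB] pt])
  also have "\<dots> = (\<integral>x. indicator A x * (norm (Y x))\<^sup>2 \<partial>M) + ((\<integral>x. (norm (Y x))^4 \<partial>M) / (24 * m) + 6 * m * prob (space M - A))"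
    using iA iB mom(2) by (simp add: emeasure_eq_measure)
  also have "(\<integral>x. (norm (Y x))^4 \<partial>M) / (24 * m) \<le> (6 * m\<^sup>2) / (24 * m)"
    using mom(3) m by (intro divide_right_mono) (auto simp: m_def)
  also have "(6 * m\<^sup>2) / (24 * m) = m / 4" using m by (simp add: power2_eq_square)
  also have "6 * m * prob (space M - A) \<le> 6 * m * (1/24)" using p m by (intro mult_left_mono) auto
  finally show ?thesis by (simp add: m_def[symmetric])
qed simp

lemma (in prob_space) bounded_event:
  fixes Z :: "'a \<Rightarrow> real"
  assumes [measurable]: "Z \<in> borel_measurable M" and "\<epsilon> > 0"
  obtains c where "c \<ge> 0" "prob (space M - {x\<in>space M. Z x \<le> c}) \<le> \<epsilon>"
proof -
  let ?A = "\<lambda>n::nat. {x\<in>space M. Z x \<le> real n}"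
  have "(\<lambda>n. prob (?A n)) \<longlonglongrightarrow> prob (\<Union>n. ?A n)"
    by (rule finite_Lim_measure_incseq) (auto simp: incseq_def)
  also have "(\<Union>n. ?A n) = space M" using real_arch_simple by auto
  finally have "(\<lambda>n. prob (?A n)) \<longlonglongrightarrow> 1" by (simp add: prob_space)
  then have "\<forall>\<^sub>F n in sequentially. prob (?A n) > 1 - \<epsilon>"
    by (rule order_tendstoD) (use \<open>\<epsilon> > 0\<close> in simp)
  then obtain n where "prob (?A n) > 1 - \<epsilon>" by (auto simp: eventually_sequentially)
  then have "prob (space M - ?A n) \<le> \<epsilon>" by (subst prob_compl) auto
  then show ?thesis by (intro that[of "real n"]) auto
qed

section \<open>Expansions in the given basis\<close>

locale real_onb =
  fixes e :: "nat \<Rightarrow> real^3^3 \<Rightarrow> real"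
  assumes onb: "real_onb_SO3 e"
begin

abbreviation ce :: "nat \<Rightarrow> real^3^3 \<Rightarrow> complex" where "ce k g \<equiv> complex_of_real (e k g)"

lemma e_L2: "sq_integrable haar_SO3 (ce k)"
  using onb by (simp add: real_onb_SO3_def)

lemma e_measurable [measurable]: "e k \<in> borel_measurable haar_SO3"
proof -
  have [measurable]: "ce k \<in> borel_measurable haar_SO3" by (rule sq_integrable_measurable[OF e_L2])
  have "(\<lambda>g. Re (ce k g)) \<in> borel_measurable haar_SO3" by measurable
  then show ?thesis by simp
qed

lemma e_ortho: "l2ip haar_SO3 (ce i) (ce j) = of_bool (i = j)"
proof -
  have "(\<integral>g. e i g * e j g \<partial>haar_SO3) = of_bool (i = j)" using onb by (simp add: real_onb_SO3_def)
  then have "complex_of_real (\<integral>g. e i g * e j g \<partial>haar_SO3) = of_bool (i = j)" by simp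
  then show ?thesis unfolding l2ip_def by (simp flip: integral_complex_of_real)
qed

definition coef :: "(real^3^3 \<Rightarrow> complex) \<Rightarrow> nat \<Rightarrow> complex" where
  "coef \<phi> k = (\<integral>g. \<phi> g * ce k g \<partial>haar_SO3)"

lemma coef_ip: "coef \<phi> k = l2ip haar_SO3 \<phi> (ce k)"
  by (simp add: coef_def l2ip_def)

lemma partial_L2: "sq_integrable haar_SO3 (\<lambda>g. \<Sum>k<n. \<alpha> k * ce k g)"
  by (intro sq_integrable_sum sq_integrable_scale e_L2)

lemma partial_ip: "l2ip haar_SO3 (\<lambda>g. \<Sum>k<n. \<alpha> k * ce k g) (ce j) = (if j < n then \<alpha> j else 0)"
  by (subst l2ip_sum_left) (auto simp: sq_integrable_scale e_L2 l2ip_scale_left e_ortho of_bool_def if_distrib cong: if_cong)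

lemma partial_norm: "l2sq haar_SO3 (\<lambda>g. \<Sum>k<n. \<alpha> k * ce k g) = (\<Sum>k<n. (norm (\<alpha> k))\<^sup>2)"
proof -
  have "complex_of_real (l2sq haar_SO3 (\<lambda>g. \<Sum>k<n. \<alpha> k * ce k g)) = (\<Sum>j<n. cnj (\<alpha> j) * \<alpha> j)"
    unfolding l2ip_self[symmetric]
    by (subst l2ip_sum_right) (auto simp: sq_integrable_scale e_L2 partial_L2 l2ip_scale_right partial_ip)
  also have "\<dots> = of_real (\<Sum>k<n. (norm (\<alpha> k))\<^sup>2)"
    by (simp add: complex_norm_square mult.commute flip: of_real_power)
  finally show ?thesis by (simp only: of_real_eq_iff)
qed

lemma L2_sums_iff:
  assumes "sq_integrable haar_SO3 \<phi>"
  shows "L2_sums haar_SO3 (\<lambda>k g. \<alpha> k * ce k g) \<phi> \<longleftrightarrow> (\<lambda>n. l2sq haar_SO3 (\<lambda>g. \<phi> g - (\<Sum>k<n. \<alpha> k * ce k g))) \<longlonglongrightarrow> 0"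
  unfolding L2_sums_def
  by (subst nn_integral_l2sq[OF sq_integrable_diff[OF assms partial_L2]])
     (auto simp: tendsto_ennreal_iff[of _ _ 0, simplified])

text \<open>\<open>white_noise\<close> quantifies the coefficients existentially; their uniqueness
  ties every version of the noise to the same sequence.\<close>

lemma L2_sums_coef:
  assumes \<phi>: "sq_integrable haar_SO3 \<phi>" and \<alpha>: "L2_sums haar_SO3 (\<lambda>k g. \<alpha> k * ce k g) \<phi>"
  shows "\<alpha> j = coef \<phi> j"
proof -
  let ?S = "\<lambda>n g. \<Sum>k<n. \<alpha> k * ce k g"
  have "(\<lambda>n. l2ip haar_SO3 (\<lambda>g. \<phi> g - ?S n g) (ce j)) \<longlonglongrightarrow> 0"
  proof (rule Lim_null_comparison)
    have "l2sq haar_SO3 (ce j) = 1" using e_ortho[of j j] unfolding l2ip_self by simp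
    then show "\<forall>\<^sub>F n in sequentially. norm (l2ip haar_SO3 (\<lambda>g. \<phi> g - ?S n g) (ce j)) \<le> sqrt (l2sq haar_SO3 (\<lambda>g. \<phi> g - ?S n g))"
      using l2ip_cs[OF sq_integrable_diff[OF \<phi> partial_L2] e_L2[of j]] by simp
    show "(\<lambda>n. sqrt (l2sq haar_SO3 (\<lambda>g. \<phi> g - ?S n g))) \<longlonglongrightarrow> 0"
      using tendsto_real_sqrt[OF \<alpha>[unfolded L2_sums_iff[OF \<phi>]]] by simp
  qed
  moreover have "\<forall>\<^sub>F n in sequentially. l2ip haar_SO3 (\<lambda>g. \<phi> g - ?S n g) (ce j) = coef \<phi> j - \<alpha> j"
    by (rule eventually_sequentiallyI[of "Suc j"])
       (simp add: l2ip_diff_left \<phi> partial_L2 e_L2 partial_ip coef_ip)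
  ultimately have "(\<lambda>n::nat. coef \<phi> j - \<alpha> j) \<longlonglongrightarrow> 0" by (rule Lim_transform_eventually)
  then show ?thesis by (simp add: LIMSEQ_const_iff)
qed

lemma coef_L2_sums:
  assumes \<phi>: "sq_integrable haar_SO3 \<phi>"
  shows "L2_sums haar_SO3 (\<lambda>k g. coef \<phi> k * ce k g) \<phi>"
proof -
  obtain \<alpha> where \<alpha>: "L2_sums haar_SO3 (\<lambda>k g. \<alpha> k * ce k g) \<phi>"
    using onb \<phi> by (auto simp: real_onb_SO3_def)
  moreover have "\<alpha> = coef \<phi>" using L2_sums_coef[OF \<phi> \<alpha>] by auto
  ultimately show ?thesis by simp
qed

lemma parseval:
  assumes \<phi>: "sq_integrable haar_SO3 \<phi>"
  shows "(\<lambda>k. (norm (coef \<phi> k))\<^sup>2) sums l2sq haar_SO3 \<phi>"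
proof -
  let ?S = "\<lambda>n g. \<Sum>k<n. coef \<phi> k * ce k g"
  have "(\<lambda>n. l2sq haar_SO3 (\<lambda>g. ?S n g - \<phi> g)) \<longlonglongrightarrow> 0"
    using coef_L2_sums[OF \<phi>] unfolding L2_sums_iff[OF \<phi>] by (subst l2sq_minus_commute)
  then have "(\<lambda>n. l2sq haar_SO3 (?S n)) \<longlonglongrightarrow> l2sq haar_SO3 \<phi>"
    by (intro l2sq_tendsto partial_L2 \<phi>)
  then show ?thesis by (simp add: sums_def partial_norm)
qed

end

text \<open>The orthogonal projection of L^2 onto spin functions, as an average over
  \<open>K_north\<close>. Basis functions need not be pullbacks of sections; this replaces them by
  spin functions with the same inner products against spin functions.\<close>

definition spin_proj :: "int \<Rightarrow> (real^3^3 \<Rightarrow> complex) \<Rightarrow> real^3^3 \<Rightarrow> complex" where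
  "spin_proj s f g = (\<integral>h. chi s (stab_part h) * f (g ** stab_part h) \<partial>haar_SO3)"

lemma stab_part_measurable [measurable]: "stab_part \<in> measurable haar_SO3 haar_SO3"
  unfolding measurable_haar_iff stab_part_def by measurable

lemma chi_stab_measurable [measurable]: "(\<lambda>h. chi s (stab_part h)) \<in> borel_measurable haar_SO3"
proof -
  have [measurable]: "stab_part \<in> borel_measurable haar_SO3"
    using stab_part_measurable unfolding measurable_haar_iff by (rule measurable_SO3_borel)
  have [measurable]: "(\<lambda>h. zk (stab_part h)) \<in> borel_measurable haar_SO3" unfolding zk_def Complex_eq by measurable
  have "chi s (stab_part h) = (if s \<ge> 0 then zk (stab_part h) ^ nat s else inverse (zk (stab_part h)) ^ nat (- s))"
    if "h \<in> space haar_SO3" for h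
    using that stab_part_K by (simp add: chi_powi power_int_def)
  moreover have "(\<lambda>h. if s \<ge> 0 then zk (stab_part h) ^ nat s else inverse (zk (stab_part h)) ^ nat (- s)) \<in> borel_measurable haar_SO3"
    by measurable
  ultimately show ?thesis by (subst measurable_cong)
qed

lemma spin_proj_spin:
  assumes [measurable]: "f \<in> borel_measurable haar_SO3"
  shows "spin_fun s (spin_proj s f)"
  unfolding spin_fun_def
proof (intro ballI)
  fix g k assume g: "g \<in> SO3" and k: "k \<in> K_north"
  have kS: "k \<in> SO3" by (rule K_north_SO3[OF k])
  have [measurable]: "g \<in> space haar_SO3" using g by simp
  \<comment> \<open>Commutativity of \<open>K_north\<close> lets \<open>k\<close> be absorbed, so
    that \<open>stab_part h\<close> becomes \<open>stab_part (h ** k)\<close>.\<close>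
  have "spin_proj s f (g ** k) = (\<integral>h. cnj (chi s k) * (chi s (stab_part (h ** k)) * f (g ** stab_part (h ** k))) \<partial>haar_SO3)"
    unfolding spin_proj_def
  proof (rule Bochner_Integration.integral_cong)
    fix h assume "h \<in> space haar_SO3"
    then have h: "stab_part h \<in> K_north" by (simp add: stab_part_K)
    have "cnj (chi s k) * (chi s (stab_part h) * chi s k) = chi s (stab_part h) * (cnj (chi s k) * chi s k)"
      by (simp only: mult_ac)
    then have "cnj (chi s k) * chi s (stab_part (h ** k)) = chi s (stab_part h)"
      using h k by (simp add: stab_part_mult chi_mult chi_cnj_mult)
    moreover have "g ** k ** stab_part h = g ** stab_part (h ** k)"
      using K_north_commute[OF k h] by (simp add: stab_part_mult k matrix_mul_assoc[symmetric])
    ultimately show "chi s (stab_part h) * f (g ** k ** stab_part h)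
        = cnj (chi s k) * (chi s (stab_part (h ** k)) * f (g ** stab_part (h ** k)))"
      by (simp flip: mult.assoc)
  qed simp
  also have "\<dots> = cnj (chi s k) * (\<integral>h. chi s (stab_part (h ** k)) * f (g ** stab_part (h ** k)) \<partial>haar_SO3)"
    by (rule Bochner_Integration.integral_mult_right_zero)
  also have "(\<integral>h. chi s (stab_part (h ** k)) * f (g ** stab_part (h ** k)) \<partial>haar_SO3) = spin_proj s f g"
    unfolding spin_proj_def using kS
    by (intro haar.integral_preserving[where f = "\<lambda>h. chi s (stab_part h) * f (g ** stab_part h)"] distr_haar_right) measurable
  finally show "spin_proj s f (g ** k) = cnj (chi s k) * spin_proj s f g" .
qed

section \<open>Finite second moment of the random section\<close>

lemma chi_stab_norm: "h \<in> SO3 \<Longrightarrow> norm (chi s (stab_part h)) = 1"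
  by (simp add: chi_norm stab_part_K)

lemma measure_haar [simp]: "measure haar_SO3 SO3 = 1"
  using haar.prob_space by simp

lemma emeasure_haar [simp]: "emeasure haar_SO3 SO3 = 1"
  using haar.emeasure_space_1 by simp

lemma right_stab_preserving:
  assumes "h \<in> SO3"
  shows "(\<lambda>g. g ** stab_part h) \<in> measurable haar_SO3 haar_SO3"
    "distr haar_SO3 haar_SO3 (\<lambda>g. g ** stab_part h) = haar_SO3"
proof -
  have "stab_part h \<in> SO3" by (intro K_north_SO3 stab_part_K assms)
  then show "distr haar_SO3 haar_SO3 (\<lambda>g. g ** stab_part h) = haar_SO3" by (rule distr_haar_right)
  have [measurable]: "stab_part h \<in> space haar_SO3" using \<open>stab_part h \<in> SO3\<close> by simp
  show "(\<lambda>g. g ** stab_part h) \<in> measurable haar_SO3 haar_SO3" by measurable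
qed

lemma spin_proj_measurable [measurable]:
  assumes [measurable]: "f \<in> borel_measurable haar_SO3"
  shows "spin_proj s f \<in> borel_measurable haar_SO3"
  unfolding spin_proj_def by measurable

lemma spin_proj_L2:
  assumes f: "sq_integrable haar_SO3 f"
  shows "sq_integrable haar_SO3 (spin_proj s f)"
proof -
  interpret HH: pair_sigma_finite haar_SO3 haar_SO3 by (rule haar.pair_closed)
  note [measurable] = sq_integrable_measurable[OF f]
  \<comment> \<open>The function along the stabiliser may fail to be square integrable for some
    \<open>g\<close>; the bound is then trivial because its right side is infinite.\<close>
  have pt: "ennreal ((norm (spin_proj s f g))\<^sup>2) \<le> (\<integral>\<^sup>+h. ennreal ((norm (f (g ** stab_part h)))\<^sup>2) \<partial>haar_SO3)"
    if g: "g \<in> SO3" for g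
  proof (cases "sq_integrable haar_SO3 (\<lambda>h. f (g ** stab_part h))")
    case True
    have c: "sq_integrable haar_SO3 (\<lambda>h. chi s (stab_part h))"
      by (rule sq_integrable_bounded_by[of haar_SO3 "\<lambda>_. 1"]) (auto simp: chi_stab_norm)
    have "l2sq haar_SO3 (\<lambda>h. chi s (stab_part h)) = (\<integral>h. 1 \<partial>haar_SO3)"
      unfolding l2sq_def by (rule Bochner_Integration.integral_cong) (auto simp: chi_stab_norm)
    then have "l2sq haar_SO3 (\<lambda>h. chi s (stab_part h)) = 1" by (simp add: haar.prob_space)
    then have "(norm (spin_proj s f g))\<^sup>2 \<le> l2sq haar_SO3 (\<lambda>h. f (g ** stab_part h))"
      using l2_cs[OF c True] by (simp add: spin_proj_def)
    then show ?thesis unfolding nn_integral_l2sq[OF True] by (rule ennreal_leI)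
  next
    case False
    have [measurable]: "g \<in> space haar_SO3" using g by simp
    have "(\<lambda>h. f (g ** stab_part h)) \<in> borel_measurable haar_SO3" by measurable
    with False have "(\<integral>\<^sup>+h. ennreal ((norm (f (g ** stab_part h)))\<^sup>2) \<partial>haar_SO3) = \<infinity>"
      by (auto simp: sq_integrable_iff_nn less_top[symmetric])
    then show ?thesis by simp
  qed
  have "(\<integral>\<^sup>+g. ennreal ((norm (spin_proj s f g))\<^sup>2) \<partial>haar_SO3)
      \<le> (\<integral>\<^sup>+g. \<integral>\<^sup>+h. ennreal ((norm (f (g ** stab_part h)))\<^sup>2) \<partial>haar_SO3 \<partial>haar_SO3)"
    by (rule nn_integral_mono) (use pt in simp)
  also have "\<dots> = (\<integral>\<^sup>+h. \<integral>\<^sup>+g. ennreal ((norm (f (g ** stab_part h)))\<^sup>2) \<partial>haar_SO3 \<partial>haar_SO3)"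
    by (rule HH.Fubini'[symmetric]) measurable
  also have "\<dots> = (\<integral>\<^sup>+h. ennreal (l2sq haar_SO3 f) \<partial>haar_SO3)"
  proof (rule nn_integral_cong)
    fix h assume "h \<in> space haar_SO3"
    then have "h \<in> SO3" by simp
    note p = right_stab_preserving[OF this]
    show "(\<integral>\<^sup>+g. ennreal ((norm (f (g ** stab_part h)))\<^sup>2) \<partial>haar_SO3) = ennreal (l2sq haar_SO3 f)"
      unfolding nn_integral_l2sq[OF f, symmetric]
      by (rule haar.nn_integral_preserving[OF p, of "\<lambda>x. ennreal ((norm (f x))\<^sup>2)"]) measurable
  qed
  also have "\<dots> < \<infinity>" by simp
  finally show ?thesis by (auto simp: sq_integrable_iff_nn)
qed

text \<open>Equivariance of \<open>V\<close> absorbs the character, and right invariance then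
  removes the stabiliser element from \<open>f\<close>.\<close>

lemma spin_proj_ip:
  assumes V: "sq_integrable haar_SO3 V" "spin_fun s V" and f: "sq_integrable haar_SO3 f"
  shows "l2ip haar_SO3 V (spin_proj s f) = l2ip haar_SO3 V f"
proof -
  interpret HH: pair_sigma_finite haar_SO3 haar_SO3 by (rule haar.pair_closed)
  note [measurable] = sq_integrable_measurable[OF f] sq_integrable_measurable[OF V(1)]
  have shift: "sq_integrable haar_SO3 (\<lambda>g. f (g ** stab_part h))" "l2sq haar_SO3 (\<lambda>g. f (g ** stab_part h)) = l2sq haar_SO3 f"
    if "h \<in> SO3" for h
    using haar.sq_integrable_preserving[OF right_stab_preserving[OF that] f]
      haar.l2sq_preserving[OF right_stab_preserving[OF that], of f] by auto
  have int: "integrable (haar_SO3 \<Otimes>\<^sub>M haar_SO3) (\<lambda>(h, g). V g * cnj (chi s (stab_part h) * f (g ** stab_part h)))"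
  proof (rule HH.integrable_pair_bound[where b = "\<lambda>_. sqrt (l2sq haar_SO3 V * l2sq haar_SO3 f)"])
    fix h assume "h \<in> space haar_SO3"
    then have h: "h \<in> SO3" by simp
    have "integrable haar_SO3 (\<lambda>g. V g * cnj (chi s (stab_part h) * f (g ** stab_part h)))"
      by (intro integrable_l2ip V(1) sq_integrable_scale shift(1) h)
    then show "integrable haar_SO3 (\<lambda>g. case (h, g) of (h, g) \<Rightarrow> V g * cnj (chi s (stab_part h) * f (g ** stab_part h)))"
      by simp
    have "(\<integral>g. norm (V g) * norm (f (g ** stab_part h)) \<partial>haar_SO3) \<le> sqrt (l2sq haar_SO3 V * l2sq haar_SO3 f)"
      using l2sq_cs_norm[OF V(1) shift(1)[OF h]] unfolding shift(2)[OF h] by (rule real_le_rsqrt)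
    then show "(\<integral>g. norm (case (h, g) of (h, g) \<Rightarrow> V g * cnj (chi s (stab_part h) * f (g ** stab_part h))) \<partial>haar_SO3)
        \<le> sqrt (l2sq haar_SO3 V * l2sq haar_SO3 f)"
      using h by (simp add: norm_mult chi_stab_norm)
  qed measurable
  have "l2ip haar_SO3 V (spin_proj s f) = (\<integral>g. \<integral>h. V g * cnj (chi s (stab_part h) * f (g ** stab_part h)) \<partial>haar_SO3 \<partial>haar_SO3)"
    unfolding l2ip_def spin_proj_def
    by (simp only: Bochner_Integration.integral_cnj[symmetric] Bochner_Integration.integral_mult_right_zero[symmetric])
  also have "\<dots> = (\<integral>h. \<integral>g. V g * cnj (chi s (stab_part h) * f (g ** stab_part h)) \<partial>haar_SO3 \<partial>haar_SO3)"
    using HH.Fubini_integral[OF int] by simp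
  also have "\<dots> = (\<integral>h. l2ip haar_SO3 V f \<partial>haar_SO3)"
  proof (rule Bochner_Integration.integral_cong)
    fix h assume "h \<in> space haar_SO3"
    then have h: "h \<in> SO3" by simp
    have "(\<integral>g. V g * cnj (chi s (stab_part h) * f (g ** stab_part h)) \<partial>haar_SO3)
        = (\<integral>g. V (g ** stab_part h) * cnj (f (g ** stab_part h)) \<partial>haar_SO3)"
      by (rule Bochner_Integration.integral_cong) (use V(2) stab_part_K[OF h] in \<open>simp_all add: spin_fun_def\<close>)
    also have "\<dots> = l2ip haar_SO3 V f"
      unfolding l2ip_def
      by (rule haar.integral_preserving[OF right_stab_preserving[OF h], of "\<lambda>g. V g * cnj (f g)"]) measurable
    finally show "(\<integral>g. V g * cnj (chi s (stab_part h) * f (g ** stab_part h)) \<partial>haar_SO3) = l2ip haar_SO3 V f" .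
  qed simp
  finally show ?thesis by (simp add: haar.prob_space)
qed

section \<open>Rotation of sections\<close>

lemma L2_sectionI:
  assumes u: "\<And>g. g \<in> SO3 \<Longrightarrow> u (g *v north) = theta s g (U g)" and U: "sq_integrable haar_SO3 U"
  shows "L2_section s u" "\<And>g. g \<in> SO3 \<Longrightarrow> pullback s u g = U g"
proof -
  show "\<And>g. g \<in> SO3 \<Longrightarrow> pullback s u g = U g" by (rule pullback_eqI) (auto simp: u)
  have [measurable]: "U \<in> borel_measurable haar_SO3" using U by auto
  have "is_section s u"
    unfolding is_section_def
  proof (intro ballI)
    fix x assume "x \<in> S2"
    then have "u x = theta s (pole_lift x) (U (pole_lift x))" "pole_lift x *v north = x"
      using u[OF pole_lift_SO3, of x] by (simp_all add: pole_lift_north)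
    then show "u x \<in> spin_bundle s \<and> bundle_proj (u x) = x"
      by (simp add: theta_in_bundle pole_lift_SO3 bundle_proj_theta)
  qed
  moreover have "u \<in> measurable S2_measure (bundle_borel s)"
    by (rule S2_fun_measurable[where f = "\<lambda>g. theta s g (U g)", OF u]) measurable
  moreover have "(\<integral>\<^sup>+x. ennreal ((fiber_norm s (u x))\<^sup>2) \<partial>S2_measure) = (\<integral>\<^sup>+g. ennreal ((norm (U g))\<^sup>2) \<partial>haar_SO3)"
    by (rule S2_nn_integral) (auto simp: u fiber_norm_theta)
  ultimately show "L2_section s u"
    using U by (simp add: L2_section_def sq_integrable_iff_nn)
qed

lemma translate_preserving:
  assumes "h \<in> SO3"
  shows "(\<lambda>g. h ** g) \<in> measurable haar_SO3 haar_SO3" "distr haar_SO3 haar_SO3 (\<lambda>g. h ** g) = haar_SO3"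
    "(\<lambda>g. g ** h) \<in> measurable haar_SO3 haar_SO3" "distr haar_SO3 haar_SO3 (\<lambda>g. g ** h) = haar_SO3"
proof -
  have [measurable]: "h \<in> space haar_SO3" using assms by simp
  show "(\<lambda>g. h ** g) \<in> measurable haar_SO3 haar_SO3" "(\<lambda>g. g ** h) \<in> measurable haar_SO3 haar_SO3" by measurable
qed (simp_all add: distr_haar_left distr_haar_right assms)

lemma L2_section_act:
  assumes u: "L2_section s u" and h: "h \<in> SO3"
  shows "L2_section s (section_act h u)"
    and "\<And>g. g \<in> SO3 \<Longrightarrow> pullback s (section_act h u) g = pullback s u (matrix_inv h ** g)"
proof -
  have 1: "section_act h u (g *v north) = theta s g (pullback s u (matrix_inv h ** g))" if "g \<in> SO3" for g
    using section_act_pullback[OF _ h that] u by (simp add: L2_section_def)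
  have 2: "sq_integrable haar_SO3 (\<lambda>g. pullback s u (matrix_inv h ** g))"
    by (rule haar.sq_integrable_preserving[OF translate_preserving(1,2)[OF SO3_inv[OF h]] L2_section_pullback(1)[OF u]])
  show "L2_section s (section_act h u)"
    "\<And>g. g \<in> SO3 \<Longrightarrow> pullback s (section_act h u) g = pullback s u (matrix_inv h ** g)"
    using L2_sectionI[OF 1 2] by auto
qed

locale gaussian_spin_section = spin_random_section M s T + real_onb e
  for M :: "'w measure" and s :: int and T :: "real^3 \<Rightarrow> 'w \<Rightarrow> bundle_point" and e :: "nat \<Rightarrow> real^3^3 \<Rightarrow> real" +
  assumes s: "s \<noteq> 0"
    and sq: "sq_integrable_random_section s M T"
    and iso: "isotropic s M T"
    and gauss: "complex_gaussian_section s M T"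
begin

lemma path_L2: "AE \<omega> in M. sq_integrable haar_SO3 (\<lambda>g. X g \<omega>)"
  using sq[unfolded sq_integrable_random_section_def] AE_space
proof eventually_elim
  case (elim \<omega>)
  have "(\<lambda>g. X g \<omega>) \<in> borel_measurable haar_SO3" using elim(2) by measurable
  then show ?case using elim by (simp add: sq_integrable_iff_nn path_norm)
qed

text \<open>Sections whose pairings with \<open>T\<close> are the coefficients of the path in the
  basis \<open>e\<close>, so that Parseval expresses the path norm by countably many Gaussian
  variables.\<close>

definition test_section :: "nat \<Rightarrow> real^3 \<Rightarrow> bundle_point" where
  "test_section k = sec_of s (spin_proj s (ce k))"

lemma test_section_L2: "L2_section s (test_section k)"
  unfolding test_section_def by (intro L2_section_sec_of spin_proj_L2 e_L2 spin_proj_spin) measurable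

lemma pairing_test:
  assumes \<omega>: "\<omega> \<in> space M" and L2: "sq_integrable haar_SO3 (\<lambda>g. X g \<omega>)"
  shows "pairing s T (test_section k) \<omega> = coef (\<lambda>g. X g \<omega>) k"
proof -
  have "pairing s T (test_section k) \<omega> = (\<integral>g. X g \<omega> * cnj (pullback s (test_section k) g) \<partial>haar_SO3)"
    by (rule pairing_eq[OF \<omega> test_section_L2])
  also have "\<dots> = l2ip haar_SO3 (\<lambda>g. X g \<omega>) (spin_proj s (ce k))"
    unfolding l2ip_def test_section_def
    by (rule Bochner_Integration.integral_cong) (auto simp: pullback_sec_of spin_proj_spin)
  also have "\<dots> = l2ip haar_SO3 (\<lambda>g. X g \<omega>) (ce k)"
    using \<omega> by (intro spin_proj_ip L2 e_L2) (simp add: spin_fun_def X_spin)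
  finally show ?thesis by (simp add: coef_ip)
qed

lemma pairing_gaussian: "L2_section s u \<Longrightarrow> complex_gaussian_var M (pairing s T u)"
  using gauss by (simp add: complex_gaussian_section_def)

lemma pairing_L2: "L2_section s u \<Longrightarrow> sq_integrable M (pairing s T u)"
  by (rule complex_gaussian_moments(1)[OF pairing_gaussian])

lemma path_norm_sum:
  "AE \<omega> in M. ennreal (l2sq haar_SO3 (\<lambda>g. X g \<omega>)) = (\<Sum>k. ennreal ((norm (pairing s T (test_section k) \<omega>))\<^sup>2))"
  using path_L2 AE_space
proof eventually_elim
  case (elim \<omega>)
  have "(\<lambda>k. (norm (pairing s T (test_section k) \<omega>))\<^sup>2) sums l2sq haar_SO3 (\<lambda>g. X g \<omega>)"
    using parseval[OF elim(1)] by (simp add: pairing_test[OF elim(2,1)])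
  then show ?case by (intro suminf_ennreal_eq[symmetric]) auto
qed

lemma path_norm_measurable [measurable]: "(\<lambda>\<omega>. l2sq haar_SO3 (\<lambda>g. X g \<omega>)) \<in> borel_measurable M"
  unfolding l2sq_def by measurable

text \<open>The path norm is at most some \<open>c\<close> on an event \<open>A\<close> of
  probability at least 23/24. \<open>gaussian_truncation\<close> applies to all coefficients with
  this same \<open>A\<close>; summing, the second moment is at most twice its part on
  \<open>A\<close>, hence at most \<open>2 * c\<close>.\<close>

lemma second_moment: "integrable M (\<lambda>\<omega>. l2sq haar_SO3 (\<lambda>g. X g \<omega>))"
proof -
  let ?Z = "\<lambda>\<omega>. l2sq haar_SO3 (\<lambda>g. X g \<omega>)"
  let ?Y = "\<lambda>k. pairing s T (test_section k)"
  note [measurable] = pairing_measurable[OF test_section_L2]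
  obtain c where c: "c \<ge> 0" "prob (space M - {\<omega>\<in>space M. ?Z \<omega> \<le> c}) \<le> 1/24"
    using bounded_event[OF path_norm_measurable, of "1/24"] by auto
  define A where "A = {\<omega>\<in>space M. ?Z \<omega> \<le> c}"
  have A [measurable]: "A \<in> events" unfolding A_def by measurable
  have tr: "(\<integral>\<^sup>+\<omega>. ennreal ((norm (?Y k \<omega>))\<^sup>2) \<partial>M) \<le> 2 * (\<integral>\<^sup>+\<omega>. indicator A \<omega> * ennreal ((norm (?Y k \<omega>))\<^sup>2) \<partial>M)" for k
  proof -
    have "integrable M (\<lambda>\<omega>. indicator A \<omega> * (norm (?Y k \<omega>))\<^sup>2)"
      by (rule Bochner_Integration.integrable_bound[OF sq_integrableD[OF pairing_L2[OF test_section_L2[of k]]]])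
         (auto split: split_indicator)
    then have "(\<integral>\<^sup>+\<omega>. ennreal (indicator A \<omega> * (norm (?Y k \<omega>))\<^sup>2) \<partial>M) = ennreal (\<integral>\<omega>. indicator A \<omega> * (norm (?Y k \<omega>))\<^sup>2 \<partial>M)"
      by (rule nn_integral_eq_integral) auto
    moreover have "ennreal (indicator A \<omega> * (norm (?Y k \<omega>))\<^sup>2) = indicator A \<omega> * ennreal ((norm (?Y k \<omega>))\<^sup>2)" for \<omega>
      by (simp split: split_indicator)
    moreover have "ennreal (l2sq M (?Y k)) \<le> ennreal (2 * (\<integral>\<omega>. indicator A \<omega> * (norm (?Y k \<omega>))\<^sup>2 \<partial>M))"
      using gaussian_truncation[OF pairing_gaussian[OF test_section_L2] A] c(2) by (intro ennreal_leI) (simp add: A_def)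
    ultimately show ?thesis
      unfolding nn_integral_l2sq[OF pairing_L2[OF test_section_L2]] by (simp add: ennreal_mult)
  qed
  have "(\<integral>\<^sup>+\<omega>. ennreal (?Z \<omega>) \<partial>M) = (\<integral>\<^sup>+\<omega>. (\<Sum>k. ennreal ((norm (?Y k \<omega>))\<^sup>2)) \<partial>M)"
    by (rule nn_integral_cong_AE[OF path_norm_sum])
  also have "\<dots> = (\<Sum>k. \<integral>\<^sup>+\<omega>. ennreal ((norm (?Y k \<omega>))\<^sup>2) \<partial>M)"
    by (rule nn_integral_suminf) measurable
  also have "\<dots> \<le> (\<Sum>k. 2 * (\<integral>\<^sup>+\<omega>. indicator A \<omega> * ennreal ((norm (?Y k \<omega>))\<^sup>2) \<partial>M))"
    by (intro suminf_le tr summableI)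
  also have "\<dots> = 2 * (\<integral>\<^sup>+\<omega>. (\<Sum>k. indicator A \<omega> * ennreal ((norm (?Y k \<omega>))\<^sup>2)) \<partial>M)"
    by (subst nn_integral_suminf) measurable
  also have "(\<integral>\<^sup>+\<omega>. (\<Sum>k. indicator A \<omega> * ennreal ((norm (?Y k \<omega>))\<^sup>2)) \<partial>M) = (\<integral>\<^sup>+\<omega>. indicator A \<omega> * ennreal (?Z \<omega>) \<partial>M)"
  proof (rule nn_integral_cong_AE, use path_norm_sum in eventually_elim)
    case (elim \<omega>)
    then show ?case by simp
  qed
  also have "(\<integral>\<^sup>+\<omega>. indicator A \<omega> * ennreal (?Z \<omega>) \<partial>M) \<le> (\<integral>\<^sup>+\<omega>. ennreal c \<partial>M)"
    by (rule nn_integral_mono) (auto simp: A_def ennreal_leI split: split_indicator)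
  also have "2 * (\<integral>\<^sup>+\<omega>. ennreal c \<partial>M) < \<infinity>" by (simp add: emeasure_space_1 ennreal_mult_less_top)
  finally have "(\<integral>\<^sup>+\<omega>. ennreal (?Z \<omega>) \<partial>M) < \<infinity>" by (simp add: mult_left_mono)
  then show ?thesis by (intro integrableI_bounded) auto
qed

end

section \<open>Covariance of an isotropic Gaussian section\<close>

text \<open>Right translation by an element with character \<open>\<i>\<close> multiplies the
  integral by \<open>-\<i>\<close>.\<close>

lemma spin_fun_integral_zero:
  assumes U: "sq_integrable haar_SO3 U" "spin_fun s U" and s: "s \<noteq> 0"
  shows "(\<integral>g. U g \<partial>haar_SO3) = 0"
proof -
  obtain k where k: "k \<in> K_north" "chi s k = \<i>" using chi_imaginary_unit[OF s] .
  note p = translate_preserving(3,4)[OF K_north_SO3[OF k(1)]]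
  have "(\<integral>g. U g \<partial>haar_SO3) = (\<integral>g. U (g ** k) \<partial>haar_SO3)"
    using U(1) by (intro haar.integral_preserving[OF p, symmetric]) auto
  also have "\<dots> = (\<integral>g. - \<i> * U g \<partial>haar_SO3)"
    by (rule Bochner_Integration.integral_cong) (use U(2) k in \<open>simp_all add: spin_fun_def\<close>)
  also have "\<dots> = - \<i> * (\<integral>g. U g \<partial>haar_SO3)" by (rule Bochner_Integration.integral_mult_right_zero)
  finally have "(\<integral>g. U g \<partial>haar_SO3) - (- \<i> * (\<integral>g. U g \<partial>haar_SO3)) = 0" by (simp only: right_minus_eq)
  then have "(1 + \<i>) * (\<integral>g. U g \<partial>haar_SO3) = 0" by (simp add: algebra_simps)
  moreover have "1 + \<i> \<noteq> 0" by (simp add: complex_eq_iff)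
  ultimately show ?thesis by simp
qed

lemma distr_eq_integrals:
  assumes "Y \<in> borel_measurable M" "Y' \<in> borel_measurable M" "distr M borel Y = distr M borel Y'"
  shows "(\<integral>x. Y x \<partial>M) = (\<integral>x. (Y' x :: complex) \<partial>M)" "l2sq M Y = l2sq M Y'"
proof -
  have I: "(\<integral>x. f (Y x) \<partial>M) = (\<integral>x. f (Y' x) \<partial>M)" if "f \<in> borel_measurable borel"
    for f :: "complex \<Rightarrow> 'b::{banach, second_countable_topology}"
    using integral_distr[OF assms(1) that] integral_distr[OF assms(2) that] assms(3) by simp
  show "(\<integral>x. Y x \<partial>M) = (\<integral>x. Y' x \<partial>M)" by (rule I) simp
  show "l2sq M Y = l2sq M Y'" unfolding l2sq_def by (rule I) simp
qed

context gaussian_spin_section begin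

abbreviation HM :: "((real^3^3) \<times> 'w) measure" where "HM \<equiv> haar_SO3 \<Otimes>\<^sub>M M"

text \<open>The first component of the sample is the random rotation. The conjugate makes
  \<open>v = cnj U\<close> the partner of \<open>Z\<close> in the pairing and gives
  \<open>phi\<close> the character \<open>chi s\<close> on both sides.\<close>

definition Z :: "real^3^3 \<Rightarrow> (real^3^3) \<times> 'w \<Rightarrow> complex" where
  "Z x p = cnj (X (fst p ** x) (snd p))"

definition phi :: "real^3^3 \<Rightarrow> complex" where
  "phi x = l2ip HM (Z x) (Z (mat 1))"

definition C :: real where "C = (\<integral>\<omega>. l2sq haar_SO3 (\<lambda>g. X g \<omega>) \<partial>M)"

lemma Z_joint: "(\<lambda>(x, p). Z x p) \<in> borel_measurable (haar_SO3 \<Otimes>\<^sub>M HM)"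
  unfolding Z_def by measurable

lemma Z_raw [measurable (raw)]:
  "f \<in> measurable N haar_SO3 \<Longrightarrow> f' \<in> measurable N HM \<Longrightarrow> (\<lambda>x. Z (f x) (f' x)) \<in> borel_measurable N"
  using measurable_compose[OF measurable_Pair Z_joint, of f N f'] by (simp only: prod.case)

lemma Z_sq:
  assumes g: "g \<in> SO3"
  shows "sq_integrable HM (Z g)" "l2sq HM (Z g) = C"
proof -
  interpret HM: pair_sigma_finite haar_SO3 M ..
  have [measurable]: "g \<in> space haar_SO3" using g by simp
  have m: "Z g \<in> borel_measurable HM" using Z_raw[of "\<lambda>_. g" HM "\<lambda>p. p"] by simp
  have "(\<integral>\<^sup>+p. ennreal ((norm (Z g p))\<^sup>2) \<partial>HM) = (\<integral>\<^sup>+\<omega>. \<integral>\<^sup>+k. ennreal ((norm (Z g (k, \<omega>)))\<^sup>2) \<partial>haar_SO3 \<partial>M)"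
    by (rule HM.nn_integral_snd[symmetric]) (use m in measurable)
  also have "\<dots> = (\<integral>\<^sup>+\<omega>. ennreal (l2sq haar_SO3 (\<lambda>g. X g \<omega>)) \<partial>M)"
  proof (rule nn_integral_cong_AE, use path_L2 AE_space in eventually_elim)
    case (elim \<omega>)
    have [measurable]: "(\<lambda>k. X k \<omega>) \<in> borel_measurable haar_SO3" using elim(1) by auto
    show ?case
      unfolding nn_integral_l2sq[OF elim(1), symmetric] Z_def
      using haar.nn_integral_preserving[OF translate_preserving(3,4)[OF g], of "\<lambda>k. ennreal ((norm (X k \<omega>))\<^sup>2)"]
      by simp
  qed
  also have "\<dots> = ennreal C" unfolding C_def by (rule nn_integral_eq_integral[OF second_moment]) simp
  finally have *: "(\<integral>\<^sup>+p. ennreal ((norm (Z g p))\<^sup>2) \<partial>HM) = ennreal C" .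
  then show sq: "sq_integrable HM (Z g)" using m by (simp add: sq_integrable_iff_nn)
  have "0 \<le> C" unfolding C_def by (rule Bochner_Integration.integral_nonneg) simp
  then show "l2sq HM (Z g) = C" using * unfolding nn_integral_l2sq[OF sq] by simp
qed

text \<open>Shifting the random rotation by \<open>h\<close> on the right carries the pair
  \<open>matrix_inv h ** g\<close>, \<open>mat 1\<close> to the pair \<open>g\<close>,
  \<open>h\<close>.\<close>

lemma Z_cov:
  assumes g: "g \<in> SO3" and h: "h \<in> SO3"
  shows "l2ip HM (Z g) (Z h) = phi (matrix_inv h ** g)"
proof -
  interpret HM: pair_sigma_finite haar_SO3 M ..
  let ?g = "matrix_inv h ** g"
  have g': "?g \<in> SO3" by (intro SO3_mult SO3_inv g h)
  have it: "l2ip HM (Z a) (Z b) = (\<integral>\<omega>. \<integral>k. Z a (k, \<omega>) * cnj (Z b (k, \<omega>)) \<partial>haar_SO3 \<partial>M)"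
    if "a \<in> SO3" "b \<in> SO3" for a b
    unfolding l2ip_def
    using HM.integral_snd[of "\<lambda>k \<omega>. Z a (k, \<omega>) * cnj (Z b (k, \<omega>))"] integrable_l2ip[OF Z_sq(1) Z_sq(1), OF that]
    by (simp add: case_prod_unfold)
  have "(\<integral>k. Z g (k, \<omega>) * cnj (Z h (k, \<omega>)) \<partial>haar_SO3) = (\<integral>k. Z ?g (k, \<omega>) * cnj (Z (mat 1) (k, \<omega>)) \<partial>haar_SO3)"
    if \<omega>: "\<omega> \<in> space M" for \<omega>
  proof -
    have [measurable]: "?g \<in> space haar_SO3" "mat 1 \<in> space haar_SO3" using g' SO3_one by simp_all
    have "(\<integral>k. Z ?g (k ** h, \<omega>) * cnj (Z (mat 1) (k ** h, \<omega>)) \<partial>haar_SO3) = (\<integral>k. Z ?g (k, \<omega>) * cnj (Z (mat 1) (k, \<omega>)) \<partial>haar_SO3)"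
      by (rule haar.integral_preserving[OF translate_preserving(3,4)[OF h], of "\<lambda>k. Z ?g (k, \<omega>) * cnj (Z (mat 1) (k, \<omega>))"])
         (use \<omega> in \<open>unfold Z_def fst_conv snd_conv, measurable\<close>)
    moreover have "Z ?g (k ** h, \<omega>) = Z g (k, \<omega>)" "Z (mat 1) (k ** h, \<omega>) = Z h (k, \<omega>)" for k
      by (simp_all add: Z_def matrix_mul_assoc[symmetric] SO3_inv_cancel h)
    ultimately show ?thesis by simp
  qed
  from Bochner_Integration.integral_cong[of M M, OF refl this] show ?thesis
    unfolding phi_def it[OF g h] it[OF g' SO3_one] .
qed

lemma phi_measurable: "phi \<in> borel_measurable haar_SO3"
proof -
  have [measurable]: "mat 1 \<in> space haar_SO3" using SO3_one by simp
  interpret HM: pair_prob_space haar_SO3 M ..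
  show ?thesis unfolding phi_def l2ip_def by measurable
qed

sublocale field: stationary_field haar_SO3 "(**)" matrix_inv "mat 1" HM Z phi C
proof -
  interpret HM: pair_prob_space haar_SO3 M ..
  show "stationary_field haar_SO3 (**) matrix_inv (mat 1) HM Z phi C"
    by unfold_locales (simp_all add: Z_joint Z_sq Z_cov phi_measurable)
qed

lemma law_invariant:
  assumes u: "L2_section s u" and g: "g \<in> SO3"
  shows "distr M borel (pairing s T u) = distr M borel (pairing s T (section_act g u))"
proof -
  have e: "distr M borel (pairing s T v) = distr (joint_law s M T 1 (\<lambda>_. v)) borel (\<lambda>x. x 0)"
    if v: "L2_section s v" for v
  proof -
    note [measurable] = pairing_measurable[OF v]
    have "distr (joint_law s M T 1 (\<lambda>_. v)) borel (\<lambda>x. x 0)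
        = distr M borel ((\<lambda>x. x 0) \<circ> (\<lambda>\<omega>. \<lambda>i\<in>{..<1::nat}. pairing s T v \<omega>))"
      unfolding joint_law_def by (rule distr_distr) (measurable; simp)+
    then show ?thesis by (simp add: o_def)
  qed
  have "joint_law s M T 1 (\<lambda>_. u) = joint_law s M T 1 (\<lambda>_. section_act g u)"
    using iso[unfolded isotropic_def, rule_format, OF g, of 1 "\<lambda>_. u"] u by simp
  then show ?thesis by (simp only: e[OF u] e[OF L2_section_act(1)[OF u g]])
qed

text \<open>For a fixed rotation \<open>k\<close>, integrating against \<open>Z\<close> amounts to
  pairing \<open>T\<close> with the section rotated by \<open>k\<close>. Through this identity
  isotropy acts on the auxiliary field.\<close>

lemma pairing_act:
  assumes u: "L2_section s u" and k: "k \<in> SO3" and \<omega>: "\<omega> \<in> space M"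
  shows "pairing s T (section_act k u) \<omega> = (\<integral>g. cnj (pullback s u g) * cnj (Z g (k, \<omega>)) \<partial>haar_SO3)"
proof -
  note [measurable] = sq_integrable_measurable[OF L2_section_pullback(1)[OF u]]
  have [measurable]: "matrix_inv k \<in> space haar_SO3" using SO3_inv[OF k] by simp
  have "pairing s T (section_act k u) \<omega> = (\<integral>g. X g \<omega> * cnj (pullback s (section_act k u) g) \<partial>haar_SO3)"
    by (rule pairing_eq[OF \<omega> L2_section_act(1)[OF u k]])
  also have "\<dots> = (\<integral>g. X g \<omega> * cnj (pullback s u (matrix_inv k ** g)) \<partial>haar_SO3)"
    by (rule Bochner_Integration.integral_cong) (auto simp: L2_section_act(2)[OF u k])
  also have "\<dots> = (\<integral>g. X (k ** g) \<omega> * cnj (pullback s u (matrix_inv k ** (k ** g))) \<partial>haar_SO3)"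
    by (rule haar.integral_preserving[OF translate_preserving(1,2)[OF k], symmetric,
          of "\<lambda>g. X g \<omega> * cnj (pullback s u (matrix_inv k ** g))"]) (use \<omega> in measurable)
  also have "\<dots> = (\<integral>g. cnj (pullback s u g) * cnj (Z g (k, \<omega>)) \<partial>haar_SO3)"
    by (simp add: SO3_inv_cancel k Z_def mult.commute)
  finally show ?thesis .
qed

text \<open>Each inner integral over \<open>M\<close> is the second moment of a rotated pairing,
  which by isotropy does not depend on \<open>k\<close>.\<close>

lemma pairing_variance:
  assumes u: "L2_section s u"
  shows "(\<integral>p. (norm (\<integral>g. cnj (pullback s u g) * cnj (Z g p) \<partial>haar_SO3))\<^sup>2 \<partial>HM) = l2sq M (pairing s T u)"
proof -
  interpret HM: pair_sigma_finite haar_SO3 M ..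
  have v: "sq_integrable haar_SO3 (\<lambda>g. cnj (pullback s u g))" using L2_section_pullback(1)[OF u] by simp
  let ?J = "\<lambda>p. \<integral>g. cnj (pullback s u g) * cnj (Z g p) \<partial>haar_SO3"
  have "(\<integral>p. (norm (?J p))\<^sup>2 \<partial>HM) = (\<integral>k. \<integral>\<omega>. (norm (?J (k, \<omega>)))\<^sup>2 \<partial>M \<partial>haar_SO3)"
    using HM.integral_fst'[OF field.form_integrable(1)[OF v]] by simp
  also have "\<dots> = (\<integral>k. l2sq M (pairing s T u) \<partial>haar_SO3)"
  proof (rule Bochner_Integration.integral_cong)
    fix k assume "k \<in> space haar_SO3"
    then have k: "k \<in> SO3" by simp
    have "(\<integral>\<omega>. (norm (?J (k, \<omega>)))\<^sup>2 \<partial>M) = l2sq M (pairing s T (section_act k u))"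
      unfolding l2sq_def by (rule Bochner_Integration.integral_cong) (simp_all add: pairing_act[OF u k])
    also have "\<dots> = l2sq M (pairing s T u)"
      by (rule distr_eq_integrals(2)[OF pairing_measurable pairing_measurable law_invariant[symmetric]])
         (auto intro: u k L2_section_act)
    finally show "(\<integral>\<omega>. (norm (?J (k, \<omega>)))\<^sup>2 \<partial>M) = l2sq M (pairing s T u)" .
  qed simp
  finally show ?thesis by simp
qed

text \<open>Averaging over \<open>k\<close> makes the mean of \<open>Z\<close> constant in
  \<open>g\<close>. The mean of the pairing thus becomes a multiple of the conjugate integral of a
  spin function, which is zero.\<close>

lemma pairing_mean:
  assumes u: "L2_section s u"
  shows "(\<integral>\<omega>. pairing s T u \<omega> \<partial>M) = 0"
proof -
  interpret HM: pair_prob_space haar_SO3 M ..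
  interpret HHM: pair_sigma_finite haar_SO3 HM ..
  let ?U = "pullback s u"
  note UL = L2_section_pullback[OF u]
  note [measurable] = sq_integrable_measurable[OF UL(1)]
  let ?J = "\<lambda>p. \<integral>g. cnj (?U g) * cnj (Z g p) \<partial>haar_SO3"
  have int: "integrable (haar_SO3 \<Otimes>\<^sub>M HM) (\<lambda>(g, p). cnj (?U g) * cnj (Z g p))"
  proof (rule HHM.integrable_pair_bound[where b = "\<lambda>g. sqrt C * norm (?U g)"])
    have one: "sq_integrable HM (\<lambda>_. 1)" "l2sq HM (\<lambda>_. 1) = 1"
      by (simp_all add: sq_integrable_def l2sq_def field.P.prob_space)
    show "integrable haar_SO3 (\<lambda>g. sqrt C * norm (?U g))"
      by (intro integrable_mult_right integrable_norm haar.sq_integrable_integrable UL)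
    fix g assume "g \<in> space haar_SO3"
    then have g: "g \<in> SO3" by simp
    show "integrable HM (\<lambda>p. case (g, p) of (g, p) \<Rightarrow> cnj (?U g) * cnj (Z g p))"
      using integrable_mult_L2[OF Z_sq(1)[OF g] one(1)] by simp
    have "(\<integral>p. norm (Z g p) \<partial>HM) \<le> sqrt C"
      using l2sq_cs_norm[OF Z_sq(1)[OF g] one(1)] unfolding Z_sq(2)[OF g] one(2) by (simp add: real_le_rsqrt)
    from mult_right_mono[OF this norm_ge_zero[of "?U g"]]
    show "(\<integral>p. norm (case (g, p) of (g, p) \<Rightarrow> cnj (?U g) * cnj (Z g p)) \<partial>HM) \<le> sqrt C * norm (?U g)"
      by (simp add: norm_mult mult.commute)
  qed measurable
  have m: "(\<integral>p. cnj (Z g p) \<partial>HM) = (\<integral>p. cnj (Z (mat 1) p) \<partial>HM)" if g: "g \<in> SO3" for g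
  proof -
    have one: "sq_integrable HM (\<lambda>_. 1)" by (simp add: sq_integrable_def)
    have it: "(\<integral>p. cnj (Z a p) \<partial>HM) = (\<integral>\<omega>. \<integral>k. X (k ** a) \<omega> \<partial>haar_SO3 \<partial>M)" if "a \<in> SO3" for a
      using HM.integral_snd[of "\<lambda>k \<omega>. X (k ** a) \<omega>"] integrable_mult_L2[OF Z_sq(1)[OF that] one]
      by (simp add: case_prod_unfold Z_def)
    have "(\<integral>k. X (k ** g) \<omega> \<partial>haar_SO3) = (\<integral>k. X k \<omega> \<partial>haar_SO3)" if "\<omega> \<in> space M" for \<omega>
      by (rule haar.integral_preserving[OF translate_preserving(3,4)[OF g], of "\<lambda>k. X k \<omega>"]) (use that in measurable)
    from Bochner_Integration.integral_cong[of M M, OF refl this] show ?thesis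
      unfolding it[OF g] it[OF SO3_one] matrix_mul_rid .
  qed
  have "(\<integral>\<omega>. pairing s T u \<omega> \<partial>M) = (\<integral>k. (\<integral>\<omega>. pairing s T u \<omega> \<partial>M) \<partial>haar_SO3)" by simp
  also have "\<dots> = (\<integral>k. \<integral>\<omega>. ?J (k, \<omega>) \<partial>M \<partial>haar_SO3)"
  proof (rule Bochner_Integration.integral_cong)
    fix k assume "k \<in> space haar_SO3"
    then have k: "k \<in> SO3" by simp
    have "(\<integral>\<omega>. pairing s T u \<omega> \<partial>M) = (\<integral>\<omega>. pairing s T (section_act k u) \<omega> \<partial>M)"
      by (rule distr_eq_integrals(1)[OF pairing_measurable pairing_measurable law_invariant])
         (auto intro: u k L2_section_act)
    also have "\<dots> = (\<integral>\<omega>. ?J (k, \<omega>) \<partial>M)"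
      by (rule Bochner_Integration.integral_cong) (simp_all add: pairing_act[OF u k])
    finally show "(\<integral>\<omega>. pairing s T u \<omega> \<partial>M) = (\<integral>\<omega>. ?J (k, \<omega>) \<partial>M)" .
  qed simp
  also have "\<dots> = (\<integral>p. ?J p \<partial>HM)"
    using HM.integral_fst'[OF HHM.integrable_snd[OF int]] by simp
  also have "\<dots> = (\<integral>g. (\<integral>p. cnj (?U g) * cnj (Z g p) \<partial>HM) \<partial>haar_SO3)"
    using HHM.Fubini_integral[OF int] by simp
  also have "\<dots> = (\<integral>g. cnj (?U g) * (\<integral>p. cnj (Z (mat 1) p) \<partial>HM) \<partial>haar_SO3)"
    by (rule Bochner_Integration.integral_cong) (simp_all add: m del: Bochner_Integration.integral_cnj)
  also have "\<dots> = cnj (\<integral>g. ?U g \<partial>haar_SO3) * (\<integral>p. cnj (Z (mat 1) p) \<partial>HM)"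
    by (simp only: Bochner_Integration.integral_mult_left_zero Bochner_Integration.integral_cnj)
  also have "\<dots> = 0" using spin_fun_integral_zero[OF UL s] by simp
  finally show ?thesis .
qed

text \<open>Centred real and imaginary parts of common variance \<open>\<sigma>^2\<close> give the
  second moment \<open>2 * \<sigma>^2\<close>, and the Gaussian exponent
  \<open>\<sigma>^2 / 2\<close> is a quarter of it.\<close>

lemma pairing_char:
  assumes u: "L2_section s u"
  shows "(\<integral>\<omega>. exp (\<i> * of_real (Re (pairing s T u \<omega>))) \<partial>M) = exp (- of_real (l2sq M (pairing s T u) / 4))"
proof -
  let ?Y = "pairing s T u"
  obtain a b \<sigma> where Y [measurable]: "?Y \<in> borel_measurable M"
    and re: "distr M borel (\<lambda>\<omega>. Re (?Y \<omega>)) = gaussian_law a \<sigma>"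
    and im: "distr M borel (\<lambda>\<omega>. Im (?Y \<omega>)) = gaussian_law b \<sigma>"
    using pairing_gaussian[OF u] by (auto simp: complex_gaussian_var_def)
  have "(\<lambda>\<omega>. Re (?Y \<omega>)) \<in> borel_measurable M" "(\<lambda>\<omega>. Im (?Y \<omega>)) \<in> borel_measurable M" by measurable
  note R = gaussian_law_facts[OF this(1) re] and I = gaussian_law_facts[OF this(2) im]
  have "integrable M ?Y"
    using integrable_mult_L2[OF pairing_L2[OF u], of "\<lambda>_. 1"] by (simp add: sq_integrable_def)
  then have "a = 0" "b = 0"
    using R(2) I(2) integral_Re[of M ?Y] integral_Im[of M ?Y] pairing_mean[OF u] by auto
  moreover have "l2sq M ?Y = (a\<^sup>2 + \<sigma>\<^sup>2) + (b\<^sup>2 + \<sigma>\<^sup>2)"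
    using R(3,4) I(3,4) by (simp add: l2sq_def cmod_power2)
  ultimately have "l2sq M ?Y / 4 = \<sigma>\<^sup>2 / 2" by simp
  then show ?thesis using R(7) \<open>a = 0\<close> by simp
qed

text \<open>Equivariance of \<open>X\<close> concerns right multiplication only. Stationarity moves
  \<open>k\<close> to the second argument of the covariance, where it acts on the right.\<close>

lemma phi_left: assumes k: "k \<in> K_north" and g: "g \<in> SO3" shows "phi (k ** g) = chi s k * phi g"
proof -
  let ?k = "matrix_inv k"
  have k': "?k \<in> K_north" "?k \<in> SO3" by (auto intro: K_north_inv K_north_SO3 k)
  have "phi (k ** g) = l2ip HM (Z g) (Z ?k)"
    using Z_cov[OF g k'(2)] by (simp add: SO3_inv_inv K_north_SO3 k)
  also have "\<dots> = l2ip HM (Z g) (\<lambda>p. chi s ?k * Z (mat 1) p)"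
    by (rule l2ip_cong) (auto simp: space_pair_measure Z_def X_spin k' SO3_mult)
  also have "\<dots> = chi s k * phi g" by (simp add: l2ip_scale_right chi_inv_cnj k phi_def)
  finally show ?thesis .
qed

lemma phi_right: assumes k: "k \<in> K_north" and g: "g \<in> SO3" shows "phi (g ** k) = chi s k * phi g"
proof -
  have "phi (g ** k) = l2ip HM (\<lambda>p. chi s k * Z g p) (Z (mat 1))"
    unfolding phi_def by (rule l2ip_cong) (auto simp: space_pair_measure Z_def X_spin k g SO3_mult matrix_mul_assoc)
  then show ?thesis by (simp add: l2ip_scale_left phi_def)
qed

theorem root_exists:
  obtains f where "sq_integrable haar_SO3 f" "bi_associated s f"
    "\<And>u. L2_section s u \<Longrightarrow> l2sq haar_SO3 (haar.conv (\<lambda>g. cnj (pullback s u g)) f) = l2sq M (pairing s T u)"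
proof -
  obtain f where f: "sq_integrable haar_SO3 f"
    and form: "\<And>v. sq_integrable haar_SO3 v \<Longrightarrow> l2sq haar_SO3 (haar.conv v f) = (\<integral>p. (norm (\<integral>g. v g * cnj (Z g p) \<partial>haar_SO3))\<^sup>2 \<partial>HM)"
    and eq: "\<And>k1 k2 c1 c2 g. k1 \<in> space haar_SO3 \<Longrightarrow> k2 \<in> space haar_SO3 \<Longrightarrow> g \<in> space haar_SO3 \<Longrightarrow> c1 \<noteq> 0 \<Longrightarrow> c2 \<noteq> 0 \<Longrightarrow>
      (\<And>g. g \<in> space haar_SO3 \<Longrightarrow> phi (k1 ** g) = c1 * phi g) \<Longrightarrow> (\<And>g. g \<in> space haar_SO3 \<Longrightarrow> phi (g ** k2) = c2 * phi g) \<Longrightarrow>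
      f (k1 ** g ** k2) = c1 * c2 * f g"
    apply (rule field.square_root)
    subgoal premises p for f by (rule p(1)) (fact p)+
    done
  have "bi_associated s f"
    unfolding bi_associated_def
  proof (intro ballI)
    fix g k1 k2 assume "g \<in> SO3" and k: "k1 \<in> K_north" "k2 \<in> K_north"
    then have "f (k1 ** g ** k2) = chi s k1 * chi s k2 * f g"
      by (intro eq) (auto simp: chi_nonzero phi_left phi_right intro: K_north_SO3)
    then show "f (k1 ** g ** k2) = chi s k1 * f g * chi s k2" by (simp add: mult_ac)
  qed
  with f show ?thesis
    using form L2_section_pullback(1) pairing_variance by (intro that[of f]) auto
qed

text \<open>The test pairings vanish almost surely, and the squared path norm is the sum of their
  squares. In contrapositive form this separates \<open>f\<close> from \<open>-f\<close> for a
  nontrivial \<open>T\<close>.\<close>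

lemma degenerate:
  assumes "\<And>u. L2_section s u \<Longrightarrow> l2sq M (pairing s T u) = 0"
  shows "AE \<omega> in M. AE x in S2_measure. fiber_norm s (T x \<omega>) = 0"
proof -
  have "AE \<omega> in M. pairing s T (test_section k) \<omega> = 0" for k
  proof -
    note L = pairing_L2[OF test_section_L2[of k]]
    have "AE \<omega> in M. (norm (pairing s T (test_section k) \<omega>))\<^sup>2 = 0"
      using assms[OF test_section_L2[of k]] unfolding l2sq_def
      by (subst (asm) integral_nonneg_eq_0_iff_AE[OF sq_integrableD[OF L]]) auto
    then show ?thesis by eventually_elim simp
  qed
  then have "AE \<omega> in M. \<forall>k. pairing s T (test_section k) \<omega> = 0" by (simp add: AE_all_countable)
  then show ?thesis using path_norm_sum path_L2 AE_space
  proof eventually_elim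
    case (elim \<omega>)
    have [measurable]: "(\<lambda>g. X g \<omega>) \<in> borel_measurable haar_SO3" using elim(3) by auto
    have "(\<integral>\<^sup>+x. ennreal ((fiber_norm s (T x \<omega>))\<^sup>2) \<partial>S2_measure) = 0"
      using elim by (simp add: path_norm nn_integral_l2sq)
    moreover have "(\<lambda>x. ennreal ((fiber_norm s (T x \<omega>))\<^sup>2)) \<in> borel_measurable S2_measure"
      by (rule S2_fun_measurable[where f = "\<lambda>g. ennreal ((norm (X g \<omega>))\<^sup>2)"])
         (use elim(4) in \<open>simp_all add: X_theta fiber_norm_theta\<close>)
    ultimately have "AE x in S2_measure. ennreal ((fiber_norm s (T x \<omega>))\<^sup>2) = 0"
      by (subst (asm) nn_integral_0_iff_AE) auto
    then show ?case by eventually_elim (simp add: ennreal_eq_0_iff)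
  qed
qed

end

section \<open>White noise fields\<close>

lemma char_gaussian_law: "char (gaussian_law 0 \<sigma>) t = of_real (exp (- ((t * \<sigma>)\<^sup>2) / 2))"
proof -
  have "char (gaussian_law 0 \<sigma>) t = (\<integral>x. iexp (t * (0 + \<sigma> * x)) \<partial>std_normal_distribution)"
    unfolding char_def gaussian_law_def by (rule integral_distr) auto
  also have "\<dots> = char std_normal_distribution (t * \<sigma>)" by (simp add: char_def mult.assoc)
  finally show ?thesis by (simp add: char_std_normal_distribution)
qed

lemma real_distribution_gaussian_law: "real_distribution (gaussian_law a \<sigma>)"
proof -
  interpret S: real_distribution std_normal_distribution by (rule real_dist_normal_dist)
  show ?thesis unfolding gaussian_law_def by (intro S.real_distribution_distr) simp
qed

lemma iexp_lipschitz: "norm (exp (\<i> * of_real a) - exp (\<i> * of_real b)) \<le> \<bar>a - b\<bar>"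
proof -
  have "exp (\<i> * of_real a) - exp (\<i> * of_real b) = exp (\<i> * of_real b) * (exp (\<i> * of_real (a - b)) - 1)"
    by (simp add: right_diff_distrib exp_add[symmetric])
  then have "norm (exp (\<i> * of_real a) - exp (\<i> * of_real b)) = norm (iexp (a - b) - 1)"
    by (simp only: norm_mult norm_exp_i_times mult_1)
  also have "\<dots> \<le> \<bar>a - b\<bar>" using iexp_approx1[of "a - b" 0] by simp
  finally show ?thesis .
qed

text \<open>The right side may be infinite, so the inequality can be integrated over the sample
  space before \<open>d\<close> is known to be square integrable. The delicate case is
  \<open>v = 0\<close> almost everywhere, where the right side is 0 times infinity and the left side
  vanishes too.\<close>

lemma l2_nn_cs:
  assumes v: "sq_integrable M v" and d: "d \<in> borel_measurable M"
  shows "ennreal ((norm (\<integral>x. v x * d x \<partial>M))\<^sup>2) \<le> ennreal (l2sq M v) * (\<integral>\<^sup>+x. ennreal ((norm (d x))\<^sup>2) \<partial>M)"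
proof (cases "sq_integrable M d")
  case True
  show ?thesis
    unfolding nn_integral_l2sq[OF True] ennreal_mult[symmetric, OF l2sq_nonneg l2sq_nonneg]
    by (rule ennreal_leI[OF l2_cs[OF v True]])
next
  case False
  then have top: "(\<integral>\<^sup>+x. ennreal ((norm (d x))\<^sup>2) \<partial>M) = top"
    using d by (auto simp: sq_integrable_iff_nn less_top[symmetric])
  show ?thesis
  proof (cases "l2sq M v = 0")
    case True
    then have "AE x in M. (norm (v x))\<^sup>2 = 0"
      unfolding l2sq_def by (subst (asm) integral_nonneg_eq_0_iff_AE[OF sq_integrableD[OF v]]) auto
    then have "AE x in M. v x * d x = 0" by eventually_elim simp
    then have "(\<integral>x. v x * d x \<partial>M) = 0" by (rule integral_eq_zero_AE)
    then show ?thesis by simp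
  next
    case False
    then show ?thesis using l2sq_nonneg[of M v] by (simp add: top ennreal_mult_top less_le)
  qed
qed

locale gaussian_noise = real_onb e + N: prob_space N
  for e :: "nat \<Rightarrow> real^3^3 \<Rightarrow> real" and N :: "'v measure" +
  fixes \<xi> :: "nat \<Rightarrow> 'v \<Rightarrow> real"
  assumes \<xi>: "iid_std_normal N \<xi>"
begin

lemma \<xi>_measurable [measurable]: "\<xi> k \<in> borel_measurable N"
proof -
  have "distributed N lborel (\<xi> k) std_normal_density" using \<xi> by (simp add: iid_std_normal_def)
  then show ?thesis by (auto simp: distributed_def)
qed

lemma \<xi>_law: "distr N borel (\<xi> k) = std_normal_distribution"
proof -
  have "distributed N lborel (\<xi> k) std_normal_density" using \<xi> by (simp add: iid_std_normal_def)
  then have "distr N lborel (\<xi> k) = std_normal_distribution" by (simp add: distributed_def)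
  then show ?thesis by (metis distr_cong sets_lborel)
qed

lemma combination_law:
  assumes "finite S"
  shows "distr N borel (\<lambda>\<omega>. \<Sum>k\<in>S. b k * \<xi> k \<omega>) = gaussian_law 0 (sqrt (\<Sum>k\<in>S. (b k)\<^sup>2))"
proof (rule Levy_uniqueness)
  show "real_distribution (distr N borel (\<lambda>\<omega>. \<Sum>k\<in>S. b k * \<xi> k \<omega>))"
    by (rule N.real_distribution_distr) measurable
  show "char (distr N borel (\<lambda>\<omega>. \<Sum>k\<in>S. b k * \<xi> k \<omega>)) = char (gaussian_law 0 (sqrt (\<Sum>k\<in>S. (b k)\<^sup>2)))"
  proof
    fix t
    have "N.indep_vars (\<lambda>_. borel) \<xi> S"
      using \<xi> N.indep_vars_subset[of "\<lambda>_. borel" \<xi> UNIV S] by (simp add: iid_std_normal_def)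
    then have "N.indep_vars (\<lambda>_. borel) (\<lambda>k \<omega>. b k * \<xi> k \<omega>) S"
      by (rule N.indep_vars_compose2) simp
    then have "char (distr N borel (\<lambda>\<omega>. \<Sum>k\<in>S. b k * \<xi> k \<omega>)) t = (\<Prod>k\<in>S. char (distr N borel (\<lambda>\<omega>. b k * \<xi> k \<omega>)) t)"
      by (rule N.char_distr_sum)
    also have "\<dots> = (\<Prod>k\<in>S. of_real (exp (- ((t * b k)\<^sup>2) / 2)))"
    proof (rule prod.cong)
      fix k
      have "char (distr N borel (\<lambda>\<omega>. b k * \<xi> k \<omega>)) t = (\<integral>\<omega>. iexp (t * b k * \<xi> k \<omega>) \<partial>N)"
        unfolding char_def by (subst integral_distr) (auto simp: mult.assoc)
      also have "\<dots> = char (distr N borel (\<xi> k)) (t * b k)"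
        unfolding char_def by (subst integral_distr) auto
      finally show "char (distr N borel (\<lambda>\<omega>. b k * \<xi> k \<omega>)) t = of_real (exp (- ((t * b k)\<^sup>2) / 2))"
        by (simp add: \<xi>_law char_std_normal_distribution)
    qed simp
    also have "\<dots> = of_real (exp (\<Sum>k\<in>S. - ((t * b k)\<^sup>2) / 2))" by (simp add: exp_sum assms)
    also have "(\<Sum>k\<in>S. - ((t * b k)\<^sup>2) / 2) = - ((t * sqrt (\<Sum>k\<in>S. (b k)\<^sup>2))\<^sup>2) / 2"
      by (simp add: power_mult_distrib sum_nonneg sum_distrib_left sum_negf sum_divide_distrib)
    finally show "char (distr N borel (\<lambda>\<omega>. \<Sum>k\<in>S. b k * \<xi> k \<omega>)) t = char (gaussian_law 0 (sqrt (\<Sum>k\<in>S. (b k)\<^sup>2))) t"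
      by (simp add: char_gaussian_law)
  qed
qed (rule real_distribution_gaussian_law)

lemma combination_facts:
  assumes "finite S"
  shows "integrable N (\<lambda>\<omega>. (\<Sum>k\<in>S. b k * \<xi> k \<omega>)\<^sup>2)" "(\<integral>\<omega>. (\<Sum>k\<in>S. b k * \<xi> k \<omega>)\<^sup>2 \<partial>N) = (\<Sum>k\<in>S. (b k)\<^sup>2)"
    and "(\<integral>\<omega>. exp (\<i> * of_real (\<Sum>k\<in>S. b k * \<xi> k \<omega>)) \<partial>N) = of_real (exp (- (\<Sum>k\<in>S. (b k)\<^sup>2) / 2))"
proof -
  have m: "(\<lambda>\<omega>. \<Sum>k\<in>S. b k * \<xi> k \<omega>) \<in> borel_measurable N" by measurable
  note G = gaussian_law_facts[OF m combination_law[OF assms]]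
  show "integrable N (\<lambda>\<omega>. (\<Sum>k\<in>S. b k * \<xi> k \<omega>)\<^sup>2)" by (rule G(3))
  show "(\<integral>\<omega>. (\<Sum>k\<in>S. b k * \<xi> k \<omega>)\<^sup>2 \<partial>N) = (\<Sum>k\<in>S. (b k)\<^sup>2)" using G(4) by (simp add: sum_nonneg)
  have "(\<integral>\<omega>. exp (\<i> * of_real (\<Sum>k\<in>S. b k * \<xi> k \<omega>)) \<partial>N) = exp (of_real (- (\<Sum>k\<in>S. (b k)\<^sup>2) / 2))"
    unfolding G(7) by (simp add: sum_nonneg)
  then show "(\<integral>\<omega>. exp (\<i> * of_real (\<Sum>k\<in>S. b k * \<xi> k \<omega>)) \<partial>N) = of_real (exp (- (\<Sum>k\<in>S. (b k)\<^sup>2) / 2))"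
    by (simp only: exp_of_real)
qed

abbreviation c\<xi> :: "nat \<Rightarrow> 'v \<Rightarrow> complex" where "c\<xi> k \<omega> \<equiv> complex_of_real (\<xi> k \<omega>)"

lemma noise_sum:
  assumes "finite S"
  shows "sq_integrable N (\<lambda>\<omega>. \<Sum>k\<in>S. \<alpha> k * c\<xi> k \<omega>)" "l2sq N (\<lambda>\<omega>. \<Sum>k\<in>S. \<alpha> k * c\<xi> k \<omega>) = (\<Sum>k\<in>S. (norm (\<alpha> k))\<^sup>2)"
proof -
  have n: "(norm (\<Sum>k\<in>S. \<alpha> k * c\<xi> k \<omega>))\<^sup>2 = (\<Sum>k\<in>S. Re (\<alpha> k) * \<xi> k \<omega>)\<^sup>2 + (\<Sum>k\<in>S. Im (\<alpha> k) * \<xi> k \<omega>)\<^sup>2" for \<omega>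
    by (simp add: cmod_power2)
  show "sq_integrable N (\<lambda>\<omega>. \<Sum>k\<in>S. \<alpha> k * c\<xi> k \<omega>)"
    unfolding sq_integrable_def n by (intro conjI Bochner_Integration.integrable_add combination_facts assms) measurable
  show "l2sq N (\<lambda>\<omega>. \<Sum>k\<in>S. \<alpha> k * c\<xi> k \<omega>) = (\<Sum>k\<in>S. (norm (\<alpha> k))\<^sup>2)"
    unfolding l2sq_def n
    by (subst Bochner_Integration.integral_add) (auto simp: combination_facts assms cmod_power2 sum.distrib)
qed

lemma noise_diff:
  assumes "m \<le> n"
  shows "l2sq N (\<lambda>\<omega>. (\<Sum>k<n. \<alpha> k * c\<xi> k \<omega>) - (\<Sum>k<m. \<alpha> k * c\<xi> k \<omega>)) = (\<Sum>k<n. (norm (\<alpha> k))\<^sup>2) - (\<Sum>k<m. (norm (\<alpha> k))\<^sup>2)"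
proof -
  have sp: "(\<Sum>k<n. a k) - (\<Sum>k<m. a k) = (\<Sum>k=m..<n. a k)" for a :: "nat \<Rightarrow> 'b::ab_group_add"
    using sum_diff_nat_ivl[of 0 m n a] assms by (simp add: lessThan_atLeast0)
  show ?thesis unfolding sp by (rule noise_sum(2)) simp
qed

text \<open>The error of the partial sums is computed exactly, as the tail of the coefficients, by
  passing to the limit in \<open>noise_diff\<close>. It does not depend on the version
  \<open>Y\<close>.\<close>

lemma noise_limit:
  assumes Y: "Y \<in> borel_measurable N" and sums: "L2_sums N (\<lambda>k \<omega>. \<alpha> k * c\<xi> k \<omega>) Y" and a: "(\<lambda>k. (norm (\<alpha> k))\<^sup>2) sums A"
  shows "sq_integrable N Y" "(\<integral>\<^sup>+\<omega>. ennreal ((norm (Y \<omega> - (\<Sum>k<n. \<alpha> k * c\<xi> k \<omega>)))\<^sup>2) \<partial>N) = ennreal (A - (\<Sum>k<n. (norm (\<alpha> k))\<^sup>2))"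
proof -
  let ?S = "\<lambda>n \<omega>. \<Sum>k<n. \<alpha> k * c\<xi> k \<omega>"
  note lim = sums[unfolded L2_sums_def]
  have SL: "sq_integrable N (?S n)" for n by (rule noise_sum) simp
  have "\<forall>\<^sub>F n in sequentially. (\<integral>\<^sup>+\<omega>. ennreal ((norm (Y \<omega> - ?S n \<omega>))\<^sup>2) \<partial>N) < 1"
    by (rule order_tendstoD(2)[OF lim]) simp
  then obtain n0 where "(\<integral>\<^sup>+\<omega>. ennreal ((norm (Y \<omega> - ?S n0 \<omega>))\<^sup>2) \<partial>N) < 1" by (auto simp: eventually_sequentially)
  then have "sq_integrable N (\<lambda>\<omega>. Y \<omega> - ?S n0 \<omega>)"
    using Y by (auto simp: sq_integrable_iff_nn intro: order_less_trans)
  from sq_integrable_add[OF this SL[of n0]] show YL: "sq_integrable N Y" by simp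
  have "(\<lambda>m. l2sq N (\<lambda>\<omega>. ?S m \<omega> - Y \<omega>)) \<longlonglongrightarrow> 0"
    using lim unfolding nn_integral_l2sq[OF sq_integrable_diff[OF YL SL]]
    by (subst l2sq_minus_commute) (simp add: tendsto_ennreal_iff[of _ _ 0, simplified])
  then have "(\<lambda>m. l2sq N (\<lambda>\<omega>. (?S m \<omega> - ?S n \<omega>) - (Y \<omega> - ?S n \<omega>))) \<longlonglongrightarrow> 0" by simp
  then have 1: "(\<lambda>m. l2sq N (\<lambda>\<omega>. ?S m \<omega> - ?S n \<omega>)) \<longlonglongrightarrow> l2sq N (\<lambda>\<omega>. Y \<omega> - ?S n \<omega>)"
    by (intro l2sq_tendsto sq_integrable_diff YL SL)
  have "(\<lambda>m. (\<Sum>k<m. (norm (\<alpha> k))\<^sup>2) - (\<Sum>k<n. (norm (\<alpha> k))\<^sup>2)) \<longlonglongrightarrow> A - (\<Sum>k<n. (norm (\<alpha> k))\<^sup>2)"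
    using a by (intro tendsto_intros) (simp add: sums_def)
  then have 2: "(\<lambda>m. l2sq N (\<lambda>\<omega>. ?S m \<omega> - ?S n \<omega>)) \<longlonglongrightarrow> A - (\<Sum>k<n. (norm (\<alpha> k))\<^sup>2)"
    by (rule Lim_transform_eventually) (rule eventually_sequentiallyI[of n], simp add: noise_diff)
  show "(\<integral>\<^sup>+\<omega>. ennreal ((norm (Y \<omega> - ?S n \<omega>))\<^sup>2) \<partial>N) = ennreal (A - (\<Sum>k<n. (norm (\<alpha> k))\<^sup>2))"
    unfolding nn_integral_l2sq[OF sq_integrable_diff[OF YL SL]] LIMSEQ_unique[OF 1 2] ..
qed

end

section \<open>The random section of a kernel\<close>

locale noise_field = gaussian_noise e N \<xi>
  for e :: "nat \<Rightarrow> real^3^3 \<Rightarrow> real" and N :: "'v measure" and \<xi> :: "nat \<Rightarrow> 'v \<Rightarrow> real" +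
  fixes s :: int and f :: "real^3^3 \<Rightarrow> complex"
  assumes f_L2: "sq_integrable haar_SO3 f" and f_bi: "bi_associated s f"
begin

lemma f_measurable [measurable]: "f \<in> borel_measurable haar_SO3"
  using f_L2 by auto

definition amp :: "real^3^3 \<Rightarrow> nat \<Rightarrow> complex" where
  "amp g = coef (left_translate g f)"

lemma translate_L2:
  assumes "g \<in> SO3"
  shows "sq_integrable haar_SO3 (left_translate g f)" "l2sq haar_SO3 (left_translate g f) = l2sq haar_SO3 f"
  unfolding left_translate_def
  using haar.sq_integrable_preserving[OF translate_preserving(1,2)[OF SO3_inv[OF assms]] f_L2]
    haar.l2sq_preserving[OF translate_preserving(1,2)[OF SO3_inv[OF assms]] f_measurable] by auto

lemma amp_sums: "g \<in> SO3 \<Longrightarrow> (\<lambda>k. (norm (amp g k))\<^sup>2) sums l2sq haar_SO3 f"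
  using parseval[OF translate_L2(1)] translate_L2(2) by (simp add: amp_def)

lemma amp_measurable [measurable]: "(\<lambda>g. amp g k) \<in> borel_measurable haar_SO3"
  unfolding amp_def coef_def left_translate_def by measurable

lemma amp_spin:
  assumes g: "g \<in> SO3" and k: "k \<in> K_north"
  shows "amp (g ** k) j = cnj (chi s k) * amp g j"
proof -
  have "left_translate (g ** k) f h = cnj (chi s k) * left_translate g f h" if h: "h \<in> SO3" for h
  proof -
    have "matrix_inv (g ** k) ** h = matrix_inv k ** (matrix_inv g ** h) ** mat 1"
      by (simp add: SO3_inv_prod g K_north_SO3 k matrix_mul_assoc)
    then show ?thesis
      using f_bi[unfolded bi_associated_def, rule_format, OF SO3_mult[OF SO3_inv[OF g] h] K_north_inv[OF k] K_north_one]
      by (simp add: left_translate_def chi_inv k chi_one)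
  qed
  then have "amp (g ** k) j = (\<integral>h. cnj (chi s k) * (left_translate g f h * ce j h) \<partial>haar_SO3)"
    unfolding amp_def coef_def by (intro Bochner_Integration.integral_cong) auto
  then show ?thesis by (simp add: amp_def coef_def)
qed

text \<open>This tail in Parseval's identity is, by \<open>noise_limit\<close>, also the squared
  error of the partial sums of the noise at \<open>g\<close>.\<close>

definition tail :: "real^3^3 \<Rightarrow> nat \<Rightarrow> real" where
  "tail g n = l2sq haar_SO3 f - (\<Sum>k<n. (norm (amp g k))\<^sup>2)"

lemma tail_measurable [measurable]: "(\<lambda>g. tail g n) \<in> borel_measurable haar_SO3"
  unfolding tail_def by measurable

lemma tail_nonneg: "g \<in> SO3 \<Longrightarrow> 0 \<le> tail g n"
  using sum_le_suminf[OF sums_summable[OF amp_sums], of g "{..<n}"] sums_unique[OF amp_sums, of g] by (simp add: tail_def)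

lemma tail_lim: "g \<in> SO3 \<Longrightarrow> (\<lambda>n. tail g n) \<longlonglongrightarrow> 0"
proof -
  assume g: "g \<in> SO3"
  have "(\<lambda>n. tail g n) \<longlonglongrightarrow> l2sq haar_SO3 f - l2sq haar_SO3 f"
    unfolding tail_def by (intro tendsto_diff tendsto_const amp_sums[OF g, unfolded sums_def])
  then show ?thesis by simp
qed

definition cut :: "nat \<Rightarrow> real^3^3 \<Rightarrow> nat" where
  "cut j g = (LEAST n. tail g n \<le> (1/4)^j)"

lemma cut_measurable [measurable]: "cut j \<in> measurable haar_SO3 (count_space UNIV)"
  unfolding cut_def by measurable

lemma tail_cut: assumes "g \<in> SO3" shows "tail g (cut j g) \<le> (1/4)^j"
proof -
  have "\<forall>\<^sub>F n in sequentially. tail g n < (1/4)^j"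
    by (rule order_tendstoD(2)[OF tail_lim[OF assms]]) simp
  then obtain n where "tail g n \<le> (1/4)^j" by (auto simp: eventually_sequentially intro: less_imp_le)
  then show ?thesis unfolding cut_def by (rule LeastI)
qed

lemma cut_mono: assumes "g \<in> SO3" shows "cut j g \<le> cut (Suc j) g"
proof -
  have "tail g (cut (Suc j) g) \<le> (1/4)^j"
    using tail_cut[OF assms, of "Suc j"] tail_nonneg[OF assms, of "cut (Suc j) g"] by simp
  then show ?thesis unfolding cut_def[of j] by (rule Least_le)
qed

definition partial_field :: "nat \<Rightarrow> real^3^3 \<Rightarrow> 'v \<Rightarrow> complex" where
  "partial_field n g \<omega> = (\<Sum>k<n. amp g k * c\<xi> k \<omega>)"

text \<open>For each \<open>g\<close> the series converges fast, hence almost surely, along \<open>cut\<close>, which depends measurably on \<open>g\<close> and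
  only on the coset of \<open>g\<close>.\<close>

definition noise_version :: "real^3^3 \<Rightarrow> 'v \<Rightarrow> complex" where
  "noise_version g \<omega> = climit (\<lambda>j. partial_field (cut j g) g \<omega>)"

lemma partial_field_measurable [measurable (raw)]:
  assumes [measurable]: "G \<in> measurable L haar_SO3" "w \<in> measurable L N"
  shows "(\<lambda>x. partial_field n (G x) (w x)) \<in> borel_measurable L"
proof -
  have [measurable]: "(\<lambda>x. amp (G x) k) \<in> borel_measurable L" for k
    by (rule measurable_compose[OF assms(1) amp_measurable])
  show ?thesis unfolding partial_field_def by measurable
qed

lemma noise_version_measurable [measurable (raw)]:
  assumes [measurable]: "G \<in> measurable L haar_SO3" "w \<in> measurable L N"
  shows "(\<lambda>x. noise_version (G x) (w x)) \<in> borel_measurable L"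
proof -
  have "(\<lambda>x. partial_field (cut j (G x)) (G x) (w x)) \<in> borel_measurable L" for j
  proof (rule measurable_compose_countable[where f = "\<lambda>n x. partial_field n (G x) (w x)" and g = "\<lambda>x. cut j (G x)"])
    show "(\<lambda>x. cut j (G x)) \<in> measurable L (count_space UNIV)"
      by (rule measurable_compose[OF assms(1) cut_measurable])
  qed measurable
  then show ?thesis unfolding noise_version_def by (rule measurable_climit)
qed

lemma noise_version_spin:
  assumes g: "g \<in> SO3" and k: "k \<in> K_north"
  shows "noise_version (g ** k) \<omega> = cnj (chi s k) * noise_version g \<omega>"
proof -
  have "tail (g ** k) n = tail g n" for n
    by (simp add: tail_def amp_spin g k norm_mult chi_norm)
  then have "cut j (g ** k) = cut j g" for j by (simp add: cut_def)
  moreover have "partial_field n (g ** k) \<omega> = cnj (chi s k) * partial_field n g \<omega>" for n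
    by (simp add: partial_field_def amp_spin g k sum_distrib_left mult.assoc)
  ultimately show ?thesis
    using climit_scale[of "cnj (chi s k)" "\<lambda>j. partial_field (cut j g) g \<omega>"] chi_nonzero[OF k]
    by (simp add: noise_version_def)
qed

lemma white_noise_version:
  assumes g: "g \<in> SO3"
  shows "white_noise N e \<xi> (left_translate g f) (noise_version g)"
proof -
  have [measurable]: "g \<in> space haar_SO3" using g by simp
  have m: "noise_version g \<in> borel_measurable N" using noise_version_measurable[of "\<lambda>_. g" N "\<lambda>\<omega>. \<omega>"] by simp
  have PL: "sq_integrable N (partial_field n g)" for n unfolding partial_field_def by (rule noise_sum) simp
  have PD: "l2sq N (\<lambda>\<omega>. partial_field n g \<omega> - partial_field m g \<omega>) = tail g m - tail g n" if "m \<le> n" for m n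
    using noise_diff[OF that, of "amp g"] by (simp add: partial_field_def tail_def)
  have "AE \<omega> in N. convergent (\<lambda>j. partial_field (cut j g) g \<omega>)"
  proof (rule N.AE_convergent_fast[OF PL])
    fix j
    show "l2sq N (\<lambda>\<omega>. partial_field (cut (Suc j) g) g \<omega> - partial_field (cut j g) g \<omega>) \<le> (1/4)^j"
      unfolding PD[OF cut_mono[OF g]] using tail_cut[OF g, of j] tail_nonneg[OF g, of "cut (Suc j) g"] by linarith
  qed
  then have lim: "AE \<omega> in N. (\<lambda>j. partial_field (cut j g) g \<omega>) \<longlonglongrightarrow> noise_version g \<omega>"
    unfolding noise_version_def by eventually_elim (rule tendsto_climit)
  \<comment> \<open>The slack \<open>(1/2)^n\<close> is for the case that \<open>cut j g\<close>
    stays below \<open>n\<close>, where the distance is at most \<open>(1/4)^j\<close>; otherwise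
    \<open>tail g n\<close> is enough.\<close>
  have bound: "(\<integral>\<^sup>+\<omega>. ennreal ((norm (noise_version g \<omega> - partial_field n g \<omega>))\<^sup>2) \<partial>N) \<le> ennreal (tail g n + (1/2)^n)" for n
  proof -
    have "(\<integral>\<^sup>+\<omega>. ennreal ((norm (partial_field n g \<omega> - noise_version g \<omega>))\<^sup>2) \<partial>N) \<le> ennreal (tail g n + (1/2)^n)"
    proof (rule N.l2_Fatou[OF _ _ _ lim])
      have "\<forall>\<^sub>F j in sequentially. (1/4::real)^j < (1/2)^n"
        by (rule order_tendstoD(2)[OF LIMSEQ_power_zero]) auto
      then show "\<forall>\<^sub>F j in sequentially. (\<integral>\<^sup>+\<omega>. ennreal ((norm (partial_field n g \<omega> - partial_field (cut j g) g \<omega>))\<^sup>2) \<partial>N)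
          \<le> ennreal (tail g n + (1/2)^n)"
      proof eventually_elim
        case (elim j)
        have "l2sq N (\<lambda>\<omega>. partial_field n g \<omega> - partial_field (cut j g) g \<omega>) \<le> tail g n + (1/2)^n"
        proof (cases "n \<le> cut j g")
          case True
          have "0 \<le> (1/2::real)^n" by simp
          then show ?thesis unfolding l2sq_minus_commute[of N "partial_field n g"] PD[OF True]
            using tail_nonneg[OF g, of "cut j g"] by linarith
        next
          case False
          then show ?thesis using PD[of "cut j g" n] tail_nonneg[OF g, of n] tail_cut[OF g, of j] elim by simp
        qed
        then show ?case unfolding nn_integral_l2sq[OF sq_integrable_diff[OF PL PL]] by (rule ennreal_leI)
      qed
    qed (use PL m in auto)
    then show ?thesis by (simp add: norm_minus_commute)
  qed
  have "L2_sums N (\<lambda>k \<omega>. amp g k * c\<xi> k \<omega>) (noise_version g)"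
    unfolding L2_sums_def partial_field_def[symmetric]
  proof (rule tendsto_sandwich[OF _ _ tendsto_const])
    have "(\<lambda>n. tail g n + (1/2)^n) \<longlonglongrightarrow> 0 + 0"
      by (intro tendsto_add tail_lim g LIMSEQ_power_zero) simp
    then show "(\<lambda>n. ennreal (tail g n + (1/2)^n)) \<longlonglongrightarrow> 0" using tendsto_ennrealI by fastforce
  qed (use bound in auto)
  moreover have "L2_sums haar_SO3 (\<lambda>k h. amp g k * ce k h) (left_translate g f)"
    unfolding amp_def by (rule coef_L2_sums[OF translate_L2(1)[OF g]])
  ultimately show ?thesis unfolding white_noise_def using m by blast
qed

lemma Tf_exists: "is_Tf s N e \<xi> f (\<lambda>x \<omega>. sec_of s (\<lambda>g. noise_version g \<omega>) x)"
  unfolding is_Tf_def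
proof (intro conjI exI[of _ noise_version] ballI white_noise_version)
  have "(\<lambda>(x, \<omega>). sec_of s (\<lambda>g. noise_version g \<omega>) x) \<in> measurable (S2_measure \<Otimes>\<^sub>M N) (bundle_borel s)"
  proof -
    have L: "(\<lambda>y. pole_lift (fst y)) \<in> measurable (S2_measure \<Otimes>\<^sub>M N) haar_SO3"
      by (rule measurable_compose[OF measurable_fst measurable_lift_S2])
    then have L': "(\<lambda>y. pole_lift (fst y)) \<in> measurable (S2_measure \<Otimes>\<^sub>M N) SO3_space"
      by (simp add: measurable_haar_iff)
    show ?thesis
      unfolding sec_of_def case_prod_unfold
      by (intro measurable_theta_raw L' noise_version_measurable L measurable_snd)
  qed
  then show "random_section s N (\<lambda>x \<omega>. sec_of s (\<lambda>g. noise_version g \<omega>) x)"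
    unfolding random_section_def by (simp add: is_section_sec_of N.prob_space_axioms)
  have "(\<lambda>y. noise_version (fst y) (snd y)) \<in> borel_measurable (haar_SO3 \<Otimes>\<^sub>M N)" by measurable
  then show "(\<lambda>(g, \<omega>). noise_version g \<omega>) \<in> borel_measurable (haar_SO3 \<Otimes>\<^sub>M N)" by (simp add: case_prod_unfold)
  show "sec_of s (\<lambda>g. noise_version g \<omega>) (g *v north) = theta s g (noise_version g \<omega>)" if "g \<in> SO3" for g \<omega>
    by (rule sec_of_theta[OF _ that]) (simp add: spin_fun_def noise_version_spin)
qed

lemma amp_L2: "sq_integrable haar_SO3 (\<lambda>g. amp g k)"
proof (rule sq_integrable_bounded_by[of haar_SO3 "\<lambda>_. of_real (sqrt (l2sq haar_SO3 f))"])
  fix g assume "g \<in> space haar_SO3"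
  then have g: "g \<in> SO3" by simp
  have "(norm (amp g k))\<^sup>2 \<le> l2sq haar_SO3 f"
    using sum_le_suminf[OF sums_summable[OF amp_sums[OF g]], of "{k}"] sums_unique[OF amp_sums[OF g]] by simp
  then show "norm (amp g k) \<le> norm (complex_of_real (sqrt (l2sq haar_SO3 f)))"
    by (simp add: real_le_rsqrt)
qed auto

text \<open>Averaging the translates of \<open>f\<close> with weight \<open>v\<close> gives
  \<open>conv v f\<close>, and taking coefficients commutes with this average.\<close>

lemma amp_integral:
  assumes v: "sq_integrable haar_SO3 v"
  shows "(\<integral>g. v g * amp g k \<partial>haar_SO3) = coef (haar.conv v f) k"
proof -
  interpret HH: pair_sigma_finite haar_SO3 haar_SO3 by (rule haar.pair_closed)
  \<comment> \<open>Precomposing with inversion puts the basis function into the shape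
    \<open>w (inv h \<odot> g)\<close> of \<open>integrable_assoc\<close>, taken at the
    identity.\<close>
  have "sq_integrable haar_SO3 (\<lambda>x. ce k (matrix_inv x))"
    by (rule haar.sq_integrable_preserving[OF haar.inv_meas distr_haar_inv e_L2])
  from haar.integrable_assoc[OF v f_L2 this, of "mat 1"]
  have "integrable (haar_SO3 \<Otimes>\<^sub>M haar_SO3) (\<lambda>(g, h). v g * f (matrix_inv g ** h) * ce k (matrix_inv (matrix_inv h ** mat 1)))"
    by (simp add: SO3_one)
  then have int: "integrable (haar_SO3 \<Otimes>\<^sub>M haar_SO3) (\<lambda>(g, h). v g * f (matrix_inv g ** h) * ce k h)"
    by (subst (asm) Bochner_Integration.integrable_cong[OF refl, of _ _ "\<lambda>(g, h). v g * f (matrix_inv g ** h) * ce k h"])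
       (auto simp: space_pair_measure SO3_inv_inv)
  have "(\<integral>g. v g * amp g k \<partial>haar_SO3) = (\<integral>g. \<integral>h. v g * f (matrix_inv g ** h) * ce k h \<partial>haar_SO3 \<partial>haar_SO3)"
    by (simp add: amp_def coef_def left_translate_def mult.assoc)
  also have "\<dots> = (\<integral>h. \<integral>g. v g * f (matrix_inv g ** h) * ce k h \<partial>haar_SO3 \<partial>haar_SO3)"
    using HH.Fubini_integral[OF int] by simp
  also have "\<dots> = coef (haar.conv v f) k" by (simp add: coef_def haar.conv_def)
  finally show ?thesis .
qed

lemma conv_right_K:
  assumes v: "sq_integrable haar_SO3 v" and k: "k \<in> K_north" and h: "h \<in> SO3"
  shows "haar.conv v f (h ** k) = chi s k * haar.conv v f h"
proof -
  have "haar.conv v f (h ** k) = (\<integral>g. chi s k * (v g * f (matrix_inv g ** h)) \<partial>haar_SO3)"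
    unfolding haar.conv_def
  proof (rule Bochner_Integration.integral_cong)
    fix g assume "g \<in> space haar_SO3"
    then have g: "matrix_inv g ** h \<in> SO3" using h by (simp add: SO3_mult SO3_inv)
    have "f (mat 1 ** (matrix_inv g ** h) ** k) = chi s (mat 1) * f (matrix_inv g ** h) * chi s k"
      using f_bi g K_north_one k by (simp only: bi_associated_def)
    then show "v g * f (matrix_inv g ** (h ** k)) = chi s k * (v g * f (matrix_inv g ** h))"
      by (simp add: chi_one matrix_mul_assoc)
  qed simp
  then show ?thesis by (simp add: haar.conv_def)
qed

text \<open>Right association kills \<open>\<integral> W\<^sup>2\<close>, so real and imaginary part of the pairing have equal variance. This is where
  \<open>s \<noteq> 0\<close> enters.\<close>

lemma real_part_norm:
  assumes v: "sq_integrable haar_SO3 v" and s: "s \<noteq> 0"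
  shows "l2sq haar_SO3 (\<lambda>h. of_real (Re (haar.conv v f h))) = l2sq haar_SO3 (haar.conv v f) / 2"
proof -
  let ?W = "haar.conv v f"
  have W: "sq_integrable haar_SO3 ?W" by (rule haar.conv_L2[OF v f_L2])
  note [measurable] = sq_integrable_measurable[OF W]
  obtain k where k: "k \<in> K_north" "chi s k = \<i>" using chi_imaginary_unit[OF s] .
  note p = translate_preserving(3,4)[OF K_north_SO3[OF k(1)]]
  have i2: "integrable haar_SO3 (\<lambda>h. ?W h * ?W h)" by (rule integrable_mult_L2[OF W W])
  have "(\<integral>h. ?W h * ?W h \<partial>haar_SO3) = (\<integral>h. ?W (h ** k) * ?W (h ** k) \<partial>haar_SO3)"
    by (rule haar.integral_preserving[OF p, symmetric, of "\<lambda>h. ?W h * ?W h"]) measurable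
  also have "\<dots> = (\<integral>h. - (?W h * ?W h) \<partial>haar_SO3)"
    by (rule Bochner_Integration.integral_cong) (auto simp: conv_right_K v k algebra_simps)
  finally have "(\<integral>h. ?W h * ?W h \<partial>haar_SO3) = - (\<integral>h. ?W h * ?W h \<partial>haar_SO3)"
    by (simp only: Bochner_Integration.integral_minus)
  then have "(\<integral>h. ?W h * ?W h \<partial>haar_SO3) + (\<integral>h. ?W h * ?W h \<partial>haar_SO3) = 0" by (simp only: eq_neg_iff_add_eq_0)
  then have "(\<integral>h. ?W h * ?W h \<partial>haar_SO3) = 0" by (simp flip: mult_2)
  then have z: "(\<integral>h. Re (?W h * ?W h) \<partial>haar_SO3) = 0" using integral_Re[OF i2] by simp
  have "l2sq haar_SO3 (\<lambda>h. of_real (Re (?W h))) = (\<integral>h. (1/2) * ((norm (?W h))\<^sup>2 + Re (?W h * ?W h)) \<partial>haar_SO3)"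
    unfolding l2sq_def
  proof (rule Bochner_Integration.integral_cong)
    fix h
    show "(norm (complex_of_real (Re (?W h))))\<^sup>2 = (1/2) * ((norm (?W h))\<^sup>2 + Re (?W h * ?W h))"
      using cmod_power2[of "?W h"] by (simp add: power2_eq_square)
  qed simp
  also have "\<dots> = (1/2) * ((\<integral>h. (norm (?W h))\<^sup>2 \<partial>haar_SO3) + (\<integral>h. Re (?W h * ?W h) \<partial>haar_SO3))"
    unfolding Bochner_Integration.integral_mult_right_zero
    using Bochner_Integration.integral_add[OF sq_integrableD[OF W] integrable_Re[OF i2]] by simp
  finally show ?thesis unfolding z l2sq_def by simp
qed

lemma Tf_random_section: "is_Tf s N e \<xi> f T' \<Longrightarrow> random_section s N T'"
  by (simp add: is_Tf_def)

text \<open>Uniqueness of the coefficients makes the error the same for every admissible version of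
  the field.\<close>

lemma Tf_error:
  assumes T': "is_Tf s N e \<xi> f T'" and g: "g \<in> SO3"
  shows "(\<integral>\<^sup>+\<omega>. ennreal ((norm (pullback s (\<lambda>x. T' x \<omega>) g - partial_field n g \<omega>))\<^sup>2) \<partial>N) = ennreal (tail g n)"
proof -
  obtain X' where wn: "white_noise N e \<xi> (left_translate g f) (X' g)"
    and th: "\<And>\<omega>. \<omega> \<in> space N \<Longrightarrow> T' (g *v north) \<omega> = theta s g (X' g \<omega>)"
    using T' g unfolding is_Tf_def by blast
  have XX: "pullback s (\<lambda>x. T' x \<omega>) g = X' g \<omega>" if "\<omega> \<in> space N" for \<omega>
    using th[OF that] by (intro pullback_eqI[OF g]) simp
  obtain \<alpha> where X'm: "X' g \<in> borel_measurable N" and \<alpha>: "L2_sums haar_SO3 (\<lambda>k h. \<alpha> k * ce k h) (left_translate g f)"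
    "L2_sums N (\<lambda>k \<omega>. \<alpha> k * c\<xi> k \<omega>) (X' g)"
    using wn unfolding white_noise_def by blast
  have "\<alpha> = amp g" using L2_sums_coef[OF translate_L2(1)[OF g] \<alpha>(1)] by (auto simp: amp_def)
  then have "(\<integral>\<^sup>+\<omega>. ennreal ((norm (X' g \<omega> - partial_field n g \<omega>))\<^sup>2) \<partial>N) = ennreal (tail g n)"
    using noise_limit(2)[OF X'm \<alpha>(2), of "l2sq haar_SO3 f" n] amp_sums[OF g] by (simp add: partial_field_def tail_def)
  then show ?thesis using XX by (simp cong: nn_integral_cong)
qed

lemma tail_integral_finite: "(\<integral>\<^sup>+g. ennreal (tail g n) \<partial>haar_SO3) < \<infinity>"
proof -
  have "(\<integral>\<^sup>+g. ennreal (tail g n) \<partial>haar_SO3) \<le> (\<integral>\<^sup>+g. ennreal (l2sq haar_SO3 f) \<partial>haar_SO3)"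
    by (rule nn_integral_mono) (auto intro!: ennreal_leI simp: tail_def sum_nonneg)
  also have "\<dots> < \<infinity>" by simp
  finally show ?thesis .
qed

lemma Tf_error_integral:
  assumes T': "is_Tf s N e \<xi> f T'"
  shows "(\<integral>\<^sup>+\<omega>. \<integral>\<^sup>+g. ennreal ((norm (pullback s (\<lambda>x. T' x \<omega>) g - partial_field n g \<omega>))\<^sup>2) \<partial>haar_SO3 \<partial>N)
      = (\<integral>\<^sup>+g. ennreal (tail g n) \<partial>haar_SO3)"
    and "AE \<omega> in N. sq_integrable haar_SO3 (\<lambda>g. pullback s (\<lambda>x. T' x \<omega>) g - partial_field n g \<omega>)"
proof -
  interpret R: spin_random_section N s T' by unfold_locales (rule Tf_random_section[OF T'])
  interpret HN: pair_sigma_finite haar_SO3 N ..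
  have m [measurable]: "(\<lambda>(g, \<omega>). ennreal ((norm (R.X g \<omega> - partial_field n g \<omega>))\<^sup>2)) \<in> borel_measurable (haar_SO3 \<Otimes>\<^sub>M N)"
    by measurable
  from HN.Fubini'[OF m]
  have "(\<integral>\<^sup>+\<omega>. \<integral>\<^sup>+g. ennreal ((norm (R.X g \<omega> - partial_field n g \<omega>))\<^sup>2) \<partial>haar_SO3 \<partial>N)
      = (\<integral>\<^sup>+g. \<integral>\<^sup>+\<omega>. ennreal ((norm (R.X g \<omega> - partial_field n g \<omega>))\<^sup>2) \<partial>N \<partial>haar_SO3)" by simp
  also have "\<dots> = (\<integral>\<^sup>+g. ennreal (tail g n) \<partial>haar_SO3)"
    by (rule nn_integral_cong) (simp add: R.X_def Tf_error[OF T'])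
  finally have eq: "(\<integral>\<^sup>+\<omega>. \<integral>\<^sup>+g. ennreal ((norm (R.X g \<omega> - partial_field n g \<omega>))\<^sup>2) \<partial>haar_SO3 \<partial>N)
      = (\<integral>\<^sup>+g. ennreal (tail g n) \<partial>haar_SO3)" .
  then show "(\<integral>\<^sup>+\<omega>. \<integral>\<^sup>+g. ennreal ((norm (pullback s (\<lambda>x. T' x \<omega>) g - partial_field n g \<omega>))\<^sup>2) \<partial>haar_SO3 \<partial>N)
      = (\<integral>\<^sup>+g. ennreal (tail g n) \<partial>haar_SO3)" by (simp only: R.X_def)
  have err_meas: "(\<lambda>\<omega>. \<integral>\<^sup>+g. ennreal ((norm (R.X g \<omega> - partial_field n g \<omega>))\<^sup>2) \<partial>haar_SO3) \<in> borel_measurable N"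
    by measurable
  have "AE \<omega> in N. (\<integral>\<^sup>+g. ennreal ((norm (R.X g \<omega> - partial_field n g \<omega>))\<^sup>2) \<partial>haar_SO3) \<noteq> \<infinity>"
    using tail_integral_finite[of n] unfolding eq[symmetric]
    by (intro nn_integral_PInf_AE) (use err_meas in \<open>auto simp: less_top\<close>)
  then have "AE \<omega> in N. sq_integrable haar_SO3 (\<lambda>g. R.X g \<omega> - partial_field n g \<omega>)"
    using AE_space by eventually_elim (auto simp: sq_integrable_iff_nn less_top)
  then show "AE \<omega> in N. sq_integrable haar_SO3 (\<lambda>g. pullback s (\<lambda>x. T' x \<omega>) g - partial_field n g \<omega>)"
    by (simp only: R.X_def)
qed

lemma Tf_path_L2:
  assumes "is_Tf s N e \<xi> f T'"
  shows "AE \<omega> in N. sq_integrable haar_SO3 (pullback s (\<lambda>x. T' x \<omega>))"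
  \<comment> \<open>At \<open>n = 0\<close> the partial field is zero.\<close>
  using Tf_error_integral(2)[OF assms, of 0] by (simp add: partial_field_def)

text \<open>The pairing is the L^2 limit of the finite Gaussian sums with the coefficients of
  \<open>W = conv v f\<close>, that is a version of \<open>S(W)\<close>. Imaginary exponentials are
  Lipschitz, so the characteristic functions converge.\<close>

lemma Tf_pairing_char:
  assumes s: "s \<noteq> 0" and T': "is_Tf s N e \<xi> f T'" and u: "L2_section s u"
  shows "(\<integral>\<omega>. exp (\<i> * of_real (Re (pairing s T' u \<omega>))) \<partial>N)
    = exp (- of_real (l2sq haar_SO3 (haar.conv (\<lambda>g. cnj (pullback s u g)) f) / 4))"
proof -
  interpret R: spin_random_section N s T' by unfold_locales (rule Tf_random_section[OF T'])
  define v where "v g = cnj (pullback s u g)" for g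
  have v: "sq_integrable haar_SO3 v" unfolding v_def using L2_section_pullback(1)[OF u] by simp
  note [measurable] = sq_integrable_measurable[OF v] R.pairing_measurable[OF u]
  define W where "W = haar.conv v f"
  have W: "sq_integrable haar_SO3 W" unfolding W_def by (rule haar.conv_L2[OF v f_L2])
  define S where "S n \<omega> = (\<Sum>k<n. coef W k * c\<xi> k \<omega>)" for n \<omega>
  have SL: "sq_integrable N (S n)" for n unfolding S_def by (rule noise_sum) simp
  note [measurable] = sq_integrable_measurable[OF SL]
  have S_int: "S n \<omega> = (\<integral>g. v g * partial_field n g \<omega> \<partial>haar_SO3)" for n \<omega>
  proof -
    have "(\<integral>g. v g * partial_field n g \<omega> \<partial>haar_SO3) = (\<integral>g. (\<Sum>k<n. (v g * amp g k) * c\<xi> k \<omega>) \<partial>haar_SO3)"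
      by (simp add: partial_field_def sum_distrib_left mult.assoc)
    also have "\<dots> = (\<Sum>k<n. (\<integral>g. (v g * amp g k) * c\<xi> k \<omega> \<partial>haar_SO3))"
      by (rule Bochner_Integration.integral_sum) (intro integrable_mult_left integrable_mult_L2 v amp_L2)
    finally show ?thesis by (simp add: S_def W_def amp_integral[OF v])
  qed
  note err_int = Tf_error_integral(1)[OF T', folded R.X_def]
  \<comment> \<open>The integral against \<open>v\<close> is split where the error path is square
    integrable, which holds almost surely.\<close>
  have XD: "AE \<omega> in N. pairing s T' u \<omega> - S n \<omega> = (\<integral>g. v g * (R.X g \<omega> - partial_field n g \<omega>) \<partial>haar_SO3)" for n
  proof -
    note Tf_error_integral(2)[OF T', folded R.X_def, of n]
    then show ?thesis using AE_space
    proof eventually_elim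
      case (elim \<omega>)
      note D = elim(1)
      have P: "sq_integrable haar_SO3 (\<lambda>g. partial_field n g \<omega>)"
        unfolding partial_field_def
        by (intro sq_integrable_sum) (subst mult.commute, intro sq_integrable_scale amp_L2)
      have "pairing s T' u \<omega> = (\<integral>g. v g * (R.X g \<omega> - partial_field n g \<omega>) + v g * partial_field n g \<omega> \<partial>haar_SO3)"
        unfolding R.pairing_eq[OF elim(2) u] by (simp add: v_def right_diff_distrib mult.commute)
      also have "\<dots> = (\<integral>g. v g * (R.X g \<omega> - partial_field n g \<omega>) \<partial>haar_SO3) + S n \<omega>"
        unfolding S_int by (intro Bochner_Integration.integral_add integrable_mult_L2 v D P)
      finally show ?case by simp
    qed
  qed
  define t where "t n = (\<integral>g. tail g n \<partial>haar_SO3)" for n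
  have ti: "integrable haar_SO3 (\<lambda>g. tail g n)" for n
    by (rule Bochner_Integration.integrable_bound[of haar_SO3 "\<lambda>_. l2sq haar_SO3 f"])
       (auto intro!: AE_I2 simp: tail_nonneg, simp add: tail_def sum_nonneg)
  have t0: "t \<longlonglongrightarrow> 0"
  proof -
    have "(\<lambda>n. \<integral>g. tail g n \<partial>haar_SO3) \<longlonglongrightarrow> (\<integral>g. 0 \<partial>haar_SO3)"
      by (rule integral_dominated_convergence[where w = "\<lambda>_. l2sq haar_SO3 f"])
         (auto intro!: AE_I2 tail_lim simp: tail_nonneg, simp add: tail_def sum_nonneg)
    then show ?thesis by (simp add: t_def[abs_def])
  qed
  have bound: "(\<integral>\<^sup>+\<omega>. ennreal ((norm (pairing s T' u \<omega> - S n \<omega>))\<^sup>2) \<partial>N) \<le> ennreal (l2sq haar_SO3 v * t n)" for n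
  proof -
    have "(\<integral>\<^sup>+\<omega>. ennreal ((norm (pairing s T' u \<omega> - S n \<omega>))\<^sup>2) \<partial>N)
        = (\<integral>\<^sup>+\<omega>. ennreal ((norm (\<integral>g. v g * (R.X g \<omega> - partial_field n g \<omega>) \<partial>haar_SO3))\<^sup>2) \<partial>N)"
      by (rule nn_integral_cong_AE) (use XD[of n] in eventually_elim, simp)
    also have "\<dots> \<le> (\<integral>\<^sup>+\<omega>. ennreal (l2sq haar_SO3 v) * (\<integral>\<^sup>+g. ennreal ((norm (R.X g \<omega> - partial_field n g \<omega>))\<^sup>2) \<partial>haar_SO3) \<partial>N)"
      by (rule nn_integral_mono, rule l2_nn_cs[OF v]) measurable
    also have "\<dots> = ennreal (l2sq haar_SO3 v) * (\<integral>\<^sup>+\<omega>. \<integral>\<^sup>+g. ennreal ((norm (R.X g \<omega> - partial_field n g \<omega>))\<^sup>2) \<partial>haar_SO3 \<partial>N)"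
      by (rule nn_integral_cmult) measurable
    also have "(\<integral>\<^sup>+\<omega>. \<integral>\<^sup>+g. ennreal ((norm (R.X g \<omega> - partial_field n g \<omega>))\<^sup>2) \<partial>haar_SO3 \<partial>N) = (\<integral>\<^sup>+g. ennreal (tail g n) \<partial>haar_SO3)"
      by (rule err_int)
    also have "\<dots> = ennreal (t n)"
      unfolding t_def by (rule nn_integral_eq_integral[OF ti]) (auto intro!: AE_I2 simp: tail_nonneg)
    finally show ?thesis by (simp add: ennreal_mult')
  qed
  have DL: "sq_integrable N (\<lambda>\<omega>. pairing s T' u \<omega> - S n \<omega>)" for n
    unfolding sq_integrable_iff_nn using bound[of n] by (auto intro: le_less_trans)
  have YL: "sq_integrable N (pairing s T' u)"
    using sq_integrable_add[OF DL[of 0] SL[of 0]] by simp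
  have d0: "(\<lambda>n. sqrt (l2sq N (\<lambda>\<omega>. pairing s T' u \<omega> - S n \<omega>))) \<longlonglongrightarrow> 0"
  proof -
    have t_nn: "0 \<le> t n" for n unfolding t_def by (rule integral_nonneg_AE) (auto intro!: AE_I2 simp: tail_nonneg)
    have "(\<lambda>n. l2sq N (\<lambda>\<omega>. pairing s T' u \<omega> - S n \<omega>)) \<longlonglongrightarrow> 0"
    proof (rule tendsto_sandwich[OF _ _ tendsto_const])
      show "(\<lambda>n. l2sq haar_SO3 v * t n) \<longlonglongrightarrow> 0" using tendsto_mult_right_zero[OF t0] by simp
      show "\<forall>\<^sub>F n in sequentially. l2sq N (\<lambda>\<omega>. pairing s T' u \<omega> - S n \<omega>) \<le> l2sq haar_SO3 v * t n"
        using bound t_nn unfolding nn_integral_l2sq[OF DL] by (intro always_eventually allI) (simp add: ennreal_le_iff)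
    qed simp
    from tendsto_real_sqrt[OF this] show ?thesis by simp
  qed
  let ?E = "\<lambda>Y. \<integral>\<omega>. exp (\<i> * of_real (Re (Y \<omega>))) \<partial>N"
  have Eint: "integrable N (\<lambda>\<omega>. exp (\<i> * of_real (Re (Y \<omega>))))" if [measurable]: "Y \<in> borel_measurable N" for Y
    by (rule N.integrable_const_bound[of _ 1]) auto
  have "norm (?E (pairing s T' u) - ?E (S n)) \<le> sqrt (l2sq N (\<lambda>\<omega>. pairing s T' u \<omega> - S n \<omega>))" for n
  proof -
    have one: "sq_integrable N (\<lambda>_. 1)" "l2sq N (\<lambda>_. 1) = 1" by (simp_all add: sq_integrable_def l2sq_def N.prob_space)
    have "norm (?E (pairing s T' u) - ?E (S n))
        = norm (\<integral>\<omega>. exp (\<i> * of_real (Re (pairing s T' u \<omega>))) - exp (\<i> * of_real (Re (S n \<omega>))) \<partial>N)"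
      by (subst Bochner_Integration.integral_diff) (auto intro!: Eint)
    also have "\<dots> \<le> (\<integral>\<omega>. norm (exp (\<i> * of_real (Re (pairing s T' u \<omega>))) - exp (\<i> * of_real (Re (S n \<omega>)))) \<partial>N)"
      by (rule integral_norm_bound)
    also have "\<dots> \<le> (\<integral>\<omega>. norm (pairing s T' u \<omega> - S n \<omega>) * norm (1::complex) \<partial>N)"
    proof (rule integral_mono)
      show "integrable N (\<lambda>\<omega>. norm (exp (\<i> * of_real (Re (pairing s T' u \<omega>))) - exp (\<i> * of_real (Re (S n \<omega>)))))"
        by (intro integrable_norm Bochner_Integration.integrable_diff Eint) auto
      show "integrable N (\<lambda>\<omega>. norm (pairing s T' u \<omega> - S n \<omega>) * norm (1::complex))"
        by (rule integrable_norm_mult[OF DL one(1)])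
      fix \<omega>
      have "\<bar>Re (pairing s T' u \<omega>) - Re (S n \<omega>)\<bar> \<le> norm (pairing s T' u \<omega> - S n \<omega>)"
        using abs_Re_le_cmod[of "pairing s T' u \<omega> - S n \<omega>"] by simp
      then show "norm (exp (\<i> * of_real (Re (pairing s T' u \<omega>))) - exp (\<i> * of_real (Re (S n \<omega>))))
          \<le> norm (pairing s T' u \<omega> - S n \<omega>) * norm (1::complex)"
        using iexp_lipschitz[of "Re (pairing s T' u \<omega>)" "Re (S n \<omega>)"] by simp
    qed
    also have "\<dots> \<le> sqrt (l2sq N (\<lambda>\<omega>. pairing s T' u \<omega> - S n \<omega>))"
      using l2sq_cs_norm[OF DL one(1)] unfolding one(2) mult_1_right by (rule real_le_rsqrt)
    finally show ?thesis .
  qed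
  then have "(\<lambda>n. ?E (pairing s T' u) - ?E (S n)) \<longlonglongrightarrow> 0"
    by (intro Lim_null_comparison[OF _ d0]) simp
  from tendsto_diff[OF tendsto_const[of "?E (pairing s T' u)"] this]
  have lim1: "(\<lambda>n. ?E (S n)) \<longlonglongrightarrow> ?E (pairing s T' u)" by simp
  have ES: "?E (S n) = of_real (exp (- (\<Sum>k<n. (Re (coef W k))\<^sup>2) / 2))" for n
    using combination_facts(3)[of "{..<n}" "\<lambda>k. Re (coef W k)"] by (simp add: S_def)
  have ReW: "sq_integrable haar_SO3 (\<lambda>h. complex_of_real (Re (W h)))"
    using W by (intro sq_integrable_bounded_by[OF W]) (auto simp: abs_Re_le_cmod)
  \<comment> \<open>The basis is real, so coefficients of the real part are real parts of
    coefficients.\<close>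
  have "coef (\<lambda>h. of_real (Re (W h))) k = of_real (Re (coef W k))" for k
  proof -
    have i: "integrable haar_SO3 (\<lambda>h. W h * ce k h)" by (rule integrable_mult_L2[OF W e_L2])
    have "Re (coef W k) = (\<integral>h. Re (W h) * e k h \<partial>haar_SO3)"
      unfolding coef_def integral_Re[OF i, symmetric] by simp
    then show ?thesis unfolding coef_def by (simp flip: integral_complex_of_real)
  qed
  then have "(\<lambda>k. (Re (coef W k))\<^sup>2) sums (l2sq haar_SO3 W / 2)"
    using parseval[OF ReW] real_part_norm[OF v s] by (simp add: W_def)
  then have "(\<lambda>n. \<Sum>k<n. (Re (coef W k))\<^sup>2) \<longlonglongrightarrow> l2sq haar_SO3 W / 2" by (simp add: sums_def)
  then have "(\<lambda>n. complex_of_real (exp (- (\<Sum>k<n. (Re (coef W k))\<^sup>2) / 2))) \<longlonglongrightarrow> of_real (exp (- (l2sq haar_SO3 W / 2) / 2))"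
    by (intro tendsto_intros) simp_all
  then have lim2: "(\<lambda>n. ?E (S n)) \<longlonglongrightarrow> of_real (exp (- (l2sq haar_SO3 W / 2) / 2))" unfolding ES .
  have "?E (pairing s T' u) = of_real (exp (- (l2sq haar_SO3 W / 4)))"
    using LIMSEQ_unique[OF lim1 lim2] by simp
  then show ?thesis unfolding exp_of_real[symmetric] W_def v_def by simp
qed

end

section \<open>Joint laws from characteristic functions\<close>

text \<open>\<open>D\<close> is the law of \<open>Y\<close> under the probability density
  \<open>h / m\<close>; it brings weighted expectations within reach of Levy's uniqueness
  theorem.\<close>

lemma weighted_law:
  fixes h Y :: "'a \<Rightarrow> real"
  assumes M: "prob_space M" and [measurable]: "h \<in> borel_measurable M" "Y \<in> borel_measurable M"
    and h: "\<And>x. 0 \<le> h x" "\<And>x. h x \<le> c" and m: "m = (\<integral>x. h x \<partial>M)" "m \<noteq> 0"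
  obtains D where "real_distribution D" "\<And>t. char D t = (\<integral>x. of_real (h x) * iexp (t * Y x) \<partial>M) / of_real m"
    "\<And>A. A \<in> sets borel \<Longrightarrow> (\<integral>x. indicator A x \<partial>D) * m = (\<integral>x. h x * indicator A (Y x) \<partial>M)"
proof -
  interpret prob_space M by fact
  have ih: "integrable M h" by (rule integrable_const_bound[of _ c]) (use h in auto)
  have m0: "m > 0" using m h integral_nonneg_AE[of h M] by (simp add: less_le)
  define W where "W = density M (\<lambda>x. ennreal (h x / m))"
  have "(\<integral>\<^sup>+x. ennreal (h x / m) \<partial>M) = ennreal (\<integral>x. h x / m \<partial>M)"
    by (rule nn_integral_eq_integral) (use ih h m0 in auto)
  moreover have "(\<integral>x. h x / m \<partial>M) = 1" using m by simp
  ultimately have prob: "prob_space W"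
    unfolding W_def by (intro prob_spaceI) (simp add: emeasure_density cong: nn_integral_cong)
  have Y: "Y \<in> borel_measurable W" by (simp add: W_def)
  have I: "(\<integral>x. f x \<partial>distr W borel Y) = (\<integral>x. (h x / m) *\<^sub>R f (Y x) \<partial>M)" if [measurable]: "f \<in> borel_measurable borel"
    for f :: "real \<Rightarrow> 'b::{banach, second_countable_topology}"
  proof -
    have "(\<integral>x. f x \<partial>distr W borel Y) = (\<integral>x. f (Y x) \<partial>W)" by (rule integral_distr[OF Y that])
    also have "\<dots> = (\<integral>x. (h x / m) *\<^sub>R f (Y x) \<partial>M)"
      unfolding W_def by (rule integral_density) (use h m0 in auto)
    finally show ?thesis .
  qed
  show ?thesis
  proof (rule that[of "distr W borel Y"])
    show "real_distribution (distr W borel Y)" by (rule prob_space.real_distribution_distr[OF prob Y])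
    have "char (distr W borel Y) t = (\<integral>x. (of_real (h x) * iexp (t * Y x)) / of_real m \<partial>M)" for t
      unfolding char_def by (subst I) (auto simp: scaleR_conv_of_real)
    then show "char (distr W borel Y) t = (\<integral>x. of_real (h x) * iexp (t * Y x) \<partial>M) / of_real m" for t
      by (simp only: Bochner_Integration.integral_divide_zero)
    fix A :: "real set" assume "A \<in> sets borel"
    then have "(\<integral>x. indicator A x \<partial>distr W borel Y) = (\<integral>x. (h x * indicator A (Y x)) / m \<partial>M)"
      by (subst I) auto
    then show "(\<integral>x. indicator A x \<partial>distr W borel Y) * m = (\<integral>x. h x * indicator A (Y x) \<partial>M)"
      using m by simp
  qed
qed

text \<open>At \<open>t = 0\<close> the hypothesis equates the total weights. If they vanish, both
  sides are zero; otherwise the weights can be normalised.\<close>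

lemma weighted_levy:
  fixes h :: "'a \<Rightarrow> real" and h' :: "'b \<Rightarrow> real"
  assumes M: "prob_space M" and N: "prob_space N"
    and meas: "h \<in> borel_measurable M" "Y \<in> borel_measurable M" and meas': "h' \<in> borel_measurable N" "Y' \<in> borel_measurable N"
    and h: "\<And>x. 0 \<le> h x" "\<And>x. h x \<le> c" and h': "\<And>x. 0 \<le> h' x" "\<And>x. h' x \<le> c"
    and eq: "\<And>t. (\<integral>x. of_real (h x) * iexp (t * Y x) \<partial>M) = (\<integral>x. of_real (h' x) * iexp (t * Y' x) \<partial>N)"
    and A: "A \<in> sets borel"
  shows "(\<integral>x. h x * indicator A (Y x) \<partial>M) = (\<integral>x. h' x * indicator A (Y' x) \<partial>N)"
proof -
  interpret M: prob_space M by fact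
  interpret N: prob_space N by fact
  define m where "m = (\<integral>x. h x \<partial>M)"
  have "complex_of_real m = of_real (\<integral>x. h' x \<partial>N)" using eq[of 0] unfolding m_def by simp
  then have m': "m = (\<integral>x. h' x \<partial>N)" by (simp only: of_real_eq_iff)
  show ?thesis
  proof (cases "m = 0")
    case True
    have "integrable M h" by (rule M.integrable_const_bound[of _ c]) (use h meas in auto)
    moreover have "integrable N h'" by (rule N.integrable_const_bound[of _ c]) (use h' meas' in auto)
    ultimately have "AE x in M. h x = 0" "AE x in N. h' x = 0"
      using True m' integral_nonneg_eq_0_iff_AE[of M h] integral_nonneg_eq_0_iff_AE[of N h'] h h' by (auto simp: m_def)
    then have "AE x in M. h x * indicator A (Y x) = 0" "AE x in N. h' x * indicator A (Y' x) = 0"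
      by (auto elim: eventually_mono)
    then have "(\<integral>x. h x * indicator A (Y x) \<partial>M) = 0" "(\<integral>x. h' x * indicator A (Y' x) \<partial>N) = 0"
      by (auto intro: integral_eq_zero_AE)
    then show ?thesis by simp
  next
    case False
    obtain D where D: "real_distribution D" "\<And>t. char D t = (\<integral>x. of_real (h x) * iexp (t * Y x) \<partial>M) / of_real m"
      "\<And>A. A \<in> sets borel \<Longrightarrow> (\<integral>x. indicator A x \<partial>D) * m = (\<integral>x. h x * indicator A (Y x) \<partial>M)"
      using weighted_law[OF M meas h m_def False] by blast
    obtain D' where D': "real_distribution D'" "\<And>t. char D' t = (\<integral>x. of_real (h' x) * iexp (t * Y' x) \<partial>N) / of_real m"
      "\<And>A. A \<in> sets borel \<Longrightarrow> (\<integral>x. indicator A x \<partial>D') * m = (\<integral>x. h' x * indicator A (Y' x) \<partial>N)"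
      using weighted_law[OF N meas' h' m' False] by blast
    have "char D = char D'" by (rule ext) (simp only: D(2) D'(2) eq)
    then have "D = D'" by (rule Levy_uniqueness[OF D(1) D'(1)])
    then show ?thesis using D(3)[OF A] D'(3)[OF A] by simp
  qed
qed

text \<open>The coordinates are turned from exponentials into indicators one at a time. A one-dimensional uniqueness theorem
  needs positive weights, whence the weights \<open>2 + cos\<close> and \<open>2 + sin\<close> for the remaining exponentials.\<close>

lemma multivariate_levy_step:
  fixes V :: "nat \<Rightarrow> 'a \<Rightarrow> real" and V' :: "nat \<Rightarrow> 'b \<Rightarrow> real"
  assumes M: "prob_space M" and N: "prob_space N"
    and V [measurable]: "\<And>i. V i \<in> borel_measurable M" and V' [measurable]: "\<And>i. V' i \<in> borel_measurable N"
    and eq: "\<And>t. (\<integral>x. iexp (\<Sum>i<n. t i * V i x) \<partial>M) = (\<integral>x. iexp (\<Sum>i<n. t i * V' i x) \<partial>N)"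
    and A [measurable]: "\<And>i. A i \<in> sets borel" and k: "k \<le> n"
  shows "(\<integral>x. of_real (\<Prod>i<k. indicator (A i) (V i x)) * iexp (\<Sum>i=k..<n. t i * V i x) \<partial>M)
    = (\<integral>x. of_real (\<Prod>i<k. indicator (A i) (V' i x)) * iexp (\<Sum>i=k..<n. t i * V' i x) \<partial>N)"
  using k
proof (induction k arbitrary: t)
  case 0
  then show ?case using eq[of t] by (simp add: lessThan_atLeast0)
next
  case (Suc k)
  interpret M: prob_space M by fact
  interpret N: prob_space N by fact
  define w where "w x = (\<Prod>i<k. indicator (A i) (V i x) :: real)" for x
  define w' where "w' x = (\<Prod>i<k. indicator (A i) (V' i x) :: real)" for x
  define \<theta> where "\<theta> x = (\<Sum>i=Suc k..<n. t i * V i x)" for x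
  define \<theta>' where "\<theta>' x = (\<Sum>i=Suc k..<n. t i * V' i x)" for x
  have [measurable]: "w \<in> borel_measurable M" "w' \<in> borel_measurable N" "\<theta> \<in> borel_measurable M" "\<theta>' \<in> borel_measurable N"
    unfolding w_def w'_def \<theta>_def \<theta>'_def by measurable
  have w: "0 \<le> w x" "w x \<le> 1" for x unfolding w_def by (auto intro!: prod_nonneg prod_le_1 split: split_indicator)
  have w': "0 \<le> w' x" "w' x \<le> 1" for x unfolding w'_def by (auto intro!: prod_nonneg prod_le_1 split: split_indicator)
  \<comment> \<open>The exponents are freed: \<tau> for the coordinate being converted, \<sigma> for
    the remaining ones. Only \<sigma> equal to 0, 1 and -1 will be used, for the mass and for the
    two exponentials in cos and sin.\<close>
  have E: "(\<integral>x. of_real (w x) * iexp (\<tau> * V k x + \<sigma> * \<theta> x) \<partial>M) = (\<integral>x. of_real (w' x) * iexp (\<tau> * V' k x + \<sigma> * \<theta>' x) \<partial>N)" for \<tau> \<sigma>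
  proof -
    have s: "(\<Sum>i=k..<n. (if i = k then \<tau> else \<sigma> * t i) * z i) = \<tau> * z k + \<sigma> * (\<Sum>i=Suc k..<n. t i * z i)" for z :: "nat \<Rightarrow> real"
      using Suc.prems by (simp add: sum.atLeast_Suc_lessThan sum_distrib_left mult.assoc cong: sum.cong_simp)
    show ?thesis
      using Suc.IH[of "\<lambda>i. if i = k then \<tau> else \<sigma> * t i"] Suc.prems
      by (simp add: s w_def w'_def \<theta>_def \<theta>'_def)
  qed
  have int: "integrable M (\<lambda>x. of_real (w x) * iexp (g x))" if [measurable]: "g \<in> borel_measurable M" for g
    by (rule M.integrable_const_bound[of _ 1]) (use w in \<open>auto simp: norm_mult\<close>)
  have int': "integrable N (\<lambda>x. of_real (w' x) * iexp (g x))" if [measurable]: "g \<in> borel_measurable N" for g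
    by (rule N.integrable_const_bound[of _ 1]) (use w' in \<open>auto simp: norm_mult\<close>)
  note [measurable] = A
  have b: "(\<integral>x. w x * indicator (A k) (V k x) \<partial>M) = (\<integral>x. w' x * indicator (A k) (V' k x) \<partial>N)"
    by (rule weighted_levy[OF M N, where c = 1]) (use w w' E[of _ 0] A in auto)
  define p where "p x = w x * indicator (A k) (V k x)" for x
  define p' where "p' x = w' x * indicator (A k) (V' k x)" for x
  have [measurable]: "p \<in> borel_measurable M" "p' \<in> borel_measurable N" unfolding p_def p'_def by measurable
  have pp: "norm (p x * z) \<le> 1" if "\<bar>z\<bar> \<le> 1" for x and z :: real
    using that w[of x] mult_mono[of "w x" 1 "\<bar>z\<bar>" 1] by (auto simp: p_def abs_mult split: split_indicator)
  have pp': "norm (p' x * z) \<le> 1" if "\<bar>z\<bar> \<le> 1" for x and z :: real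
    using that w'[of x] mult_mono[of "w' x" 1 "\<bar>z\<bar>" 1] by (auto simp: p'_def abs_mult split: split_indicator)
  have ip: "integrable M (\<lambda>x. p x * z x)" if [measurable]: "z \<in> borel_measurable M" and "\<And>x. \<bar>z x\<bar> \<le> 1" for z
    by (rule M.integrable_const_bound[of _ 1]) (use that pp in auto)
  have ip': "integrable N (\<lambda>x. p' x * z x)" if [measurable]: "z \<in> borel_measurable N" and "\<And>x. \<bar>z x\<bar> \<le> 1" for z
    by (rule N.integrable_const_bound[of _ 1]) (use that pp' in auto)
  have b': "(\<integral>x. p x * 1 \<partial>M) = (\<integral>x. p' x * 1 \<partial>N)" using b by (simp add: p_def p'_def)
  \<comment> \<open>\<open>tr\<close> will be cos and then sin; the contribution of the constant 2
    in the weight is removed with \<open>b'\<close>.\<close>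
  have ex: "(\<integral>x. p x * tr (\<theta> x) \<partial>M) = (\<integral>x. p' x * tr (\<theta>' x) \<partial>N)"
    if [measurable]: "tr \<in> borel_measurable borel" and tr: "\<And>a. \<bar>tr a\<bar> \<le> 1"
      and e: "\<And>a. of_real (tr a) = \<alpha> * iexp a + \<beta> * iexp (- a)" for tr :: "real \<Rightarrow> real" and \<alpha> \<beta>
  proof -
    have ec: "of_real (w0 * (2 + tr a)) * iexp b
        = 2 * (of_real w0 * iexp (b + 0 * a)) + \<alpha> * (of_real w0 * iexp (b + 1 * a)) + \<beta> * (of_real w0 * iexp (b + (-1) * a))"
      for w0 a b
    proof -
      have "iexp (b + 1 * a) = iexp b * iexp a" "iexp (b + (-1) * a) = iexp b * iexp (- a)"
        by (simp_all flip: exp_add distrib_left) (simp add: algebra_simps)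
      then show ?thesis by (simp add: e algebra_simps)
    qed
    have tb: "0 \<le> 2 + tr a" "2 + tr a \<le> 3" for a using tr[of a] by auto
    have pb: "q * z \<le> 3" if "0 \<le> q" "q \<le> 1" "0 \<le> z" "z \<le> 3" for q z :: real
      using mult_mono[of q 1 z 3] that by simp
    have "(\<integral>x. w x * (2 + tr (\<theta> x)) * indicator (A k) (V k x) \<partial>M) = (\<integral>x. w' x * (2 + tr (\<theta>' x)) * indicator (A k) (V' k x) \<partial>N)"
    proof (rule weighted_levy[OF M N, where c = 3])
      fix \<tau>
      show "(\<integral>x. of_real (w x * (2 + tr (\<theta> x))) * iexp (\<tau> * V k x) \<partial>M) = (\<integral>x. of_real (w' x * (2 + tr (\<theta>' x))) * iexp (\<tau> * V' k x) \<partial>N)"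
        unfolding ec by (simp only: Bochner_Integration.integral_add[OF Bochner_Integration.integrable_add] Bochner_Integration.integral_add
          Bochner_Integration.integral_mult_right_zero integrable_mult_right int int' E borel_measurable_add borel_measurable_times
          borel_measurable_const V V' \<open>\<theta> \<in> borel_measurable M\<close> \<open>\<theta>' \<in> borel_measurable N\<close> Bochner_Integration.integrable_add)
    next
      fix x
      show "0 \<le> w x * (2 + tr (\<theta> x))" "w x * (2 + tr (\<theta> x)) \<le> 3" by (intro mult_nonneg_nonneg pb w tb)+
    next
      fix x
      show "0 \<le> w' x * (2 + tr (\<theta>' x))" "w' x * (2 + tr (\<theta>' x)) \<le> 3" by (intro mult_nonneg_nonneg pb w' tb)+
    qed measurable
    moreover have "(\<integral>x. w x * (2 + tr (\<theta> x)) * indicator (A k) (V k x) \<partial>M) = 2 * (\<integral>x. p x * 1 \<partial>M) + (\<integral>x. p x * tr (\<theta> x) \<partial>M)"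
    proof -
      have "(\<integral>x. w x * (2 + tr (\<theta> x)) * indicator (A k) (V k x) \<partial>M) = (\<integral>x. 2 * (p x * 1) + p x * tr (\<theta> x) \<partial>M)"
        by (simp add: p_def algebra_simps)
      also have "\<dots> = 2 * (\<integral>x. p x * 1 \<partial>M) + (\<integral>x. p x * tr (\<theta> x) \<partial>M)"
        by (subst Bochner_Integration.integral_add) (use ip[of "\<lambda>_. 1"] ip[of "\<lambda>x. tr (\<theta> x)"] tr in auto)
      finally show ?thesis .
    qed
    moreover have "(\<integral>x. w' x * (2 + tr (\<theta>' x)) * indicator (A k) (V' k x) \<partial>N) = 2 * (\<integral>x. p' x * 1 \<partial>N) + (\<integral>x. p' x * tr (\<theta>' x) \<partial>N)"
    proof -
      have "(\<integral>x. w' x * (2 + tr (\<theta>' x)) * indicator (A k) (V' k x) \<partial>N) = (\<integral>x. 2 * (p' x * 1) + p' x * tr (\<theta>' x) \<partial>N)"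
        by (simp add: p'_def algebra_simps)
      also have "\<dots> = 2 * (\<integral>x. p' x * 1 \<partial>N) + (\<integral>x. p' x * tr (\<theta>' x) \<partial>N)"
        by (subst Bochner_Integration.integral_add) (use ip'[of "\<lambda>_. 1"] ip'[of "\<lambda>x. tr (\<theta>' x)"] tr in auto)
      finally show ?thesis .
    qed
    ultimately show ?thesis using b' by linarith
  qed
  have "complex_of_real (cos a) = (1/2) * iexp a + (1/2) * iexp (- a)" for a
    unfolding cis_conv_exp[symmetric] by (simp add: complex_eq_iff)
  from ex[OF _ _ this] have C: "(\<integral>x. p x * cos (\<theta> x) \<partial>M) = (\<integral>x. p' x * cos (\<theta>' x) \<partial>N)" by simp
  have "complex_of_real (sin a) = (- \<i> / 2) * iexp a + (\<i> / 2) * iexp (- a)" for a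
    unfolding cis_conv_exp[symmetric] by (simp add: complex_eq_iff)
  from ex[OF _ _ this] have S: "(\<integral>x. p x * sin (\<theta> x) \<partial>M) = (\<integral>x. p' x * sin (\<theta>' x) \<partial>N)" by simp
  have ie: "complex_of_real q * iexp a = of_real (q * cos a) + \<i> * of_real (q * sin a)" for q a
    by (simp flip: cis_conv_exp) (simp add: complex_eq_iff)
  have "(\<integral>x. of_real (p x) * iexp (\<theta> x) \<partial>M) = of_real (\<integral>x. p x * cos (\<theta> x) \<partial>M) + \<i> * of_real (\<integral>x. p x * sin (\<theta> x) \<partial>M)"
    unfolding ie by (subst Bochner_Integration.integral_add)
      (use ip[of "\<lambda>x. cos (\<theta> x)"] ip[of "\<lambda>x. sin (\<theta> x)"] in \<open>auto simp del: of_real_mult\<close>)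
  moreover have "(\<integral>x. of_real (p' x) * iexp (\<theta>' x) \<partial>N) = of_real (\<integral>x. p' x * cos (\<theta>' x) \<partial>N) + \<i> * of_real (\<integral>x. p' x * sin (\<theta>' x) \<partial>N)"
    unfolding ie by (subst Bochner_Integration.integral_add)
      (use ip'[of "\<lambda>x. cos (\<theta>' x)"] ip'[of "\<lambda>x. sin (\<theta>' x)"] in \<open>auto simp del: of_real_mult\<close>)
  ultimately have "(\<integral>x. of_real (p x) * iexp (\<theta> x) \<partial>M) = (\<integral>x. of_real (p' x) * iexp (\<theta>' x) \<partial>N)"
    using C S by simp
  then show ?case by (simp add: p_def p'_def w_def w'_def \<theta>_def \<theta>'_def)
qed

text \<open>Boxes generate the product sigma-algebra, and converting all coordinates into indicators
  equates the masses of boxes.\<close>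

lemma multivariate_levy:
  fixes V :: "nat \<Rightarrow> 'a \<Rightarrow> real" and V' :: "nat \<Rightarrow> 'b \<Rightarrow> real"
  assumes M: "prob_space M" and N: "prob_space N"
    and V [measurable]: "\<And>i. V i \<in> borel_measurable M" and V' [measurable]: "\<And>i. V' i \<in> borel_measurable N"
    and eq: "\<And>t. (\<integral>x. iexp (\<Sum>i<n. t i * V i x) \<partial>M) = (\<integral>x. iexp (\<Sum>i<n. t i * V' i x) \<partial>N)"
  shows "distr M (PiM {..<n} (\<lambda>_. borel)) (\<lambda>x. \<lambda>i\<in>{..<n}. V i x) = distr N (PiM {..<n} (\<lambda>_. borel)) (\<lambda>x. \<lambda>i\<in>{..<n}. V' i x)"
    (is "?P = ?Q")
proof (rule measure_eqI_PiM_finite)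
  interpret M: prob_space M by fact
  interpret N: prob_space N by fact
  fix A :: "nat \<Rightarrow> real set"
  assume A: "\<And>i. i \<in> {..<n} \<Longrightarrow> A i \<in> sets borel"
  \<comment> \<open>\<open>multivariate_levy_step\<close> asks for measurable sets at all indices,
    so \<open>UNIV\<close> fills those outside the range.\<close>
  define A' where "A' i = (if i < n then A i else UNIV)" for i
  have A' [measurable]: "A' i \<in> sets borel" for i using A by (auto simp: A'_def)
  have S: "Pi\<^sub>E {..<n} A \<in> sets (PiM {..<n} (\<lambda>_. borel))" using A by (intro sets_PiM_I_finite) auto
  have ind: "(\<Prod>i<n. indicator (A' i) (z i) :: real) = indicator (Pi\<^sub>E {..<n} A) (\<lambda>i\<in>{..<n}. z i)" for z
  proof (cases "\<forall>i<n. z i \<in> A i")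
    case True
    then show ?thesis by (auto simp: A'_def PiE_def indicator_def)
  next
    case False
    then obtain i where "i < n" "z i \<notin> A i" by blast
    then show ?thesis by (auto simp: A'_def PiE_def Pi_def indicator_def intro!: prod_zero bexI[of _ i])
  qed
  have mM [measurable]: "(\<lambda>x. \<lambda>i\<in>{..<n}. V i x) \<in> measurable M (PiM {..<n} (\<lambda>_. borel))" by measurable
  have mN [measurable]: "(\<lambda>x. \<lambda>i\<in>{..<n}. V' i x) \<in> measurable N (PiM {..<n} (\<lambda>_. borel))" by measurable
  have "complex_of_real (\<integral>x. (\<Prod>i<n. indicator (A' i) (V i x)) \<partial>M) = of_real (\<integral>x. (\<Prod>i<n. indicator (A' i) (V' i x)) \<partial>N)"
    \<comment> \<open>At \<open>k = n\<close> the exponent is an empty sum, so \<open>t\<close> can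
      be \<open>undefined\<close>.\<close>
    using multivariate_levy_step[where k = n and A = A', OF M N V V' eq A' order_refl, of undefined]
    unfolding integral_complex_of_real[symmetric] by simp
  then have "(\<integral>x. indicator (Pi\<^sub>E {..<n} A) (\<lambda>i\<in>{..<n}. V i x) \<partial>M) = (\<integral>x. indicator (Pi\<^sub>E {..<n} A) (\<lambda>i\<in>{..<n}. V' i x) \<partial>N :: real)"
    unfolding ind by (simp only: of_real_eq_iff)
  then have "measure ?P (Pi\<^sub>E {..<n} A) = measure ?Q (Pi\<^sub>E {..<n} A)"
    using integral_distr[OF mM, of "indicator (Pi\<^sub>E {..<n} A) :: _ \<Rightarrow> real"] integral_distr[OF mN, of "indicator (Pi\<^sub>E {..<n} A) :: _ \<Rightarrow> real"] S
    by simp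
  then show "emeasure ?P (Pi\<^sub>E {..<n} A) = emeasure ?Q (Pi\<^sub>E {..<n} A)"
    using M.prob_space_distr[OF mM] N.prob_space_distr[OF mN]
    by (simp add: finite_measure.emeasure_eq_measure prob_space.finite_measure)
next
  interpret M: prob_space M by fact
  have mM: "(\<lambda>x. \<lambda>i\<in>{..<n}. V i x) \<in> measurable M (PiM {..<n} (\<lambda>_. borel))" by measurable
  let ?U = "\<lambda>_::nat. Pi\<^sub>E {..<n} (\<lambda>_. UNIV :: real set)"
  show "range ?U \<subseteq> prod_algebra {..<n} (\<lambda>_. borel)" by (auto intro!: prod_algebraI_finite)
  show "(\<Union>i. ?U i) = space (PiM {..<n} (\<lambda>_. borel))" by (simp add: space_PiM)
  show "emeasure ?P (?U i) \<noteq> \<infinity>" for i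
    using M.prob_space_distr[OF mM] by (simp add: finite_measure.emeasure_eq_measure prob_space.finite_measure)
qed auto

section \<open>The representation theorem\<close>

context spin_random_section begin

lemma pairing_combination:
  assumes u: "\<And>i. i < m \<Longrightarrow> L2_section s (u i)" and \<omega>: "\<omega> \<in> space M"
    and L2: "sq_integrable haar_SO3 (pullback s (\<lambda>x. T x \<omega>))"
  shows "pairing s T (sec_of s (\<lambda>g. \<Sum>i<m. c i * pullback s (u i) g)) \<omega> = (\<Sum>i<m. cnj (c i) * pairing s T (u i) \<omega>)"
proof -
  let ?U = "\<lambda>g. \<Sum>i<m. c i * pullback s (u i) g"
  have U: "sq_integrable haar_SO3 ?U"
    by (intro sq_integrable_sum sq_integrable_scale L2_section_pullback) (simp add: u)
  have spin: "spin_fun s ?U"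
    using L2_section_pullback(2)[OF u] by (auto simp: spin_fun_def sum_distrib_left intro!: sum.cong)
  have X: "sq_integrable haar_SO3 (\<lambda>g. X g \<omega>)" using L2 by (simp add: X_def)
  have "pairing s T (sec_of s ?U) \<omega> = (\<integral>g. X g \<omega> * cnj (pullback s (sec_of s ?U) g) \<partial>haar_SO3)"
    by (rule pairing_eq[OF \<omega> L2_section_sec_of[OF U spin]])
  also have "\<dots> = (\<integral>g. (\<Sum>i<m. cnj (c i) * (X g \<omega> * cnj (pullback s (u i) g))) \<partial>haar_SO3)"
    by (rule Bochner_Integration.integral_cong) (auto simp: pullback_sec_of[OF spin] sum_distrib_left mult_ac)
  also have "\<dots> = (\<Sum>i<m. (\<integral>g. cnj (c i) * (X g \<omega> * cnj (pullback s (u i) g)) \<partial>haar_SO3))"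
    by (rule Bochner_Integration.integral_sum)
       (use u in \<open>auto intro!: integrable_mult_right integrable_l2ip X L2_section_pullback\<close>)
  also have "\<dots> = (\<Sum>i<m. cnj (c i) * pairing s T (u i) \<omega>)"
    by (rule sum.cong) (simp_all add: pairing_eq[OF \<omega> u])
  finally show ?thesis .
qed

lemma L2_section_combination:
  assumes u: "\<And>i. i < m \<Longrightarrow> L2_section s (u i)"
  shows "L2_section s (sec_of s (\<lambda>g. \<Sum>i<m. c i * pullback s (u i) g))"
proof (rule L2_section_sec_of)
  show "sq_integrable haar_SO3 (\<lambda>g. \<Sum>i<m. c i * pullback s (u i) g)"
    by (intro sq_integrable_sum sq_integrable_scale L2_section_pullback) (simp add: u)
  show "spin_fun s (\<lambda>g. \<Sum>i<m. c i * pullback s (u i) g)"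
    using L2_section_pullback(2)[OF u] by (auto simp: spin_fun_def sum_distrib_left intro!: sum.cong)
qed

text \<open>The law of \<open>m\<close> complex variables is handled as that of \<open>2 * m\<close>
  real ones. The value 0 beyond the range gives measurability for every \<open>k\<close>, as
  \<open>multivariate_levy\<close> asks.\<close>

definition re_im :: "nat \<Rightarrow> (nat \<Rightarrow> real^3 \<Rightarrow> bundle_point) \<Rightarrow> nat \<Rightarrow> 'w \<Rightarrow> real" where
  "re_im m u k \<omega> = (if k div 2 < m then
     (if even k then Re (pairing s T (u (k div 2)) \<omega>) else Im (pairing s T (u (k div 2)) \<omega>)) else 0)"

lemma re_im_measurable:
  assumes u: "\<And>i. i < m \<Longrightarrow> L2_section s (u i)"
  shows "re_im m u k \<in> borel_measurable M"
proof (cases "k div 2 < m")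
  case True
  note [measurable] = pairing_measurable[OF u[OF True]]
  show ?thesis unfolding re_im_def[abs_def] using True by simp
qed (simp add: re_im_def[abs_def])

lemma sum_even_odd: "(\<Sum>k<2 * m. F k) = (\<Sum>i<m. F (2 * i) + F (Suc (2 * i)))" for F :: "nat \<Rightarrow> real"
  by (induction m) (auto simp: algebra_simps)

text \<open>The Cramer-Wold device: as \<open>Re (cnj c * y)\<close> is
  \<open>Re c * Re y + Im c * Im y\<close>, every real combination of the coordinates is the real
  part of one pairing with a combined section.\<close>

lemma re_im_char:
  assumes u: "\<And>i. i < m \<Longrightarrow> L2_section s (u i)"
    and L2: "AE \<omega> in M. sq_integrable haar_SO3 (pullback s (\<lambda>x. T x \<omega>))"
  shows "(\<integral>\<omega>. iexp (\<Sum>k<2 * m. t k * re_im m u k \<omega>) \<partial>M)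
    = (\<integral>\<omega>. iexp (Re (pairing s T (sec_of s (\<lambda>g. \<Sum>i<m. Complex (t (2 * i)) (t (Suc (2 * i))) * pullback s (u i) g)) \<omega>)) \<partial>M)"
proof (rule integral_cong_AE)
  note [measurable] = re_im_measurable[OF u] pairing_measurable[OF L2_section_combination[OF u]]
  show "(\<lambda>\<omega>. iexp (\<Sum>k<2 * m. t k * re_im m u k \<omega>)) \<in> borel_measurable M" by measurable
  show "(\<lambda>\<omega>. iexp (Re (pairing s T (sec_of s (\<lambda>g. \<Sum>i<m. Complex (t (2 * i)) (t (Suc (2 * i))) * pullback s (u i) g)) \<omega>))) \<in> borel_measurable M"
    by measurable
  show "AE \<omega> in M. iexp (\<Sum>k<2 * m. t k * re_im m u k \<omega>)
    = iexp (Re (pairing s T (sec_of s (\<lambda>g. \<Sum>i<m. Complex (t (2 * i)) (t (Suc (2 * i))) * pullback s (u i) g)) \<omega>))"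
    using L2 AE_space
  proof eventually_elim
    case (elim \<omega>)
    have "(\<Sum>k<2 * m. t k * re_im m u k \<omega>)
        = (\<Sum>i<m. Re (cnj (Complex (t (2 * i)) (t (Suc (2 * i)))) * pairing s T (u i) \<omega>))"
      unfolding sum_even_odd by (rule sum.cong) (auto simp: re_im_def)
    then show ?case by (simp add: pairing_combination[OF u elim(2,1)])
  qed
qed

lemma joint_law_re_im:
  assumes u: "\<And>i. i < m \<Longrightarrow> L2_section s (u i)"
  shows "joint_law s M T m u = distr (distr M (PiM {..<2 * m} (\<lambda>_. borel)) (\<lambda>\<omega>. \<lambda>k\<in>{..<2 * m}. re_im m u k \<omega>))
    (PiM {..<m} (\<lambda>_. borel)) (\<lambda>x. \<lambda>i\<in>{..<m}. Complex (x (2 * i)) (x (Suc (2 * i))))"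
proof -
  note [measurable] = re_im_measurable[OF u]
  have 1: "(\<lambda>\<omega>. \<lambda>k\<in>{..<2 * m}. re_im m u k \<omega>) \<in> measurable M (PiM {..<2 * m} (\<lambda>_. borel))" by measurable
  have 2: "(\<lambda>x. \<lambda>i\<in>{..<m}. Complex (x (2 * i)) (x (Suc (2 * i)))) \<in> measurable (PiM {..<2 * m} (\<lambda>_. borel)) (PiM {..<m} (\<lambda>_. borel))"
  proof (rule measurable_restrict)
    fix i assume i: "i \<in> {..<m}"
    have [measurable]: "(\<lambda>x. x (2 * i)) \<in> borel_measurable (PiM {..<2 * m} (\<lambda>_. borel :: real measure))"
      "(\<lambda>x. x (Suc (2 * i))) \<in> borel_measurable (PiM {..<2 * m} (\<lambda>_. borel :: real measure))"
      using i by (auto intro!: measurable_component_singleton)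
    show "(\<lambda>x. Complex (x (2 * i)) (x (Suc (2 * i)))) \<in> borel_measurable (PiM {..<2 * m} (\<lambda>_. borel))"
      unfolding Complex_eq by measurable
  qed
  have "(\<lambda>x. \<lambda>i\<in>{..<m}. Complex (x (2 * i)) (x (Suc (2 * i)))) \<circ> (\<lambda>\<omega>. \<lambda>k\<in>{..<2 * m}. re_im m u k \<omega>)
      = (\<lambda>\<omega>. \<lambda>i\<in>{..<m}. pairing s T (u i) \<omega>)"
    by (auto simp: fun_eq_iff re_im_def complex_eq_iff restrict_def)
  then show ?thesis unfolding joint_law_def distr_distr[OF 2 1] by simp
qed

end

text \<open>One value of the characteristic function per section is enough, because sections can be
  scaled and added.\<close>

lemma same_law_of_char:
  assumes "spin_random_section M s T" "spin_random_section N s T'"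
    and L2: "AE \<omega> in M. sq_integrable haar_SO3 (pullback s (\<lambda>x. T x \<omega>))"
      "AE \<omega> in N. sq_integrable haar_SO3 (pullback s (\<lambda>x. T' x \<omega>))"
    and char: "\<And>u. L2_section s u \<Longrightarrow> (\<integral>\<omega>. iexp (Re (pairing s T u \<omega>)) \<partial>M) = (\<integral>\<omega>. iexp (Re (pairing s T' u \<omega>)) \<partial>N)"
  shows "same_law s M T N T'"
  unfolding same_law_def
proof (intro allI impI)
  interpret A: spin_random_section M s T by fact
  interpret B: spin_random_section N s T' by fact
  fix m :: nat and u :: "nat \<Rightarrow> real^3 \<Rightarrow> bundle_point"
  assume "\<forall>i<m. L2_section s (u i)"
  then have u: "\<And>i. i < m \<Longrightarrow> L2_section s (u i)" by simp
  have mA: "A.re_im m u k \<in> borel_measurable M" and mB: "B.re_im m u k \<in> borel_measurable N" for k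
    by (rule A.re_im_measurable, erule u) (rule B.re_im_measurable, erule u)
  have "(\<integral>\<omega>. iexp (\<Sum>k<2 * m. t k * A.re_im m u k \<omega>) \<partial>M) = (\<integral>\<omega>. iexp (\<Sum>k<2 * m. t k * B.re_im m u k \<omega>) \<partial>N)" for t
  proof -
    let ?u = "sec_of s (\<lambda>g. \<Sum>i<m. Complex (t (2 * i)) (t (Suc (2 * i))) * pullback s (u i) g)"
    have "(\<integral>\<omega>. iexp (\<Sum>k<2 * m. t k * A.re_im m u k \<omega>) \<partial>M) = (\<integral>\<omega>. iexp (Re (pairing s T ?u \<omega>)) \<partial>M)"
      by (rule A.re_im_char[OF _ L2(1)]) (rule u)
    also have "\<dots> = (\<integral>\<omega>. iexp (Re (pairing s T' ?u \<omega>)) \<partial>N)"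
      by (rule char, rule A.L2_section_combination) (rule u)
    also have "\<dots> = (\<integral>\<omega>. iexp (\<Sum>k<2 * m. t k * B.re_im m u k \<omega>) \<partial>N)"
      by (rule B.re_im_char[OF _ L2(2), symmetric]) (rule u)
    finally show ?thesis .
  qed
  from multivariate_levy[OF A.prob_space_axioms B.prob_space_axioms mA mB this]
  have "distr M (PiM {..<2 * m} (\<lambda>_. borel)) (\<lambda>\<omega>. \<lambda>k\<in>{..<2 * m}. A.re_im m u k \<omega>)
      = distr N (PiM {..<2 * m} (\<lambda>_. borel)) (\<lambda>\<omega>. \<lambda>k\<in>{..<2 * m}. B.re_im m u k \<omega>)" .
  then show "joint_law s M T m u = joint_law s N T' m u"
    using A.joint_law_re_im[of m u] B.joint_law_re_im[of m u] u by simp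
qed

theorem theorem9p3p2:
  fixes s :: int
    and M :: "'w measure" and T :: "real^3 \<Rightarrow> 'w \<Rightarrow> bundle_point"
    and N :: "'v measure" and e :: "nat \<Rightarrow> real^3^3 \<Rightarrow> real" and \<xi> :: "nat \<Rightarrow> 'v \<Rightarrow> real"
  assumes "s \<noteq> 0"
    and "real_onb_SO3 e" and "iid_std_normal N \<xi>"
    and "random_section s M T"
    and "sq_integrable_random_section s M T"
    and "isotropic s M T"
    and "complex_gaussian_section s M T"
  shows "(\<exists>f. represents s M T N e \<xi> f) \<and>
         (\<not> (AE \<omega> in M. AE x in S2_measure. fiber_norm s (T x \<omega>) = 0) \<longrightarrow>
          (\<exists>f f'. represents s M T N e \<xi> f \<and> represents s M T N e \<xi> f' \<and>
                  \<not> (AE g in haar_SO3. f g = f' g)))"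
proof -
  have "prob_space M" using assms(4) by (simp add: random_section_def)
  then have "spin_random_section M s T"
    by (intro spin_random_section.intro spin_random_section_axioms.intro assms)
  moreover have "real_onb e" by (intro real_onb.intro assms)
  ultimately interpret gaussian_spin_section M s T e
    by (intro gaussian_spin_section.intro gaussian_spin_section_axioms.intro assms)
  obtain f where f: "sq_integrable haar_SO3 f" "bi_associated s f"
    and form: "\<And>u. L2_section s u \<Longrightarrow> l2sq haar_SO3 (haar.conv (\<lambda>g. cnj (pullback s u g)) f) = l2sq M (pairing s T u)"
    apply (rule root_exists)
    subgoal premises p for f by (rule p(1)) (fact p)+
    done
  \<comment> \<open>Kept general in \<open>h\<close> since it is used for \<open>f\<close> and for
    \<open>-f\<close>. The variance identity \<open>hform\<close> is what connects the kernel with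
    the law of \<open>T\<close>.\<close>
  have rep: "represents s M T N e \<xi> h"
    if h: "sq_integrable haar_SO3 h" "bi_associated s h"
      and hform: "\<And>u. L2_section s u \<Longrightarrow> l2sq haar_SO3 (haar.conv (\<lambda>g. cnj (pullback s u g)) h) = l2sq M (pairing s T u)" for h
  proof -
    have "prob_space N" using assms(3) by (simp add: iid_std_normal_def)
    then have "gaussian_noise e N \<xi>"
      by (rule gaussian_noise.intro[OF real_onb_axioms _ gaussian_noise_axioms.intro[OF assms(3)]])
    then interpret F: noise_field e N \<xi> s h
      by (rule noise_field.intro[OF _ noise_field_axioms.intro[OF h]])
    have "same_law s N T' M T" if T': "is_Tf s N e \<xi> h T'" for T'
    proof (rule same_law_of_char[OF _ spin_random_section_axioms F.Tf_path_L2[OF T']])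
      show "spin_random_section N s T'"
        using F.Tf_random_section[OF T'] F.N.prob_space_axioms by (intro spin_random_section.intro spin_random_section_axioms.intro)
      show "AE \<omega> in M. sq_integrable haar_SO3 (pullback s (\<lambda>x. T x \<omega>))"
        using path_L2 by (simp add: X_def)
      show "(\<integral>\<omega>. iexp (Re (pairing s T' u \<omega>)) \<partial>N) = (\<integral>\<omega>. iexp (Re (pairing s T u \<omega>)) \<partial>M)" if "L2_section s u" for u
        unfolding F.Tf_pairing_char[OF assms(1) T' that] pairing_char[OF that] hform[OF that] ..
    qed
    then show ?thesis unfolding represents_def using h F.Tf_exists by blast
  qed
  have rep_f: "represents s M T N e \<xi> f" by (rule rep[OF f form])
  have rep_minus: "represents s M T N e \<xi> (\<lambda>g. - f g)"
  proof (rule rep)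
    show "sq_integrable haar_SO3 (\<lambda>g. - f g)" using sq_integrable_scale[OF f(1), of "-1"] by simp
    show "bi_associated s (\<lambda>g. - f g)" using f(2) by (simp add: bi_associated_def)
    fix u assume "L2_section s u"
    have "haar.conv v (\<lambda>g. - f g) x = - haar.conv v f x" for v x by (simp add: haar.conv_def)
    then have "l2sq haar_SO3 (haar.conv v (\<lambda>g. - f g)) = l2sq haar_SO3 (haar.conv v f)" for v by (simp add: l2sq_def)
    then show "l2sq haar_SO3 (haar.conv (\<lambda>g. cnj (pullback s u g)) (\<lambda>g. - f g)) = l2sq M (pairing s T u)"
      using form[OF \<open>L2_section s u\<close>] by simp
  qed
  \<comment> \<open>Agreement of \<open>f\<close> and \<open>-f\<close> almost everywhere forces
    \<open>f = 0\<close> almost everywhere, so all variances vanish and \<open>degenerate\<close>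
    applies.\<close>
  have "AE \<omega> in M. AE x in S2_measure. fiber_norm s (T x \<omega>) = 0" if ae: "AE g in haar_SO3. f g = - f g"
  proof (rule degenerate)
    fix u assume u: "L2_section s u"
    have "l2sq haar_SO3 f = (\<integral>g. 0 \<partial>haar_SO3)"
      unfolding l2sq_def
    proof (rule integral_cong_AE)
      show "AE g in haar_SO3. (norm (f g))\<^sup>2 = 0"
        using ae
      proof eventually_elim
        case (elim g)
        then have "f g + f g = 0" by (simp only: eq_neg_iff_add_eq_0)
        then show ?case by (simp flip: mult_2)
      qed
    qed (use f(1) in auto)
    then have "l2sq haar_SO3 f = 0" by simp
    moreover have "l2sq haar_SO3 (haar.conv (\<lambda>g. cnj (pullback s u g)) f) \<le> l2sq haar_SO3 (\<lambda>g. cnj (pullback s u g)) * l2sq haar_SO3 f"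
      by (rule haar.l2sq_conv[OF _ f(1)]) (use L2_section_pullback(1)[OF u] in simp)
    ultimately show "l2sq M (pairing s T u) = 0"
      using form[OF u] l2sq_nonneg[of M "pairing s T u"] by (simp del: l2sq_nonneg)
  qed
  with rep_f rep_minus show ?thesis by blast
qed

end
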